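(* Let $A$ be a sectorial operator on a complex Banach space $X$ which admits an $H^\infty(\Sigma_\sigma)$-calculus, and let $F\in H^\infty(\Sigma_\rho;\mathcal A)$ for some $\rho>\sigma$. Suppose that the set $\{F(z):z\in\Sigma_\rho\}$ is U-bounded. Then $F\in\mathcal H(A;\mathcal A)$, i.e. $\sup_n\|(\varphi_nF)(A)\|<\infty$, so that $F(A)$ is defined as a bounded operator.
   Context: $\Sigma_\sigma=\{z\ne0:|\arg z|<\sigma\}$. $A$ is sectorial of type $\omega\in[0,\pi)$: closed, densely defined, injective with dense range, $R(\lambda,A)$ exists for $|\arg\lambda|>\omega$ and $\sup_{|\arg\lambda|\ge\sigma}\|\lambda R(\lambda,A)\|<\infty$ for each $\sigma\in(\omega,\pi)$. For scalar $f$ with $|f(z)|\le C(|z|/(1+|z|^2))^\epsilon$ on $\Sigma_\sigma$ ($\sigma>\omega$), $f(A)=\frac1{2\pi i}\int_{\partial\Sigma_\nu}f(\lambda)R(\lambda,A)d\lambda$ ($\omega<\nu<\sigma$, $\partial\Sigma_\nu$ oriented from $\infty e^{i\nu}$ through $0$ to $\infty e^{-i\nu}$); $A$ admits an $H^\infty(\Sigma_\sigma)$-calculus if $\|f(A)\|\le C\sup_{\Sigma_\sigma}|f|$ for all such $f$. $\mathcal A$ is the algebra of bounded operators commuting with all $R(\lambda,A)$. $H^\infty(\Sigma_\rho;\mathcal A)$ is the space of bounded $F:\Sigma_\rho\to\mathcal A$ with $z\mapsto F(z)x$ analytic for each $x\in X$. Let $\varphi_n(z)=\frac{n}{n+z}-\frac1{1+nz}$;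 for $F\in H^\infty(\Sigma_\rho;\mathcal A)$, $(\varphi_nF)(A)x=\frac1{2\pi i}\int_{\partial\Sigma_\nu}\varphi_n(\lambda)F(\lambda)R(\lambda,A)x\,d\lambda$. By definition $F\in\mathcal H(A;\mathcal A)$ if $\sup_n\|(\varphi_nF)(A)\|<\infty$; then $F(A)$ is the strong limit of $(\varphi_nF)(A)$. A family $\mathcal F\subset\mathcal L(X)$ is U-bounded with constant $C$ if for all $n$, $x_k\in X$, $x_k^*\in X^*$, $T_k\in\mathcal F$: $\sum_{k=1}^n|\langle T_kx_k,x_k^*\rangle|\le C\max_{\epsilon_k=\pm1}\|\sum_k\epsilon_kx_k\|\max_{\epsilon_k=\pm1}\|\sum_k\epsilon_kx_k^*\|$. *)

theory Defs
  imports "HOL-Analysis.Analysis"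
begin

class complex_banach = banach +
  fixes cscale :: "complex \<Rightarrow> 'a \<Rightarrow> 'a"
  assumes cscale_add_right: "cscale a (x + y) = cscale a x + cscale a y"
    and cscale_add_left: "cscale (a + b) x = cscale a x + cscale b x"
    and cscale_cscale: "cscale a (cscale b x) = cscale (a * b) x"
    and cscale_of_real: "cscale (complex_of_real r) x = r *\<^sub>R x"
    and norm_cscale: "norm (cscale a x) = cmod a * norm x"

definition bop :: "('a::complex_banach \<Rightarrow> 'a) \<Rightarrow> bool" where
  "bop T \<longleftrightarrow> bounded_linear T \<and> (\<forall>c x. T (cscale c x) = cscale c (T x))"

definition dual_elem :: "('a::complex_banach \<Rightarrow> complex) \<Rightarrow> bool" where
  "dual_elem f \<longleftrightarrow> bounded_linear f \<and> (\<forall>c x. f (cscale c x) = c * f x)"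

definition sector :: "real \<Rightarrow> complex set" where
  "sector s = {z. z \<noteq> 0 \<and> \<bar>Arg z\<bar> < s}"

text \<open>An (unbounded) operator is given by its domain D and its action A on D.\<close>

definition in_resolvent :: "'a::complex_banach set \<Rightarrow> ('a \<Rightarrow> 'a) \<Rightarrow> complex \<Rightarrow> bool" where
  "in_resolvent D A l \<longleftrightarrow>
     (\<forall>x. \<exists>!y. y \<in> D \<and> cscale l y - A y = x) \<and>
     bounded_linear (\<lambda>x. THE y. y \<in> D \<and> cscale l y - A y = x)"

definition resolv :: "'a::complex_banach set \<Rightarrow> ('a \<Rightarrow> 'a) \<Rightarrow> complex \<Rightarrow> 'a \<Rightarrow> 'a" where
  "resolv D A l x = (THE y. y \<in> D \<and> cscale l y - A y = x)"

definition sectorial :: "'a::complex_banach set \<Rightarrow> ('a \<Rightarrow> 'a) \<Rightarrow> real \<Rightarrow> bool" where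
  "sectorial D A \<omega> \<longleftrightarrow>
     0 \<le> \<omega> \<and> \<omega> < pi \<and>
     0 \<in> D \<and> (\<forall>x\<in>D. \<forall>y\<in>D. x + y \<in> D) \<and> (\<forall>c. \<forall>x\<in>D. cscale c x \<in> D) \<and>
     (\<forall>x\<in>D. \<forall>y\<in>D. A (x + y) = A x + A y) \<and> (\<forall>c. \<forall>x\<in>D. A (cscale c x) = cscale c (A x)) \<and>
     closed {(x, A x) | x. x \<in> D} \<and>
     closure D = UNIV \<and>
     inj_on A D \<and>
     closure (A ` D) = UNIV \<and>
     (\<forall>l. l \<noteq> 0 \<and> \<bar>Arg l\<bar> > \<omega> \<longrightarrow> in_resolvent D A l) \<and>
     (\<forall>s. \<omega> < s \<and> s < pi \<longrightarrow>
        (\<exists>C. \<forall>l. l \<noteq> 0 \<and> \<bar>Arg l\<bar> \<ge> s \<longrightarrow>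
               (\<forall>x. norm (cscale l (resolv D A l x)) \<le> C * norm x)))"

text \<open>For an operator-valued integrand g (g l applied to R(l,A)x), this is
  (1/(2 pi i)) times the integral over the boundary of the sector of angle nu, oriented from
  infinity e^{i nu} through 0 to infinity e^{-i nu}, parametrised by t > 0 as t e^{\<plusminus> i nu}.\<close>

definition sect_int ::
  "'a::complex_banach set \<Rightarrow> ('a \<Rightarrow> 'a) \<Rightarrow> real \<Rightarrow> (complex \<Rightarrow> 'a \<Rightarrow> 'a) \<Rightarrow> 'a \<Rightarrow> 'a" where
  "sect_int D A \<nu> g x =
     cscale (1 / (2 * complex_of_real pi * \<i>))
       (integral {0<..}
         (\<lambda>t::real. cscale (cis (- \<nu>)) (g (of_real t * cis (- \<nu>)) (resolv D A (of_real t * cis (- \<nu>)) x))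
                   - cscale (cis \<nu>) (g (of_real t * cis \<nu>) (resolv D A (of_real t * cis \<nu>) x))))"

definition scalar_calc :: "'a::complex_banach set \<Rightarrow> ('a \<Rightarrow> 'a) \<Rightarrow> real \<Rightarrow> (complex \<Rightarrow> complex) \<Rightarrow> 'a \<Rightarrow> 'a" where
  "scalar_calc D A \<nu> f = sect_int D A \<nu> (\<lambda>l y. cscale (f l) y)"

definition decaying_on :: "real \<Rightarrow> (complex \<Rightarrow> complex) \<Rightarrow> bool" where
  "decaying_on s f \<longleftrightarrow> f holomorphic_on sector s \<and>
     (\<exists>C eps. eps > 0 \<and> (\<forall>z\<in>sector s. cmod (f z) \<le> C * (cmod z / (1 + (cmod z)\<^sup>2)) powr eps))"

definition Hinf_calculus :: "'a::complex_banach set \<Rightarrow> ('a \<Rightarrow> 'a) \<Rightarrow> real \<Rightarrow> real \<Rightarrow> bool" where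
  "Hinf_calculus D A \<omega> \<sigma> \<longleftrightarrow> \<omega> < \<sigma> \<and> \<sigma> < pi \<and>
     (\<exists>C. \<forall>f \<nu>. decaying_on \<sigma> f \<longrightarrow> \<omega> < \<nu> \<longrightarrow> \<nu> < \<sigma> \<longrightarrow>
        (\<forall>x. norm (scalar_calc D A \<nu> f x) \<le> C * (SUP z\<in>sector \<sigma>. cmod (f z)) * norm x))"

definition comm_alg :: "'a::complex_banach set \<Rightarrow> ('a \<Rightarrow> 'a) \<Rightarrow> ('a \<Rightarrow> 'a) set" where
  "comm_alg D A = {T. bop T \<and> (\<forall>l. in_resolvent D A l \<longrightarrow> T \<circ> resolv D A l = resolv D A l \<circ> T)}"

definition vec_holomorphic_on :: "(complex \<Rightarrow> 'a::complex_banach) \<Rightarrow> complex set \<Rightarrow> bool" where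
  "vec_holomorphic_on g S \<longleftrightarrow> (\<forall>z\<in>S. \<exists>v. (g has_derivative (\<lambda>h. cscale h v)) (at z))"

definition Hinf_op :: "'a::complex_banach set \<Rightarrow> ('a \<Rightarrow> 'a) \<Rightarrow> real \<Rightarrow> (complex \<Rightarrow> 'a \<Rightarrow> 'a) \<Rightarrow> bool" where
  "Hinf_op D A \<rho> F \<longleftrightarrow>
     (\<forall>z\<in>sector \<rho>. F z \<in> comm_alg D A) \<and>
     (\<exists>C. \<forall>z\<in>sector \<rho>. \<forall>x. norm (F z x) \<le> C * norm x) \<and>
     (\<forall>x. vec_holomorphic_on (\<lambda>z. F z x) (sector \<rho>))"

definition phi :: "nat \<Rightarrow> complex \<Rightarrow> complex" where
  "phi n z = of_nat n / (of_nat n + z) - 1 / (1 + of_nat n * z)"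

definition phiF_calc :: "'a::complex_banach set \<Rightarrow> ('a \<Rightarrow> 'a) \<Rightarrow> real \<Rightarrow> nat \<Rightarrow> (complex \<Rightarrow> 'a \<Rightarrow> 'a) \<Rightarrow> 'a \<Rightarrow> 'a" where
  "phiF_calc D A \<nu> n F = sect_int D A \<nu> (\<lambda>l y. cscale (phi n l) (F l y))"

definition sign_seqs :: "nat \<Rightarrow> (nat \<Rightarrow> real) set" where
  "sign_seqs n = {e. \<forall>k<n. e k = 1 \<or> e k = -1}"

definition U_bounded :: "('a::complex_banach \<Rightarrow> 'a) set \<Rightarrow> bool" where
  "U_bounded \<F> \<longleftrightarrow> (\<exists>C. \<forall>n xs xds Ts.
      (\<forall>k<n. Ts k \<in> \<F> \<and> dual_elem (xds k)) \<longrightarrow>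
      (\<Sum>k<n. cmod (xds k (Ts k (xs k))))
        \<le> C * (SUP e\<in>sign_seqs n. norm (\<Sum>k<n. e k *\<^sub>R xs k))
            * (SUP e\<in>sign_seqs n. onorm (\<lambda>x. \<Sum>k<n. complex_of_real (e k) * xds k x)))"

end

theory Submission
  imports Defs "HOL-Complex_Analysis.Cauchy_Integral_Theorem"
begin

text \<open>Write \<open>\<psi>\<^sub>N = \<Sum>\<^sub>k m (z / b\<^sub>k)\<close>, \<open>b\<^sub>k = 2\<^sup>k / 2\<^sup>N\<close>, for a telescoping sum of rational bumps that is uniformly
  bounded on the sector and tends to \<open>1\<close>; it suffices to bound the integral of \<open>\<psi>\<^sub>N \<phi>\<^sub>n F R(\<sqdot>, A) x\<close>.
  By the resolvent identity and Cauchy's theorem, rational factors of \<open>m\<close> may be moved from \<open>\<lambda>\<close> to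
  \<open>A\<close> under the integral sign. After rescaling the \<open>k\<close>-th integral by \<open>b\<^sub>k\<close>, the integrand at a point \<open>\<mu>\<close> of
  the ray is a sum of terms \<open>\<langle>F (b\<^sub>k \<mu>) g\<^sub>\<mu> (A / b\<^sub>k) x, h (A / b\<^sub>k)\<^sup>* x\<^sup>*\<rangle>\<close> in which \<open>g\<^sub>\<mu>\<close> and \<open>h\<close> are rational and
  decay at \<open>0\<close> and \<open>\<infinity>\<close>. U-boundedness estimates this sum by the norms of \<open>\<Sum>\<^sub>k \<plusminus> g\<^sub>\<mu> (A / b\<^sub>k)\<close> and
  \<open>\<Sum>\<^sub>k \<plusminus> h (A / b\<^sub>k)\<close>, and the scalar calculus bounds those by \<open>sup\<^sub>z \<Sum>\<^sub>k \<bar>g\<^sub>\<mu> (z / b\<^sub>k)\<bar>\<close> and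
  \<open>sup\<^sub>z \<Sum>\<^sub>k \<bar>h (z / b\<^sub>k)\<bar>\<close>. The result is integrable in \<open>\<mu>\<close>, uniformly in \<open>N\<close> and \<open>n\<close>.\<close>

text \<open>U-boundedness needs an operator decaying at both ends on each side of the pairing,
  whereas the integrand contains the single factor \<open>R l x\<close>. The second-order zeros of
  the bump supply the missing one. Moving a factor from the variable to \<open>A\<close> costs error
  terms that contain no resolvent in the variable; they are holomorphic in the whole sector and
  integrate to zero. Every function of \<open>A\<close> that occurs is a signed sum of differences
  of \<open>m / (m - z)\<close>, so its calculus is evaluated explicitly, and signs cost nothing
  beyond a sum of absolute values. The dyadic sum for \<open>g\<close> grows like
  \<open>(1 + s) / sqrt s\<close> with \<open>s = cmod \<mu>\<close>, since one pole of
  \<open>g\<close> moves with \<open>\<mu>\<close>; the rest of the bump decays like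
  \<open>(1 + s)^(-2)\<close>, leaving \<open>1 / (sqrt s * (1 + s))\<close>. The supremum over
  \<open>sector \<sigma>\<close> requires this pole outside that sector, so the estimate is made at
  an angle above \<open>\<sigma>\<close> and transferred to all other angles by Cauchy's theorem.
  Integrals are tested against functionals of norm at most one; a norming functional, obtained from
  Hahn-Banach, returns the norm.\<close>

section \<open>The Hahn--Banach theorem\<close>

definition sublinear :: "('a::real_vector \<Rightarrow> real) \<Rightarrow> bool" where
  "sublinear p \<longleftrightarrow> (\<forall>x y. p (x + y) \<le> p x + p y) \<and> (\<forall>t\<ge>0. \<forall>x. p (t *\<^sub>R x) = t * p x)"

lemma sublinearD:
  assumes "sublinear p"
  shows "p (x + y) \<le> p x + p y" "t \<ge> 0 \<Longrightarrow> p (t *\<^sub>R x) = t * p x" "p 0 = 0" "- p (- x) \<le> p x"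
proof -
  show add: "p (x + y) \<le> p x + p y" for x y using assms by (auto simp: sublinear_def)
  show sc: "t \<ge> 0 \<Longrightarrow> p (t *\<^sub>R x) = t * p x" for t x using assms by (auto simp: sublinear_def)
  show z: "p 0 = 0" using sc[of 0 0] by simp
  show "- p (- x) \<le> p x" using add[of x "-x"] z by simp
qed

text \<open>The infimum is finite because \<open>- p (- x) \<le> - q (- x) \<le> q x\<close>. The
  chain condition gives subadditivity: the smaller \<open>s\<close> of \<open>q\<close> and
  \<open>r\<close> satisfies \<open>s x + s y \<le> q x + r y\<close>.\<close>

lemma sublinear_INF_chain:
  assumes ne: "C \<noteq> {}" and sub: "\<And>q. q \<in> C \<Longrightarrow> sublinear q"
    and le: "\<And>q x. q \<in> C \<Longrightarrow> q x \<le> p x"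
    and chain: "\<And>q r. q \<in> C \<Longrightarrow> r \<in> C \<Longrightarrow> q \<le> r \<or> r \<le> q"
  shows "sublinear (\<lambda>x. INF q\<in>C. q x)" and "q \<in> C \<Longrightarrow> (INF q\<in>C. q x) \<le> q x"
proof -
  have bdd: "bdd_below ((\<lambda>q. q x) ` C)" for x
  proof (rule bdd_belowI2)
    show "- p (- x) \<le> q x" if "q \<in> C" for q
      using sublinearD(4)[OF sub[OF that], of x] le[OF that, of "-x"] by linarith
  qed
  show low: "(INF q\<in>C. q x) \<le> q x" if "q \<in> C" for q x
    using cINF_lower[OF bdd that] .
  have add: "(INF q\<in>C. q (x + y)) \<le> (INF q\<in>C. q x) + (INF q\<in>C. q y)" for x y
  proof -
    have "(INF q\<in>C. q (x + y)) - q x \<le> r y" if qr: "q \<in> C" "r \<in> C" for q r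
    proof -
      obtain s where s: "s \<in> C" "s \<le> q" "s \<le> r"
        using chain[OF qr] qr by auto
      have "(INF q\<in>C. q (x + y)) \<le> s x + s y"
        using low[OF s(1), of "x + y"] sublinearD(1)[OF sub[OF s(1)], of x y] by linarith
      also have "\<dots> \<le> q x + r y" using s by (intro add_mono) (auto simp: le_fun_def)
      finally show ?thesis by simp
    qed
    then have "(INF q\<in>C. q (x + y)) - q x \<le> (INF r\<in>C. r y)" if "q \<in> C" for q
      using that ne by (intro cINF_greatest) auto
    then have "(INF q\<in>C. q (x + y)) - (INF r\<in>C. r y) \<le> q x" if "q \<in> C" for q
      using that by (simp add: algebra_simps)
    then have "(INF q\<in>C. q (x + y)) - (INF r\<in>C. r y) \<le> (INF q\<in>C. q x)"
      using ne by (intro cINF_greatest) auto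
    then show ?thesis by simp
  qed
  have half: "t * (INF q\<in>C. q x) \<le> (INF q\<in>C. q (t *\<^sub>R x))" if "t \<ge> 0" for t x
    using that ne low by (intro cINF_greatest) (auto simp: sublinearD(2)[OF sub] intro!: mult_left_mono)
  have sc: "(INF q\<in>C. q (t *\<^sub>R x)) = t * (INF q\<in>C. q x)" if t: "t \<ge> 0" for t x
  proof (cases "t = 0")
    case True
    then show ?thesis using ne by (simp add: sublinearD(3)[OF sub] cong: INF_cong_simp)
  next
    case False
    then have "t * (1/t * (INF q\<in>C. q (t *\<^sub>R x))) \<le> t * (INF q\<in>C. q x)"
      using half[of "1/t" "t *\<^sub>R x"] t by (intro mult_left_mono) auto
    then show ?thesis using half[OF t, of x] False by simp
  qed
  show "sublinear (\<lambda>x. INF q\<in>C. q x)" using add sc by (auto simp: sublinear_def)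
qed

text \<open>Zorn's lemma for the reversed pointwise order; the pointwise infimum of a chain is its
  bound.\<close>

lemma minimal_sublinear_exists:
  assumes "sublinear p"
  obtains m where "sublinear m" "m \<le> p" "\<And>q. sublinear q \<Longrightarrow> q \<le> m \<Longrightarrow> q = m"
proof -
  let ?A = "{q. sublinear q \<and> q \<le> p}"
  let ?P = "\<lambda>f g. (g :: 'a \<Rightarrow> real) \<le> f"
  have "\<exists>m\<in>?A. \<forall>a\<in>?A. ?P m a \<longrightarrow> a = m"
  proof (rule predicate_Zorn)
    show "partial_order_on ?A (relation_of ?P ?A)"
      by (rule partial_order_on_relation_ofI) auto
    fix C assume C: "C \<in> Chains (relation_of ?P ?A)"
    then have CA: "q \<in> ?A" if "q \<in> C" for q
      using that unfolding Chains_def relation_of_def by blast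
    have chain: "q \<le> r \<or> r \<le> q" if "q \<in> C" "r \<in> C" for q r
      using that C unfolding Chains_def relation_of_def by blast
    show "\<exists>u\<in>?A. \<forall>a\<in>C. ?P a u"
    proof (cases "C = {}")
      case True
      then show ?thesis using assms by auto
    next
      case False
      have le: "q x \<le> p x" if "q \<in> C" for q x using CA[OF that] by (auto simp: le_fun_def)
      have sub: "sublinear q" if "q \<in> C" for q using CA[OF that] by auto
      have "sublinear (\<lambda>x. INF q\<in>C. q x)"
        by (rule sublinear_INF_chain(1)[OF False, of p]) (use sub le chain in auto)
      moreover have low: "(INF q\<in>C. q x) \<le> q x" if "q \<in> C" for q x
        by (rule sublinear_INF_chain(2)[OF False, of p]) (use sub le chain that in auto)
      moreover have "(INF q\<in>C. q x) \<le> p x" for x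
        using False low le by (metis all_not_in_conv order_trans)
      ultimately show ?thesis by (intro bexI[of _ "\<lambda>x. INF q\<in>C. q x"]) (auto simp: le_fun_def)
    qed
  qed
  then obtain m where "m \<in> ?A" "\<And>a. a \<in> ?A \<Longrightarrow> a \<le> m \<Longrightarrow> a = m" by blast
  then show ?thesis using that by (metis (mono_tags, lifting) mem_Collect_eq order_trans)
qed

text \<open>The shift lies below \<open>p\<close> (take \<open>t = 0\<close>) and is at most
  \<open>- p y\<close> at \<open>- y\<close> (take \<open>t = 1\<close>). The first fact lets it
  compete with a minimal functional, the second forces functionals below it to be large at
  \<open>y\<close>.\<close>

lemma sublinear_shift:
  assumes p: "sublinear p"
  shows "sublinear (\<lambda>x. INF t\<in>{0..}. p (x + t *\<^sub>R y) - t * p y)" (is "sublinear ?q")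
    and "t \<ge> 0 \<Longrightarrow> (INF t\<in>{0..}. p (x + t *\<^sub>R y) - t * p y) \<le> p (x + t *\<^sub>R y) - t * p y"
proof -
  note add = sublinearD(1)[OF p] and sc = sublinearD(2)[OF p]
  have bdd: "bdd_below ((\<lambda>t. p (x + t *\<^sub>R y) - t * p y) ` {0..})" for x
  proof (rule bdd_belowI2)
    fix t :: real assume "t \<in> {0..}"
    then have "t * p y \<le> p (x + t *\<^sub>R y) + p (- x)"
      using add[of "x + t *\<^sub>R y" "- x"] sc[of t y] by simp
    then show "- p (- x) \<le> p (x + t *\<^sub>R y) - t * p y" by simp
  qed
  show low: "(INF t\<in>{0..}. p (x + t *\<^sub>R y) - t * p y) \<le> p (x + t *\<^sub>R y) - t * p y"
    if "t \<ge> 0" for t x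
    using that by (intro cINF_lower[OF bdd]) auto
  have "?q (x + z) \<le> ?q x + ?q z" for x z
  proof -
    have "?q (x + z) - (p (x + s *\<^sub>R y) - s * p y) \<le> p (z + t *\<^sub>R y) - t * p y"
      if "s \<ge> 0" "t \<ge> 0" for s t
    proof -
      have "?q (x + z) \<le> p ((x + z) + (s + t) *\<^sub>R y) - (s + t) * p y"
        using that by (intro low) auto
      also have "(x + z) + (s + t) *\<^sub>R y = (x + s *\<^sub>R y) + (z + t *\<^sub>R y)"
        by (simp add: scaleR_left_distrib)
      finally show ?thesis using add[of "x + s *\<^sub>R y" "z + t *\<^sub>R y"] by (simp add: algebra_simps)
    qed
    then have "?q (x + z) - (p (x + s *\<^sub>R y) - s * p y) \<le> ?q z" if "s \<ge> 0" for s
      using that by (intro cINF_greatest) auto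
    then have "?q (x + z) - ?q z \<le> p (x + s *\<^sub>R y) - s * p y" if "s \<ge> 0" for s
      using that by (force simp: algebra_simps)
    then have "?q (x + z) - ?q z \<le> ?q x" by (intro cINF_greatest) auto
    then show ?thesis by simp
  qed
  moreover
  have half: "c * ?q x \<le> ?q (c *\<^sub>R x)" if "c > 0" for c x
  proof (rule cINF_greatest)
    fix t :: real assume t: "t \<in> {0..}"
    have "c * ?q x \<le> c * (p (x + (t/c) *\<^sub>R y) - (t/c) * p y)"
      using that t by (intro mult_left_mono low) auto
    also have "\<dots> = p (c *\<^sub>R (x + (t/c) *\<^sub>R y)) - t * p y"
      using that sc[of c] by (simp add: right_diff_distrib)
    also have "\<dots> = p (c *\<^sub>R x + t *\<^sub>R y) - t * p y"
      using that by (simp add: scaleR_right_distrib)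
    finally show "c * ?q x \<le> p (c *\<^sub>R x + t *\<^sub>R y) - t * p y" .
  qed auto
  have "?q (c *\<^sub>R x) = c * ?q x" if "c \<ge> 0" for c x
  proof (cases "c = 0")
    case True
    have "(\<lambda>t. p (c *\<^sub>R x + t *\<^sub>R y) - t * p y) ` {0..} = {0}"
      using True by (auto simp: sc image_iff)
    then show ?thesis using True by simp
  next
    case False
    then have "c * (1/c * ?q (c *\<^sub>R x)) \<le> c * ?q x"
      using half[of "1/c" "c *\<^sub>R x"] that by (intro mult_left_mono) auto
    then show ?thesis using half[of c x] False that by simp
  qed
  ultimately show "sublinear ?q" by (auto simp: sublinear_def)
qed

text \<open>A minimal sublinear functional coincides with all of its shifts, which forces additivity.\<close>

lemma minimal_sublinear_linear:
  fixes m :: "'a::real_vector \<Rightarrow> real"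
  assumes m: "sublinear m" and min: "\<And>q. sublinear q \<Longrightarrow> q \<le> m \<Longrightarrow> q = m"
  shows "linear m"
proof -
  have add: "m (x + y) = m x + m y" for x y
  proof -
    let ?q = "\<lambda>x. INF t\<in>{0..}. m (x + t *\<^sub>R y) - t * m y"
    note low = sublinear_shift(2)[OF m, of _ _ y]
    have "?q \<le> m" using low[of 0] by (auto simp: le_fun_def)
    then have "?q = m" by (rule min[OF sublinear_shift(1)[OF m]])
    then have "m x \<le> m (x + y) - m y" using low[of 1 x] by (auto simp: fun_eq_iff)
    then show ?thesis using sublinearD(1)[OF m, of x y] by simp
  qed
  have neg: "m (- x) = - m x" for x using add[of x "-x"] sublinearD(3)[OF m] by simp
  have "m (t *\<^sub>R x) = t * m x" for t x
  proof (cases "t \<ge> 0")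
    case False
    then have "m ((- t) *\<^sub>R x) = - t * m x" using sublinearD(2)[OF m, of "-t" x] by simp
    then show ?thesis using neg[of "t *\<^sub>R x"] by simp
  qed (rule sublinearD(2)[OF m])
  then show ?thesis by (intro linearI) (auto simp: add)
qed

text \<open>A minimal functional \<open>f\<close> is chosen below the shift of the norm along
  \<open>y\<close>, not merely below the norm. Then \<open>f (- y) \<le> - norm y\<close>, which by
  linearity is the lower bound for \<open>f y\<close>.\<close>

lemma real_norming_functional:
  fixes y :: "'a::real_normed_vector"
  obtains f :: "'a \<Rightarrow> real" where "linear f" "\<And>x. f x \<le> norm x" "f y = norm y"
proof -
  have "sublinear (norm :: 'a \<Rightarrow> real)"
    by (auto simp: sublinear_def norm_triangle_ineq)
  note shift = sublinear_shift[OF this, where y=y]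
  let ?q = "\<lambda>x. INF t\<in>{0..}. norm (x + t *\<^sub>R y) - t * norm y"
  obtain f where f: "sublinear f" "f \<le> ?q" "\<And>q. sublinear q \<Longrightarrow> q \<le> f \<Longrightarrow> q = f"
    using minimal_sublinear_exists[OF shift(1)] by blast
  have lin: "linear f" by (rule minimal_sublinear_linear[OF f(1,3)])
  have le: "f x \<le> ?q x" for x using f(2) by (auto simp: le_fun_def)
  have bd: "f x \<le> norm x" for x using le[of x] shift(2)[of 0 x] by simp
  have "f y \<ge> norm y"
    using le[of "-y"] shift(2)[of 1 "-y"] linear_neg[OF lin, of y] by simp
  with bd[of y] have "f y = norm y" by simp
  then show ?thesis using bd lin that by blast
qed

section \<open>Complex scalar multiplication\<close>

lemma cscale_one [simp]: "cscale 1 x = x"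
  using cscale_of_real[of 1 x] by simp

lemma bounded_bilinear_cscale: "bounded_bilinear (cscale :: complex \<Rightarrow> 'a::complex_banach \<Rightarrow> 'a)"
proof
  fix r :: real and a :: complex and x :: 'a
  show "cscale (r *\<^sub>R a) x = r *\<^sub>R cscale a x"
    by (simp add: cscale_cscale scaleR_conv_of_real flip: cscale_of_real)
  show "cscale a (r *\<^sub>R x) = r *\<^sub>R cscale a x"
    by (simp add: cscale_cscale mult.commute flip: cscale_of_real)
  show "\<exists>K. \<forall>a (x::'a). norm (cscale a x) \<le> norm a * norm x * K"
    by (intro exI[of _ 1]) (simp add: norm_cscale)
qed (rule cscale_add_left cscale_add_right)+

interpretation cscale: bounded_bilinear cscale
  by (rule bounded_bilinear_cscale)

lemma bounded_linear_cscale [simp, intro]: "bounded_linear (cscale c)"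
  by (rule cscale.bounded_linear_right)

lemma bop_cscale: "bop (cscale c)"
  by (auto simp: bop_def cscale_cscale mult.commute)

lemma bop_imp_linear: "bop T \<Longrightarrow> linear T"
  by (simp add: bop_def bounded_linear.linear)

lemma bop_compose: "bop S \<Longrightarrow> bop T \<Longrightarrow> bop (\<lambda>x. S (T x))"
  by (auto simp: bop_def intro: bounded_linear_compose)

lemma bop_diff: "bop S \<Longrightarrow> bop T \<Longrightarrow> bop (\<lambda>x. S x - T x)"
  by (auto simp: bop_def cscale.diff_right intro: bounded_linear_sub)

lemma bop_simps:
  assumes "bop T"
  shows "T (x + y) = T x + T y" "T (x - y) = T x - T y" "T 0 = 0" "T (- x) = - T x"
    "T (cscale c x) = cscale c (T x)"
  using assms bop_imp_linear[OF assms] by (auto simp: bop_def linear_add linear_diff linear_0 linear_neg)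

lemma dual_elem_simps:
  assumes "dual_elem f"
  shows "f (x + y) = f x + f y" "f (x - y) = f x - f y" "f 0 = 0" "f (- x) = - f x"
    "f (cscale c x) = c * f x" "f (\<Sum>i\<in>I. g i) = (\<Sum>i\<in>I. f (g i))"
proof -
  have "linear f" using assms by (simp add: dual_elem_def bounded_linear.linear)
  then show "f (x + y) = f x + f y" "f (x - y) = f x - f y" "f 0 = 0" "f (- x) = - f x"
    "f (cscale c x) = c * f x" "f (\<Sum>i\<in>I. g i) = (\<Sum>i\<in>I. f (g i))"
    using assms by (auto simp: dual_elem_def linear_add linear_diff linear_0 linear_neg linear_sum)
qed

lemma dual_elem_compose: "dual_elem f \<Longrightarrow> bop T \<Longrightarrow> dual_elem (\<lambda>x. f (T x))"
  by (auto simp: bop_def dual_elem_def intro: bounded_linear_compose)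

text \<open>Complexification: \<open>f x = g x - \<i> * g (\<i> x)\<close> has real part
  \<open>g\<close>. The bound for \<open>cmod (f x)\<close> follows from that of \<open>g\<close>
  after rotating \<open>x\<close> until \<open>f x\<close> is a nonnegative real.\<close>

lemma norming_functional:
  fixes y :: "'a::complex_banach"
  obtains f where "dual_elem f" "\<And>x. cmod (f x) \<le> norm x" "f y = of_real (norm y)"
proof -
  obtain g :: "'a \<Rightarrow> real" where g: "linear g" "\<And>x. g x \<le> norm x" "g y = norm y"
    using real_norming_functional by blast
  note lin = linear_add[OF g(1)] linear_neg[OF g(1)] linear_scale[OF g(1)] linear_diff[OF g(1)]
  define f where "f = (\<lambda>x. Complex (g x) (- g (cscale \<i> x)))"
  have split: "cscale c x = Re c *\<^sub>R x + Im c *\<^sub>R cscale \<i> x" for c and x :: 'a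
  proof -
    have "cscale c x = cscale (of_real (Re c)) x + cscale (of_real (Im c) * \<i>) x"
      by (subst complex_eq[of c]) (simp only: cscale_add_left mult.commute)
    then show ?thesis by (simp only: cscale_cscale[symmetric] cscale_of_real)
  qed
  have ii: "cscale \<i> (cscale \<i> x) = - x" for x :: 'a
    using cscale_of_real[of "-1" x] by (simp add: cscale_cscale)
  have add: "f (x + z) = f x + f z" for x z
    by (simp add: f_def lin cscale_add_right complex_eq_iff)
  have sc: "f (cscale c x) = c * f x" for c x
  proof -
    have 1: "g (cscale c x) = Re c * g x + Im c * g (cscale \<i> x)"
      by (simp add: split[of c] lin)
    have 2: "g (cscale \<i> (cscale c x)) = Re c * g (cscale \<i> x) - Im c * g x"
      by (simp add: split[of c] lin cscale_add_right cscale.scaleR_right ii)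
    show ?thesis by (simp add: f_def complex_eq_iff 1 2 algebra_simps)
  qed
  have bound: "cmod (f x) \<le> norm x" for x
  proof (cases "f x = 0")
    case False
    define c where "c = cnj (f x) / cmod (f x)"
    have "cmod c = 1" using False by (simp add: c_def norm_divide)
    have "f (cscale c x) = cmod (f x)"
      using False by (simp add: sc c_def complex_norm_square[symmetric] mult.commute[of "cnj _"] power2_eq_square)
    then have "cmod (f x) = g (cscale c x)" by (simp add: f_def complex_eq_iff)
    also have "\<dots> \<le> norm (cscale c x)" by (rule g)
    finally show ?thesis by (simp add: norm_cscale \<open>cmod c = 1\<close>)
  qed simp
  have lf: "bounded_linear f"
  proof (rule bounded_linear_intro[of _ 1])
    show "f (r *\<^sub>R x) = r *\<^sub>R f x" for r x
      using sc[of "of_real r" x] by (simp add: cscale_of_real scaleR_conv_of_real)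
  qed (auto simp: add bound)
  \<comment> \<open>The real part already equals \<open>norm y\<close>, and
    \<open>cmod (f y) \<le> norm y\<close> leaves no room for an imaginary part.\<close>
  have "f y = of_real (norm y)"
  proof -
    have re: "Re (f y) = norm y" by (simp add: f_def g)
    then have "(Re (f y))\<^sup>2 + (Im (f y))\<^sup>2 \<le> (norm y)\<^sup>2"
      using power_mono[OF bound[of y], of 2] by (simp add: cmod_power2)
    then have "Im (f y) = 0" by (simp add: re)
    with re show ?thesis by (simp add: complex_eq_iff)
  qed
  with lf bound sc show ?thesis using that by (auto simp: dual_elem_def)
qed

lemma dual_separates:
  fixes x y :: "'a::complex_banach"
  assumes "\<And>f. dual_elem f \<Longrightarrow> f x = f y"
  shows "x = y"
proof -
  obtain f where "dual_elem f" "f (x - y) = of_real (norm (x - y))"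
    using norming_functional by blast
  then show ?thesis using assms[of f] by (simp add: dual_elem_simps)
qed

section \<open>Integrals over the half-line and rotation of rays\<close>

text \<open>An improper fundamental theorem that asks only for limits of the antiderivative.
  Absolute convergence is not assumed: on a single ray \<open>1 / (m - z)\<close> is not integrable,
  only the difference of two rays is.\<close>

lemma has_integral_Ioi_antiderivative:
  fixes Q :: "real \<Rightarrow> 'a::banach"
  assumes der: "\<And>t. t > 0 \<Longrightarrow> (Q has_vector_derivative f t) (at t)"
    and top: "(Q \<longlongrightarrow> L) at_top" and bot: "(Q \<longlongrightarrow> l) (at_right 0)"
  shows "(f has_integral (L - l)) {0<..}"
proof -
  let ?g = "\<lambda>x. if x \<in> {0<..} then f x else 0"
  \<comment> \<open>Filling in the limit at \<open>0\<close> makes the antiderivative continuous on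
    the closed interval.\<close>
  define Q' where "Q' t = (if t \<le> 0 then l else Q t)" for t
  have der': "(Q' has_vector_derivative f t) (at t)" if "t > 0" for t
    by (rule has_vector_derivative_transform_within_open[OF der[OF that], of "{0<..}"])
       (use that in \<open>auto simp: Q'_def\<close>)
  have ftc: "(?g has_integral (Q b - l)) {a..b}" if ab: "a \<le> 0" "0 < b" for a b
  proof -
    have "continuous (at t within {0..b}) Q'" if "t \<in> {0..b}" for t
    proof (cases "t = 0")
      case True
      have "(Q' \<longlongrightarrow> l) (at_right 0)"
        by (rule Lim_transform_eventually[OF bot]) (auto simp: Q'_def eventually_at_filter)
      then have "(Q' \<longlongrightarrow> Q' 0) (at 0 within {0..b})"
        using ab by (simp add: Q'_def at_within_Icc_at_right)
      then show ?thesis using True by (simp add: continuous_within)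
    next
      case False
      then show ?thesis
        using der'[of t] that by (auto intro: continuous_at_imp_continuous_within has_vector_derivative_continuous)
    qed
    then have "(f has_integral (Q' b - Q' 0)) {0..b}"
      using ab der' by (intro fundamental_theorem_of_calculus_interior) (auto simp: continuous_on_eq_continuous_within)
    then have "(f has_integral (Q b - l)) {0..b}" using ab by (simp add: Q'_def)
    moreover have "(f has_integral (Q b - l)) {0..b} \<longleftrightarrow> (f has_integral (Q b - l)) {0<..b}"
      by (rule has_integral_spike_set_eq; rule negligible_subset[of "{0}"]) auto
    ultimately have "((\<lambda>x. if x \<in> {0<..b} then f x else 0) has_integral (Q b - l)) {a..b}"
      using ab by (subst has_integral_restrict) auto
    then show ?thesis by (rule has_integral_eq[rotated]) auto
  qed
  show ?thesis
    unfolding has_integral_alt'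
  proof (intro conjI allI impI)
    fix a b :: real
    have "?g integrable_on {min a 0..max b 1}" by (intro has_integral_integrable[OF ftc]) auto
    then show "?g integrable_on cbox a b"
      using integrable_on_subinterval[of ?g "{min a 0..max b 1}" a b] by simp
  next
    fix e :: real assume "e > 0"
    then have "eventually (\<lambda>b. dist (Q b) L < e) at_top" by (rule tendstoD[OF top])
    then obtain B where B: "\<And>b. b \<ge> B \<Longrightarrow> dist (Q b) L < e" by (auto simp: eventually_at_top_linorder)
    show "\<exists>B>0. \<forall>a b. ball 0 B \<subseteq> cbox a b \<longrightarrow> norm (integral (cbox a b) ?g - (L - l)) < e"
    proof (intro exI[of _ "max B 1 + 1"] conjI allI impI)
      fix a b :: real assume sub: "ball 0 (max B 1 + 1) \<subseteq> cbox a b"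
      have "max B 1 \<in> ball 0 (max B 1 + 1)" by (simp add: dist_norm)
      moreover have "(- 1 :: real) \<in> ball 0 (max B 1 + 1)" by (simp add: dist_norm)
      ultimately have "max B 1 \<in> cbox a b" "- 1 \<in> cbox a b" using sub by blast+
      then have ab: "a \<le> 0" "0 < b" "B \<le> b" by auto
      show "norm (integral (cbox a b) ?g - (L - l)) < e"
        using integral_unique[OF ftc[OF ab(1,2)]] B[OF ab(3)] by (simp add: dist_norm)
    qed auto
  qed
qed

lemma tendsto_of_controlled_increments:
  fixes P :: "real \<Rightarrow> 'a::banach" and G :: "real \<Rightarrow> real"
  assumes le: "\<And>s t. 0 < s \<Longrightarrow> 0 < t \<Longrightarrow> norm (P t - P s) \<le> \<bar>G t - G s\<bar>"
    and G: "(G \<longlongrightarrow> c) F" and F: "F \<noteq> bot" "eventually (\<lambda>t. t > 0) F"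
  shows "\<exists>L. (P \<longlongrightarrow> L) F"
proof -
  have "\<exists>Q. eventually Q F \<and> (\<forall>x y. Q x \<and> Q y \<longrightarrow> dist (P x) (P y) < e)" if "e > 0" for e
  proof (intro exI[of _ "\<lambda>t. dist (G t) c < e/2 \<and> t > 0"] conjI allI impI)
    show "eventually (\<lambda>t. dist (G t) c < e/2 \<and> t > 0) F"
      using tendstoD[OF G, of "e/2"] F(2) that by (simp add: eventually_conj_iff)
    fix s t assume *: "(dist (G s) c < e/2 \<and> s > 0) \<and> (dist (G t) c < e/2 \<and> t > 0)"
    then have "norm (P s - P t) \<le> \<bar>G s - G t\<bar>" by (intro le) auto
    also have "\<dots> < e" using * by (auto simp: dist_real_def abs_if split: if_splits)
    finally show "dist (P s) (P t) < e" by (simp add: dist_norm)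
  qed
  then have "cauchy_filter (filtermap P F)" by (simp add: cauchy_filter_metric_filtermap)
  moreover have "filtermap P F \<noteq> bot" using F by (simp add: filtermap_bot_iff)
  ultimately obtain L where "filtermap P F \<le> nhds L"
    using cauchy_filter_complete_converges[of "filtermap P F" UNIV] by (auto simp: complete_UNIV)
  then show ?thesis by (auto simp: filterlim_def)
qed

text \<open>The majorant has the antiderivative \<open>- C / (1 + t)\<close>, which converges at
  both ends. It controls the increments of a primitive of \<open>f\<close>, so by completeness the
  primitive converges too. This works directly for Banach-valued \<open>f\<close>.\<close>

lemma integrable_Ioi_decay:
  fixes f :: "real \<Rightarrow> 'a::banach"
  assumes cont: "continuous_on {0<..} f" and le: "\<And>t. t > 0 \<Longrightarrow> norm (f t) \<le> C / (1 + t)\<^sup>2"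
  shows "f integrable_on {0<..}"
proof -
  \<comment> \<open>The signed integral from \<open>1\<close> to \<open>t\<close>; whichever of the
    two intervals is reversed contributes \<open>0\<close>.\<close>
  define P where "P t = integral {1..t} f - integral {t..1} f" for t
  have int: "f integrable_on {a..b}" if "a > 0" for a b
    by (rule integrable_continuous_real, rule continuous_on_subset[OF cont]) (use that in auto)
  have P_eq: "P t = integral {a..t} f - integral {a..1} f" if "0 < a" "a \<le> t" "a \<le> 1" for a t
  proof (cases "t \<le> 1")
    case True
    then have "integral {a..t} f + integral {t..1} f = integral {a..1} f"
      using that by (intro Henstock_Kurzweil_Integration.integral_combine int) auto
    moreover have "integral {1..t} f = 0" using True by (cases "t = 1") auto
    ultimately show ?thesis by (simp add: P_def algebra_simps)
  next
    case False
    then have "integral {a..1} f + integral {1..t} f = integral {a..t} f"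
      using that by (intro Henstock_Kurzweil_Integration.integral_combine int) auto
    then show ?thesis using False by (simp add: P_def algebra_simps)
  qed
  have der: "(P has_vector_derivative f t) (at t)" if "t > 0" for t
  proof -
    define a where "a = min t 1 / 2"
    have a: "0 < a" "a < t" "a \<le> 1" using that by (auto simp: a_def)
    have "((\<lambda>u. integral {a..u} f) has_vector_derivative f t) (at t within {a..t+1})"
      by (rule integral_has_vector_derivative, rule continuous_on_subset[OF cont]) (use a in auto)
    then have "((\<lambda>u. integral {a..u} f) has_vector_derivative f t) (at t)"
      using a by (simp add: at_within_Icc_at)
    then have "((\<lambda>u. integral {a..u} f - integral {a..1} f) has_vector_derivative f t) (at t)"
      by (rule iffD2[OF has_vector_derivative_diff_const])
    then show ?thesis
      by (rule has_vector_derivative_transform_within_open[of _ _ _ "{a<..}"]) (use a P_eq in auto)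
  qed
  let ?G = "\<lambda>t. - C / (1 + t)"
  have G': "(?G has_vector_derivative C / (1 + t)\<^sup>2) (at t)" if "t > 0" for t
    unfolding has_real_derivative_iff_has_vector_derivative[symmetric]
    using that by (auto intro!: derivative_eq_intros simp: power2_eq_square)
  have mono: "norm (P t - P s) \<le> ?G t - ?G s" if "0 < s" "s < t" for s t
  proof (rule differentiable_bound_general[OF that(2)])
    show "continuous_on {s..t} P"
      by (intro continuous_at_imp_continuous_on ballI has_vector_derivative_continuous[OF der]) (use that in auto)
    show "continuous_on {s..t} ?G"
      by (intro continuous_at_imp_continuous_on ballI has_vector_derivative_continuous[OF G']) (use that in auto)
    show "(P has_vector_derivative f u) (at u)" if "s < u" for u using that \<open>0 < s\<close> by (intro der) auto
    show "(?G has_vector_derivative C / (1 + u)\<^sup>2) (at u)" if "s < u" for u using that \<open>0 < s\<close> by (intro G') auto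
    show "norm (f u) \<le> C / (1 + u)\<^sup>2" if "s < u" for u using that \<open>0 < s\<close> by (intro le) auto
  qed
  have incr: "norm (P t - P s) \<le> \<bar>?G t - ?G s\<bar>" if "0 < s" "0 < t" for s t
    using mono[of s t] mono[of t s] that by (cases s t rule: linorder_cases) (auto simp: norm_minus_commute)
  have lim: "\<exists>L. (P \<longlongrightarrow> L) F" if "(?G \<longlongrightarrow> c) F" "F \<noteq> bot" "eventually (\<lambda>t. t > 0) F" for c F
    by (rule tendsto_of_controlled_increments[OF incr that])
  have "(?G \<longlongrightarrow> 0) at_top"
    by (intro tendsto_divide_0[OF tendsto_const] filterlim_at_top_imp_at_infinity filterlim_tendsto_add_at_top[OF tendsto_const] filterlim_ident)
  then obtain L where L: "(P \<longlongrightarrow> L) at_top"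
    using lim[OF _ trivial_limit_at_top_linorder eventually_gt_at_top] by blast
  have "(?G \<longlongrightarrow> - C / (1 + 0)) (at_right 0)" by (intro tendsto_intros) auto
  then obtain l where l: "(P \<longlongrightarrow> l) (at_right 0)"
    using lim[OF _ trivial_limit_at_right_real eventually_at_right_less] by blast
  show ?thesis using has_integral_Ioi_antiderivative[OF der L l] by (auto simp: integrable_on_def)
qed

text \<open>In the logarithmic variable the sector becomes a convex strip, on which the integrand
  \<open>h (exp w) * exp w\<close> has a primitive \<open>G\<close>. The difference of
  \<open>G\<close> at the two angles is an antiderivative of the ray difference, and its limits are
  the arc contributions: \<open>z * h z\<close> tends to \<open>\<kappa>\<close> at infinity and to
  \<open>0\<close> at the origin.\<close>

lemma ray_rotation:
  assumes range: "- pi \<le> \<alpha>" "\<alpha> < \<nu>1" "\<nu>1 \<le> \<nu>2" "\<nu>2 < \<beta>" "\<beta> \<le> pi"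
    and hol: "h holomorphic_on {z. z \<noteq> 0 \<and> \<alpha> < Arg z \<and> Arg z < \<beta>}"
    and infty: "\<And>z. z \<noteq> 0 \<Longrightarrow> \<nu>1 \<le> Arg z \<Longrightarrow> Arg z \<le> \<nu>2 \<Longrightarrow> cmod (z * h z - \<kappa>) \<le> C / cmod z"
    and zero: "\<And>z. z \<noteq> 0 \<Longrightarrow> \<nu>1 \<le> Arg z \<Longrightarrow> Arg z \<le> \<nu>2 \<Longrightarrow> cmod (z * h z) \<le> C * cmod z"
  shows "((\<lambda>t. h (of_real t * cis \<nu>1) * cis \<nu>1 - h (of_real t * cis \<nu>2) * cis \<nu>2)
    has_integral (\<i> * \<kappa> * (of_real \<nu>1 - of_real \<nu>2))) {0<..}"
proof -
  define S where "S = {w. \<alpha> < Im w \<and> Im w < \<beta>}"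
  have S: "convex S" "open S"
    unfolding S_def Collect_conj_eq
    by (rule convex_Int[OF convex_halfspace_Im_gt convex_halfspace_Im_lt],
        rule open_Int[OF open_halfspace_Im_gt open_halfspace_Im_lt])
  define K where "K = (\<lambda>w. h (exp w) * exp w)"
  have Arg: "Arg (exp w) = Im w" if "w \<in> S" for w
    using that range by (intro Arg_exp) (auto simp: S_def)
  have "K holomorphic_on S"
  proof -
    have "(h \<circ> exp) holomorphic_on S"
      by (rule holomorphic_on_compose_gen[OF holomorphic_on_exp hol]) (use Arg in \<open>auto simp: S_def\<close>)
    then show ?thesis unfolding K_def o_def by (intro holomorphic_on_mult holomorphic_on_exp)
  qed
  then obtain G where G: "\<And>w. w \<in> S \<Longrightarrow> (G has_field_derivative K w) (at w within S)"
    using holomorphic_convex_primitive'[OF S] by blast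
  then have G: "(G has_field_derivative K w) (at w)" if "w \<in> S" for w
    using G[OF that] at_within_open[OF that S(2)] by simp
  define p where "p = (\<lambda>\<theta> t. of_real (ln t) + \<i> * of_real \<theta>)"
  have exp_p: "exp (p \<theta> t) = of_real t * cis \<theta>" if "t > 0" for \<theta> t
    using that by (simp add: p_def exp_add cis_conv_exp exp_of_real)
  have pS: "p \<theta> t \<in> S" if "\<nu>1 \<le> \<theta>" "\<theta> \<le> \<nu>2" for \<theta> t
    using that range by (auto simp: S_def p_def)
  define Q where "Q t = G (p \<nu>1 t) - G (p \<nu>2 t)" for t
  have der1: "((\<lambda>t. G (p \<theta> t)) has_vector_derivative h (of_real t * cis \<theta>) * cis \<theta>) (at t)"
    if "t > 0" "\<nu>1 \<le> \<theta>" "\<theta> \<le> \<nu>2" for \<theta> t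
  proof -
    have "((\<lambda>t. p \<theta> t) has_vector_derivative of_real (1/t)) (at t)"
      unfolding p_def using that(1)
      by (intro has_vector_derivative_add_const[THEN iffD2] has_vector_derivative_of_real has_real_derivative_iff_has_vector_derivative[THEN iffD1] DERIV_ln_divide)
    from field_vector_diff_chain_at[OF this G[OF pS[OF that(2,3)]]]
    show ?thesis using that(1) exp_p[OF that(1)] by (simp add: o_def K_def)
  qed
  have der: "(Q has_vector_derivative (h (of_real t * cis \<nu>1) * cis \<nu>1 - h (of_real t * cis \<nu>2) * cis \<nu>2)) (at t)"
    if "t > 0" for t
    unfolding Q_def using that range by (intro derivative_intros der1) auto
  have seg: "\<exists>\<theta>. w = p \<theta> t \<and> \<nu>1 \<le> \<theta> \<and> \<theta> \<le> \<nu>2" if w: "w \<in> closed_segment (p \<nu>2 t) (p \<nu>1 t)" for w t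
  proof -
    obtain u where u: "0 \<le> u" "u \<le> 1" "w = (1 - u) *\<^sub>R p \<nu>2 t + u *\<^sub>R p \<nu>1 t"
      using w unfolding in_segment by blast
    have "w = p ((1 - u) * \<nu>2 + u * \<nu>1) t"
      unfolding u by (simp add: p_def complex_eq_iff algebra_simps)
    moreover have "0 \<le> (1 - u) * (\<nu>2 - \<nu>1)" "0 \<le> u * (\<nu>2 - \<nu>1)" using u range by auto
    then have "\<nu>1 \<le> (1 - u) * \<nu>2 + u * \<nu>1" "(1 - u) * \<nu>2 + u * \<nu>1 \<le> \<nu>2" by (auto simp: algebra_simps)
    ultimately show ?thesis by blast
  qed
  have dist_p: "p \<nu>1 t - p \<nu>2 t = \<i> * (of_real \<nu>1 - of_real \<nu>2)" for t
    by (simp add: p_def algebra_simps)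
  \<comment> \<open>The function \<open>G w - k * w\<close> has derivative
    \<open>z * h z - k\<close> with \<open>z = exp w\<close>, so the mean value inequality along the
    arc of radius \<open>t\<close> compares \<open>Q t\<close> with the expected limit.\<close>
  have bound: "norm (Q t - \<i> * k * (of_real \<nu>1 - of_real \<nu>2)) \<le> B * \<bar>\<nu>1 - \<nu>2\<bar>"
    if "t > 0" and B: "\<And>z. cmod z = t \<Longrightarrow> \<nu>1 \<le> Arg z \<Longrightarrow> Arg z \<le> \<nu>2 \<Longrightarrow> cmod (z * h z - k) \<le> B" for t B k
  proof -
    have "cmod ((G (p \<nu>1 t) - k * p \<nu>1 t) - (G (p \<nu>2 t) - k * p \<nu>2 t)) \<le> B * cmod (p \<nu>1 t - p \<nu>2 t)"
    proof (rule field_differentiable_bound[where S = "closed_segment (p \<nu>2 t) (p \<nu>1 t)"])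
      fix w assume "w \<in> closed_segment (p \<nu>2 t) (p \<nu>1 t)"
      then obtain \<theta> where \<theta>: "w = p \<theta> t" "\<nu>1 \<le> \<theta>" "\<theta> \<le> \<nu>2" using seg by blast
      have w: "w \<in> S" using \<theta> pS by blast
      show "((\<lambda>w. G w - k * w) has_field_derivative (K w - k)) (at w within closed_segment (p \<nu>2 t) (p \<nu>1 t))"
        by (rule has_field_derivative_at_within) (auto intro!: derivative_eq_intros G[OF w])
      have "cmod (exp w) = t" using \<theta> \<open>t > 0\<close> by (simp add: exp_p norm_mult)
      then show "cmod (K w - k) \<le> B"
        using B[of "exp w"] Arg[OF w] \<theta> by (simp add: K_def mult.commute p_def)
    qed auto
    moreover have "(G (p \<nu>1 t) - k * p \<nu>1 t) - (G (p \<nu>2 t) - k * p \<nu>2 t) = Q t - k * (p \<nu>1 t - p \<nu>2 t)"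
      by (simp add: Q_def algebra_simps)
    ultimately show ?thesis
      unfolding dist_p by (simp add: norm_mult mult_ac flip: of_real_diff)
  qed
  have top: "(Q \<longlongrightarrow> \<i> * \<kappa> * (of_real \<nu>1 - of_real \<nu>2)) at_top"
  proof (rule LIM_zero_cancel, rule Lim_null_comparison)
    show "eventually (\<lambda>t. norm (Q t - \<i> * \<kappa> * (of_real \<nu>1 - of_real \<nu>2)) \<le> C / t * \<bar>\<nu>1 - \<nu>2\<bar>) at_top"
      using eventually_gt_at_top[of 0] 
    proof eventually_elim
      case (elim t)
      show ?case by (rule bound[OF elim]) (use infty elim in force)
    qed
    show "((\<lambda>t. C / t * \<bar>\<nu>1 - \<nu>2\<bar>) \<longlongrightarrow> 0) at_top"
      by (intro tendsto_mult_left_zero tendsto_divide_0[OF tendsto_const] filterlim_at_top_imp_at_infinity filterlim_ident)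
  qed
  have "(Q \<longlongrightarrow> 0) (at_right 0)"
  proof (rule Lim_null_comparison)
    show "eventually (\<lambda>t. norm (Q t) \<le> C * t * \<bar>\<nu>1 - \<nu>2\<bar>) (at_right 0)"
      using eventually_at_right_less[of 0]
    proof eventually_elim
      case (elim t)
      have "cmod (z * h z - 0) \<le> C * t" if "cmod z = t" "\<nu>1 \<le> Arg z" "Arg z \<le> \<nu>2" for z
        using zero[of z] that elim by auto
      from bound[OF elim this] show ?case by simp
    qed
    have "((\<lambda>t. C * t * \<bar>\<nu>1 - \<nu>2\<bar>) \<longlongrightarrow> C * 0 * \<bar>\<nu>1 - \<nu>2\<bar>) (at_right 0)" by (intro tendsto_intros)
    then show "((\<lambda>t. C * t * \<bar>\<nu>1 - \<nu>2\<bar>) \<longlongrightarrow> 0) (at_right 0)" by simp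
  qed
  from has_integral_Ioi_antiderivative[OF der top this] show ?thesis by simp
qed

section \<open>Sectors\<close>

lemma abs_Arg_le_pi: "\<bar>Arg z\<bar> \<le> pi"
  using Arg_bounded[of z] by linarith

lemma abs_Arg_minus: "z \<noteq> 0 \<Longrightarrow> \<bar>Arg (- z)\<bar> = pi - \<bar>Arg z\<bar>"
  using Arg_bounded[of z] by (auto simp: Arg_minus abs_if)

text \<open>Law of cosines: the angle between \<open>z\<close> and \<open>w\<close> stays away from
  \<open>0\<close>, hence its cosine is at most some \<open>\<kappa> < 1\<close>.\<close>

lemma sector_separation:
  assumes "0 \<le> a" "a < b"
  obtains c where "0 < c"
    "\<And>z w. z \<noteq> 0 \<Longrightarrow> w \<noteq> 0 \<Longrightarrow> \<bar>Arg z\<bar> \<le> a \<Longrightarrow> b \<le> \<bar>Arg w\<bar> \<Longrightarrow> c * (cmod z + cmod w) \<le> cmod (w - z)"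
proof -
  define b' where "b' = min b pi"
  \<comment> \<open>The truncation matters only for \<open>b - a > pi\<close>, when no
    \<open>w\<close> qualifies but a positive constant must still be produced.\<close>
  define \<kappa> where "\<kappa> = cos (min (b - a) pi)"
  have lt1: "\<kappa> < 1"
    unfolding \<kappa>_def using assms pi_gt_zero cos_monotone_0_pi[of 0 "min (b - a) pi"] by auto
  have "sqrt ((1 - \<kappa>) / 2) * (cmod z + cmod w) \<le> cmod (w - z)"
    if z: "z \<noteq> 0" "w \<noteq> 0" "\<bar>Arg z\<bar> \<le> a" "b \<le> \<bar>Arg w\<bar>" for z w
  proof -
    have ba: "b - a \<le> pi" using assms z(4) abs_Arg_le_pi[of w] by linarith
    define d where "d = \<bar>Arg w - Arg z\<bar>"
    have d: "b - a \<le> d" "d \<le> 2 * pi - (b - a)"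
      using z abs_Arg_le_pi[of w] assms by (auto simp: d_def abs_if split: if_splits)
    have cosd: "cos d \<le> \<kappa>"
    proof (cases "d \<le> pi")
      case True
      then show ?thesis using d ba assms unfolding \<kappa>_def by (intro cos_monotone_0_pi_le) auto
    next
      case False
      have "cos d = cos (2 * pi - d)" by (simp add: cos_diff)
      also have "\<dots> \<le> \<kappa>" using d ba assms False unfolding \<kappa>_def by (intro cos_monotone_0_pi_le) auto
      finally show ?thesis .
    qed
    define r s where "r = cmod z" and "s = cmod w"
    have rs: "r > 0" "s > 0" using z by (auto simp: r_def s_def)
    have zw: "z = of_real r * cis (Arg z)" "w = of_real s * cis (Arg w)"
      using rcis_cmod_Arg by (auto simp: r_def s_def rcis_def)
    have "(cmod (w - z))\<^sup>2 = (s * cos (Arg w) - r * cos (Arg z))\<^sup>2 + (s * sin (Arg w) - r * sin (Arg z))\<^sup>2"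
      by (subst zw(1), subst zw(2)) (simp add: cmod_power2)
    also have "\<dots> = s\<^sup>2 * ((cos (Arg w))\<^sup>2 + (sin (Arg w))\<^sup>2) + r\<^sup>2 * ((cos (Arg z))\<^sup>2 + (sin (Arg z))\<^sup>2)
        - 2 * (r * s) * (cos (Arg w) * cos (Arg z) + sin (Arg w) * sin (Arg z))"
    proof -
      have "(s * c - r * d)\<^sup>2 + (s * e - r * f)\<^sup>2 = s\<^sup>2 * (c\<^sup>2 + e\<^sup>2) + r\<^sup>2 * (d\<^sup>2 + f\<^sup>2) - 2 * (r * s) * (c * d + e * f)"
        for c d e f by (simp add: power2_eq_square algebra_simps)
      then show ?thesis .
    qed
    also have "\<dots> = s\<^sup>2 + r\<^sup>2 - 2 * (r * s) * cos (Arg w - Arg z)"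
      by (simp only: cos_diff sin_cos_squared_add2 mult_1_right)
    also have "cos (Arg w - Arg z) = cos d" by (simp add: d_def)
    finally have 1: "(cmod (w - z))\<^sup>2 = s\<^sup>2 + r\<^sup>2 - 2 * (r * s) * cos d" .
    have "2 * (r * s) * cos d \<le> 2 * (r * s) * \<kappa>" using cosd rs by (intro mult_left_mono) auto
    moreover have "- 1 \<le> \<kappa>" unfolding \<kappa>_def by (rule cos_ge_minus_one)
    \<comment> \<open>This is exactly the gap between \<open>r^2 + s^2 - 2 r s \<kappa>\<close> and
      \<open>(1 - \<kappa>) / 2 * (r + s)^2\<close>.\<close>
    then have "0 \<le> (1 + \<kappa>) / 2 * (r - s)\<^sup>2" by simp
    ultimately have "(1 - \<kappa>) / 2 * (r + s)\<^sup>2 \<le> (cmod (w - z))\<^sup>2"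
      unfolding 1 by (simp add: power2_eq_square field_simps)
    then have "sqrt ((1 - \<kappa>) / 2 * (r + s)\<^sup>2) \<le> cmod (w - z)" by (intro real_le_lsqrt) auto
    then show ?thesis using rs by (simp only: real_sqrt_mult r_def s_def) simp
  qed
  moreover have "sqrt ((1 - \<kappa>) / 2) > 0" using lt1 by simp
  ultimately show ?thesis using that by blast
qed

text \<open>\<open>Arg\<close> jumps across the negative axis; the right-hand side is a comparison
  of continuous functions, from which openness of the outer sector is immediate.\<close>

lemma abs_Arg_gt_iff: "z \<noteq> 0 \<Longrightarrow> 0 \<le> s \<Longrightarrow> s \<le> pi \<Longrightarrow> s < \<bar>Arg z\<bar> \<longleftrightarrow> Re z < cmod z * cos s"
proof -
  assume a: "z \<noteq> 0" "0 \<le> s" "s \<le> pi"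
  have "Re z = cmod z * cos \<bar>Arg z\<bar>"
    using arg_cong[OF rcis_cmod_Arg[of z], of Re] by simp
  then have "Re z < cmod z * cos s \<longleftrightarrow> cos \<bar>Arg z\<bar> < cos s" using a by simp
  also have "\<dots> \<longleftrightarrow> s < \<bar>Arg z\<bar>" using a abs_Arg_le_pi[of z] by (intro cos_mono_less_eq) auto
  finally show ?thesis by simp
qed

lemma open_outer_sector:
  assumes "0 \<le> s" "s \<le> pi"
  shows "open {z. z \<noteq> 0 \<and> s < \<bar>Arg z\<bar>}"
proof -
  have "{z. z \<noteq> 0 \<and> s < \<bar>Arg z\<bar>} = {z. Re z < cmod z * cos s}"
  proof (rule set_eqI)
    fix z show "z \<in> {z. z \<noteq> 0 \<and> s < \<bar>Arg z\<bar>} \<longleftrightarrow> z \<in> {z. Re z < cmod z * cos s}"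
      by (cases "z = 0") (simp_all add: abs_Arg_gt_iff[OF _ assms])
  qed
  then show ?thesis by (simp add: open_Collect_less continuous_intros)
qed

lemma open_sector:
  assumes "s \<le> pi"
  shows "open (sector s)"
proof (cases "s \<le> 0")
  case True
  then have "sector s = {}" by (auto simp: sector_def)
  then show ?thesis by simp
next
  case False
  have "sector s = uminus -` {z. z \<noteq> 0 \<and> pi - s < \<bar>Arg z\<bar>}"
    unfolding sector_def by (auto simp: abs_Arg_minus)
  moreover have "open {z. z \<noteq> 0 \<and> pi - s < \<bar>Arg z\<bar>}" using False assms by (intro open_outer_sector) auto
  ultimately show ?thesis by (simp only: open_vimage continuous_on_minus continuous_on_id)
qed

section \<open>Resolvents\<close>

locale sectorial_operator =
  fixes D :: "'a::complex_banach set" and A :: "'a \<Rightarrow> 'a" and \<omega> :: real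
  assumes sectorial: "sectorial D A \<omega>"
begin

abbreviation "R \<equiv> resolv D A"

definition res_set :: "complex set" where
  "res_set = {l. l \<noteq> 0 \<and> \<omega> < \<bar>Arg l\<bar>}"

text \<open>The value at \<open>A\<close> of the function
  \<open>z \<mapsto> m / (m - z)\<close>.\<close>

definition S :: "complex \<Rightarrow> 'a \<Rightarrow> 'a" where
  "S m x = cscale m (R m x)"

lemma omega: "0 \<le> \<omega>" "\<omega> < pi"
  using sectorial by (auto simp: sectorial_def)

lemma D_closed: "x \<in> D \<Longrightarrow> y \<in> D \<Longrightarrow> x + y \<in> D" "x \<in> D \<Longrightarrow> cscale c x \<in> D"
  and A_linear: "x \<in> D \<Longrightarrow> y \<in> D \<Longrightarrow> A (x + y) = A x + A y" "x \<in> D \<Longrightarrow> A (cscale c x) = cscale c (A x)"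
  using sectorial by (auto simp: sectorial_def)

lemma in_resolvent: "l \<in> res_set \<Longrightarrow> in_resolvent D A l"
  using sectorial by (auto simp: sectorial_def res_set_def)

lemma neg_real_in_res_set: "b > 0 \<Longrightarrow> - complex_of_real b \<in> res_set"
  using omega by (simp add: res_set_def Arg_minus Arg_of_real)

lemma open_res_set: "open res_set"
  unfolding res_set_def using omega by (intro open_outer_sector) auto

lemma resolv_unique: "l \<in> res_set \<Longrightarrow> y \<in> D \<Longrightarrow> cscale l y - A y = x \<Longrightarrow> R l x = y"
  using in_resolvent[of l] unfolding in_resolvent_def resolv_def by (blast intro: the1_equality)

lemma
  assumes "l \<in> res_set"
  shows resolv_in_D: "R l x \<in> D" and resolv_eq: "cscale l (R l x) - A (R l x) = x"
proof -
  have "\<exists>!y. y \<in> D \<and> cscale l y - A y = x" using in_resolvent[OF assms] by (simp add: in_resolvent_def)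
  from theI'[OF this] show "R l x \<in> D" "cscale l (R l x) - A (R l x) = x" by (auto simp: resolv_def)
qed

lemma bop_resolv: "l \<in> res_set \<Longrightarrow> bop (R l)"
proof -
  assume l: "l \<in> res_set"
  have "R l = (\<lambda>x. THE y. y \<in> D \<and> cscale l y - A y = x)" by (auto simp: resolv_def)
  then have "bounded_linear (R l)" using in_resolvent[OF l] by (simp add: in_resolvent_def)
  moreover have "R l (cscale c x) = cscale c (R l x)" for c x
  proof (rule resolv_unique[OF l D_closed(2)[OF resolv_in_D[OF l]]])
    have "cscale l (cscale c (R l x)) - A (cscale c (R l x)) = cscale c (cscale l (R l x) - A (R l x))"
      by (simp add: A_linear resolv_in_D[OF l] cscale.diff_right cscale_cscale mult.commute)
    then show "cscale l (cscale c (R l x)) - A (cscale c (R l x)) = cscale c x" by (simp add: resolv_eq[OF l])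
  qed
  ultimately show ?thesis by (simp add: bop_def)
qed

lemmas resolv_simps = bop_simps[OF bop_resolv]

lemma bop_S: "m \<in> res_set \<Longrightarrow> bop (S m)"
  unfolding S_def by (intro bop_compose[OF bop_cscale bop_resolv])

lemma resolv_A: "l \<in> res_set \<Longrightarrow> y \<in> D \<Longrightarrow> R l (A y) = cscale l (R l y) - y"
  using resolv_unique[of l y "cscale l y - A y"] by (simp add: resolv_simps algebra_simps)

lemma resolvent_identity:
  assumes "l \<in> res_set" "m \<in> res_set"
  shows "R l x - R m x = cscale (m - l) (R l (R m x))"
proof -
  let ?y = "R m x"
  have "R l x = R l (cscale m ?y - A ?y)" by (simp add: resolv_eq[OF assms(2)])
  also have "\<dots> = cscale m (R l ?y) - (cscale l (R l ?y) - ?y)"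
    using assms by (simp add: resolv_simps resolv_A resolv_in_D)
  finally show ?thesis by (simp add: cscale.diff_left)
qed

lemma resolv_commute:
  assumes "l \<in> res_set" "m \<in> res_set"
  shows "R l (R m x) = R m (R l x)"
proof (cases "l = m")
  case False
  have "cscale (m - l) (R l (R m x)) = cscale (m - l) (R m (R l x))"
    using resolvent_identity[OF assms] resolvent_identity[OF assms(2,1)] 
    by (metis cscale.minus_left minus_diff_eq)
  then have "cscale (1 / (m - l)) (cscale (m - l) (R l (R m x))) = cscale (1 / (m - l)) (cscale (m - l) (R m (R l x)))"
    by simp
  then show ?thesis using False by (simp add: cscale_cscale)
qed simp

text \<open>The resolvent identity read as an exchange rule: a factor \<open>m / (m - l)\<close> in
  front of \<open>R l\<close> turns into the operator \<open>S m\<close> behind it, up to a term in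
  which \<open>l\<close> enters only through a scalar.\<close>

lemma cscale_resolv:
  assumes "l \<in> res_set" "m \<in> res_set" "l \<noteq> m"
  shows "cscale (m / (m - l)) (R l x) = R l (S m x) + cscale (1 / (m - l)) (S m x)"
proof -
  have "R l x = R m x + cscale (m - l) (R l (R m x))"
    using resolvent_identity[OF assms(1,2), of x] by (simp add: algebra_simps)
  then have "cscale (m / (m - l)) (R l x)
      = cscale (m / (m - l)) (R m x) + cscale (m / (m - l)) (cscale (m - l) (R l (R m x)))"
    by (metis cscale_add_right)
  also have "\<dots> = cscale (1 / (m - l)) (S m x) + R l (S m x)"
    using assms by (simp add: S_def cscale_cscale resolv_simps)
  finally show ?thesis by (simp add: add.commute)
qed

lemma resolv_bound:
  assumes "\<omega> < s" "s < pi"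
  obtains C where "0 \<le> C" "\<And>l x. l \<noteq> 0 \<Longrightarrow> s \<le> \<bar>Arg l\<bar> \<Longrightarrow> norm (R l x) \<le> C / cmod l * norm x"
proof -
  obtain C where C: "\<And>l x. l \<noteq> 0 \<Longrightarrow> s \<le> \<bar>Arg l\<bar> \<Longrightarrow> norm (cscale l (R l x)) \<le> C * norm x"
  proof -
    have "\<forall>s. \<omega> < s \<and> s < pi \<longrightarrow> (\<exists>C. \<forall>l. l \<noteq> 0 \<and> \<bar>Arg l\<bar> \<ge> s \<longrightarrow> (\<forall>x. norm (cscale l (R l x)) \<le> C * norm x))"
      using sectorial unfolding sectorial_def by (elim conjE)
    with assms have "\<exists>C. \<forall>l. l \<noteq> 0 \<and> \<bar>Arg l\<bar> \<ge> s \<longrightarrow> (\<forall>x. norm (cscale l (R l x)) \<le> C * norm x)" by simp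
    then show ?thesis using that by blast
  qed
  have "norm (R l x) \<le> \<bar>C\<bar> / cmod l * norm x" if "l \<noteq> 0" "s \<le> \<bar>Arg l\<bar>" for l x
  proof -
    have "cmod l * norm (R l x) \<le> C * norm x" using C[OF that, of x] by (simp add: norm_cscale)
    also have "\<dots> \<le> \<bar>C\<bar> * norm x" by (intro mult_right_mono) auto
    finally show ?thesis using that by (simp add: field_simps)
  qed
  then show ?thesis using that[of "\<bar>C\<bar>"] by simp
qed

lemma tendsto_resolv:
  assumes "l \<in> res_set"
  shows "((\<lambda>m. R m x) \<longlongrightarrow> R l x) (at l)"
proof -
  \<comment> \<open>An intermediate angle, so that the sectorial estimate with one constant covers a
    neighbourhood of \<open>l\<close>.\<close>
  define s where "s = (\<omega> + \<bar>Arg l\<bar>) / 2"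
  have s: "\<omega> < s" "s < \<bar>Arg l\<bar>" "l \<noteq> 0" using assms by (auto simp: res_set_def s_def)
  then have "s < pi" using abs_Arg_le_pi[of l] by linarith
  obtain C where C: "0 \<le> C" "\<And>l x. l \<noteq> 0 \<Longrightarrow> s \<le> \<bar>Arg l\<bar> \<Longrightarrow> norm (R l x) \<le> C / cmod l * norm x"
    using resolv_bound[OF s(1) \<open>s < pi\<close>] by blast
  have "eventually (\<lambda>m. m \<in> {z. z \<noteq> 0 \<and> s < \<bar>Arg z\<bar>}) (at l)"
    using s omega abs_Arg_le_pi[of l] by (intro eventually_at_in_open' open_outer_sector) auto
  then have ev: "eventually (\<lambda>m. norm (R m x - R l x) \<le> cmod (l - m) * (C / cmod m * norm (R l x))) (at l)"
  proof eventually_elim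
    case (elim m)
    then have m: "m \<in> res_set" using s by (auto simp: res_set_def)
    have "norm (R m (R l x)) \<le> C / cmod m * norm (R l x)" using elim by (intro C(2)) auto
    then have "cmod (l - m) * norm (R m (R l x)) \<le> cmod (l - m) * (C / cmod m * norm (R l x))"
      by (rule mult_left_mono) simp
    then show ?case unfolding resolvent_identity[OF m assms] norm_cscale .
  qed
  have "((\<lambda>m. cmod (l - m) * (C / cmod m * norm (R l x))) \<longlongrightarrow> cmod (l - l) * (C / cmod l * norm (R l x))) (at l)"
    using s by (intro tendsto_intros) auto
  then have "((\<lambda>m. cmod (l - m) * (C / cmod m * norm (R l x))) \<longlongrightarrow> 0) (at l)" by simp
  with ev have "((\<lambda>m. R m x - R l x) \<longlongrightarrow> 0) (at l)" by (rule Lim_null_comparison)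
  then show ?thesis by (rule LIM_zero_cancel)
qed

lemma continuous_on_resolv: "continuous_on res_set (\<lambda>l. R l x)"
  by (intro continuous_at_imp_continuous_on) (auto simp: isCont_def intro: tendsto_resolv)

lemma has_field_derivative_resolv:
  assumes l: "l \<in> res_set" and f: "dual_elem f"
  shows "((\<lambda>m. f (R m x)) has_field_derivative - f (R l (R l x))) (at l)"
  unfolding has_field_derivative_iff
proof (rule Lim_transform_eventually)
  have "((\<lambda>m. f (R m (R l x))) \<longlongrightarrow> f (R l (R l x))) (at l)"
    using f unfolding dual_elem_def by (intro bounded_linear.tendsto[of f] tendsto_resolv l) auto
  then show "((\<lambda>m. - f (R m (R l x))) \<longlongrightarrow> - f (R l (R l x))) (at l)" by (rule tendsto_minus)
  have "eventually (\<lambda>m. m \<in> res_set) (at l)" using l open_res_set by (rule eventually_at_in_open'[rotated])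
  then show "eventually (\<lambda>m. - f (R m (R l x)) = (f (R m x) - f (R l x)) / (m - l)) (at l)"
    using eventually_neq_at_within[of l l UNIV]
  proof eventually_elim
    case (elim m)
    have "f (R m x) - f (R l x) = (l - m) * f (R m (R l x))"
      using resolvent_identity[OF elim(1) l, of x] f by (simp flip: dual_elem_simps)
    then show ?case using elim by (simp add: field_simps)
  qed
qed

lemma holomorphic_resolv:
  assumes "dual_elem f" "T \<subseteq> res_set"
  shows "(\<lambda>l. f (R l x)) holomorphic_on T"
  unfolding holomorphic_on_def field_differentiable_def
proof (rule ballI, rule exI)
  fix l assume "l \<in> T"
  then show "((\<lambda>l. f (R l x)) has_field_derivative - f (R l (R l x))) (at l within T)"
    using assms by (auto intro!: has_field_derivative_resolv[THEN has_field_derivative_at_within])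
qed

end

section \<open>The functional calculus of differences of resolvents\<close>

text \<open>Each quotient is \<open>1\<close> at \<open>0\<close> and \<open>0\<close> at infinity,
  so the difference decays at both ends and is admissible for the scalar calculus once both poles
  lie outside the sector.\<close>

definition pole_diff :: "complex \<Rightarrow> complex \<Rightarrow> complex \<Rightarrow> complex" where
  "pole_diff z1 z2 z = z1 / (z1 - z) - z2 / (z2 - z)"

lemma pole_diff_eq: "z \<noteq> z1 \<Longrightarrow> z \<noteq> z2 \<Longrightarrow> pole_diff z1 z2 z = z * (z2 - z1) / ((z1 - z) * (z2 - z))"
  by (simp add: pole_diff_def field_simps)

lemma pole_diff_scale: "b \<noteq> 0 \<Longrightarrow> pole_diff (b * z1) (b * z2) z = pole_diff z1 z2 (z / b)"
  by (simp add: pole_diff_def field_simps)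

lemma one_plus_cmod_le: "0 < m \<Longrightarrow> 0 \<le> r \<Longrightarrow> min 1 m * (1 + r) \<le> m + (r::real)"
proof -
  assume *: "0 < m" "0 \<le> r"
  have "min 1 m * r \<le> 1 * r" using * by (intro mult_right_mono) auto
  then show ?thesis by (simp add: algebra_simps)
qed

lemma inverse_pole_bound:
  assumes "0 \<le> a" "a < \<bar>Arg m\<bar>" "m \<noteq> 0"
  obtains C where "0 < C" "\<And>z. z \<noteq> 0 \<Longrightarrow> \<bar>Arg z\<bar> \<le> a \<Longrightarrow> z \<noteq> m \<and> cmod (1 / (m - z)) \<le> C / (1 + cmod z)"
proof -
  obtain c where c: "0 < c"
    "\<And>z w. z \<noteq> 0 \<Longrightarrow> w \<noteq> 0 \<Longrightarrow> \<bar>Arg z\<bar> \<le> a \<Longrightarrow> \<bar>Arg m\<bar> \<le> \<bar>Arg w\<bar> \<Longrightarrow> c * (cmod z + cmod w) \<le> cmod (w - z)"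
    using sector_separation[OF assms(1,2)] by metis
  define k where "k = c * min 1 (cmod m)"
  have k: "k > 0" using c(1) assms(3) by (simp add: k_def)
  have "z \<noteq> m \<and> cmod (1 / (m - z)) \<le> (1/k) / (1 + cmod z)" if "z \<noteq> 0" "\<bar>Arg z\<bar> \<le> a" for z
  proof -
    have "k * (1 + cmod z) = c * (min 1 (cmod m) * (1 + cmod z))" by (simp add: k_def)
    also have "\<dots> \<le> c * (cmod z + cmod m)"
      using one_plus_cmod_le[of "cmod m" "cmod z"] assms(3) c(1) by (intro mult_left_mono) (auto simp: add.commute)
    also have "\<dots> \<le> cmod (m - z)" using c(2)[of z m] that assms(3) by simp
    finally have *: "k * (1 + cmod z) \<le> cmod (m - z)" .
    have "0 < k * (1 + cmod z)" using k by (simp add: add_pos_nonneg)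
    with * have "cmod (1 / (m - z)) \<le> 1 / (k * (1 + cmod z))"
      by (simp add: norm_divide frac_le)
    moreover have "z \<noteq> m" using * \<open>0 < k * (1 + cmod z)\<close> by auto
    ultimately show ?thesis by simp
  qed
  then show ?thesis using that[of "1/k"] k by simp
qed

lemma pole_diff_bound:
  assumes "0 \<le> a" "a < \<bar>Arg z1\<bar>" "z1 \<noteq> 0" "a < \<bar>Arg z2\<bar>" "z2 \<noteq> 0"
  obtains C where "0 \<le> C" "\<And>z. z \<noteq> 0 \<Longrightarrow> \<bar>Arg z\<bar> \<le> a \<Longrightarrow> cmod (pole_diff z1 z2 z) \<le> C * cmod z / (1 + cmod z)\<^sup>2"
proof -
  obtain C1 where C1: "0 < C1" "\<And>z. z \<noteq> 0 \<Longrightarrow> \<bar>Arg z\<bar> \<le> a \<Longrightarrow> z \<noteq> z1 \<and> cmod (1 / (z1 - z)) \<le> C1 / (1 + cmod z)"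
    using inverse_pole_bound[OF assms(1-3)] by metis
  obtain C2 where C2: "0 < C2" "\<And>z. z \<noteq> 0 \<Longrightarrow> \<bar>Arg z\<bar> \<le> a \<Longrightarrow> z \<noteq> z2 \<and> cmod (1 / (z2 - z)) \<le> C2 / (1 + cmod z)"
    using inverse_pole_bound[OF assms(1,4,5)] by metis
  have "cmod (pole_diff z1 z2 z) \<le> (cmod (z2 - z1) * C1 * C2) * cmod z / (1 + cmod z)\<^sup>2"
    if "z \<noteq> 0" "\<bar>Arg z\<bar> \<le> a" for z
  proof -
    have "pole_diff z1 z2 z = (z * (z2 - z1)) * (1 / (z1 - z) * (1 / (z2 - z)))"
      using C1(2)[OF that] C2(2)[OF that] by (simp add: pole_diff_eq)
    then have "cmod (pole_diff z1 z2 z) = (cmod z * cmod (z2 - z1)) * (cmod (1 / (z1 - z)) * cmod (1 / (z2 - z)))"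
      by (simp only: norm_mult)
    also have "\<dots> \<le> (cmod z * cmod (z2 - z1)) * (C1 / (1 + cmod z) * (C2 / (1 + cmod z)))"
      using C1(2)[OF that] C2(2)[OF that] C1(1) C2(1) by (intro mult_left_mono mult_mono) auto
    finally show ?thesis by (simp add: power2_eq_square mult_ac)
  qed
  then show ?thesis using that[of "cmod (z2 - z1) * C1 * C2"] C1(1) C2(1) by simp
qed

lemma pole_diff_decaying:
  assumes "0 < s" "s < \<bar>Arg z1\<bar>" "z1 \<noteq> 0" "s < \<bar>Arg z2\<bar>" "z2 \<noteq> 0"
  obtains C where "0 \<le> C" "\<And>z. z \<in> sector s \<Longrightarrow> cmod (pole_diff z1 z2 z) \<le> C * (cmod z / (1 + (cmod z)\<^sup>2))"
    and "pole_diff z1 z2 holomorphic_on sector s"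
proof -
  obtain C where C: "0 \<le> C" "\<And>z. z \<noteq> 0 \<Longrightarrow> \<bar>Arg z\<bar> \<le> s \<Longrightarrow> cmod (pole_diff z1 z2 z) \<le> C * cmod z / (1 + cmod z)\<^sup>2"
    using pole_diff_bound[of s z1 z2] assms by auto
  have "cmod (pole_diff z1 z2 z) \<le> C * (cmod z / (1 + (cmod z)\<^sup>2))" if "z \<in> sector s" for z
  proof -
    have "cmod (pole_diff z1 z2 z) \<le> C * cmod z / (1 + cmod z)\<^sup>2" using that by (intro C(2)) (auto simp: sector_def)
    also have "\<dots> \<le> C * cmod z / (1 + (cmod z)\<^sup>2)"
      using C(1) by (intro divide_left_mono) (auto simp: power2_sum add_pos_nonneg)
    finally show ?thesis by simp
  qed
  moreover have "z1 - z \<noteq> 0" "z2 - z \<noteq> 0" if "z \<in> sector s" for z using that assms by (auto simp: sector_def)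
  then have "pole_diff z1 z2 holomorphic_on sector s"
    unfolding pole_diff_def by (intro holomorphic_intros) auto
  ultimately show ?thesis using that C(1) by blast
qed

text \<open>The pole lies outside the sector swept by the rotation, so the only contribution is the
  arc at infinity, where \<open>z / (m - z)\<close> tends to \<open>- 1\<close>.\<close>

lemma has_integral_ray_pole:
  assumes "0 < \<nu>" "\<nu> < \<bar>Arg m\<bar>" "m \<noteq> 0"
  shows "((\<lambda>t. 1 / (m - of_real t * cis (- \<nu>)) * cis (- \<nu>) - 1 / (m - of_real t * cis \<nu>) * cis \<nu>)
    has_integral 2 * \<i> * of_real \<nu>) {0<..}"
proof -
  obtain c where c: "0 < c"
    "\<And>z w. z \<noteq> 0 \<Longrightarrow> w \<noteq> 0 \<Longrightarrow> \<bar>Arg z\<bar> \<le> \<nu> \<Longrightarrow> \<bar>Arg m\<bar> \<le> \<bar>Arg w\<bar> \<Longrightarrow> c * (cmod z + cmod w) \<le> cmod (w - z)"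
    using sector_separation[of \<nu> "\<bar>Arg m\<bar>"] assms by (metis less_imp_le)
  define C where "C = cmod m / c + 1 / (c * cmod m)"
  have bounds: "cmod (z * (1 / (m - z)) - (- 1)) \<le> C / cmod z" "cmod (z * (1 / (m - z))) \<le> C * cmod z"
    if z: "z \<noteq> 0" "- \<nu> \<le> Arg z" "Arg z \<le> \<nu>" for z
  proof -
    have sep: "c * (cmod z + cmod m) \<le> cmod (m - z)" using c(2)[of z m] z assms(3) by (auto simp: abs_le_iff)
    have pos: "0 < c * cmod z" "0 < c * cmod m" using c(1) z assms by auto
    then have ge: "c * cmod z \<le> cmod (m - z)" "c * cmod m \<le> cmod (m - z)" "m \<noteq> z"
      using sep by (auto simp: algebra_simps)
    have "z * (1 / (m - z)) - (- 1) = m / (m - z)" using ge by (simp add: field_simps)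
    then have "cmod (z * (1 / (m - z)) - (- 1)) = cmod m / cmod (m - z)" by (simp add: norm_divide)
    also have "\<dots> \<le> cmod m / (c * cmod z)" using ge pos by (intro divide_left_mono) auto
    also have "\<dots> = cmod m / c / cmod z" by simp
    also have "\<dots> \<le> C / cmod z" using pos c by (intro divide_right_mono) (auto simp: C_def)
    finally show "cmod (z * (1 / (m - z)) - (- 1)) \<le> C / cmod z" .
    have "cmod (z * (1 / (m - z))) = cmod z / cmod (m - z)" by (simp add: norm_divide)
    also have "\<dots> \<le> cmod z / (c * cmod m)" using ge pos by (intro divide_left_mono) auto
    also have "\<dots> = 1 / (c * cmod m) * cmod z" by simp
    also have "\<dots> \<le> C * cmod z" using pos c by (intro mult_right_mono) (auto simp: C_def)
    finally show "cmod (z * (1 / (m - z))) \<le> C * cmod z" .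
  qed
  have "((\<lambda>t. 1 / (m - of_real t * cis (- \<nu>)) * cis (- \<nu>) - 1 / (m - of_real t * cis \<nu>) * cis \<nu>)
    has_integral (\<i> * (- 1) * (of_real (- \<nu>) - of_real \<nu>))) {0<..}"
  proof (rule ray_rotation[where h = "\<lambda>z. 1 / (m - z)" and \<alpha> = "- \<bar>Arg m\<bar>" and \<beta> = "\<bar>Arg m\<bar>" and C = C])
    show "(\<lambda>z. 1 / (m - z)) holomorphic_on {z. z \<noteq> 0 \<and> - \<bar>Arg m\<bar> < Arg z \<and> Arg z < \<bar>Arg m\<bar>}"
      by (intro holomorphic_intros) (auto simp: abs_if split: if_splits)
  qed (use assms bounds abs_Arg_le_pi[of m] in auto)
  then show ?thesis by (simp add: algebra_simps)
qed

context sectorial_operator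
begin

definition pole_diff_op :: "complex \<Rightarrow> complex \<Rightarrow> 'a \<Rightarrow> 'a" where
  "pole_diff_op z1 z2 x = S z1 x - S z2 x"

lemma bop_pole_diff_op: "z1 \<in> res_set \<Longrightarrow> z2 \<in> res_set \<Longrightarrow> bop (pole_diff_op z1 z2)"
  unfolding pole_diff_op_def by (intro bop_diff bop_S)

lemma ray_in_res_set:
  assumes "\<omega> < \<nu>" "\<nu> < pi" "t > 0"
  shows "of_real t * cis \<nu> \<in> res_set" "of_real t * cis (- \<nu>) \<in> res_set"
  using assms omega by (simp_all add: res_set_def Arg_cis)

text \<open>The rotation sweeps the complementary sector, where the resolvent exists. Substituting
  \<open>- z\<close> moves the cut of \<open>Arg\<close> out of the way. Membership of
  \<open>y\<close> in the domain gives \<open>l R(l) y \<rightarrow> y\<close> at infinity, and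
  \<open>y = A w\<close> keeps \<open>R(l) y\<close> bounded near \<open>0\<close>.\<close>

lemma has_integral_ray_resolv:
  assumes \<nu>: "\<omega> < \<nu>" "\<nu> < pi" and w: "w \<in> D" "A w = y" "y \<in> D" and f: "dual_elem f"
  shows "((\<lambda>t. f (R (of_real t * cis (- \<nu>)) y) * cis (- \<nu>) - f (R (of_real t * cis \<nu>) y) * cis \<nu>)
    has_integral 2 * \<i> * of_real (pi - \<nu>) * f y) {0<..}"
proof -
  obtain K where K: "\<And>l x. l \<noteq> 0 \<Longrightarrow> \<nu> \<le> \<bar>Arg l\<bar> \<Longrightarrow> norm (R l x) \<le> K / cmod l * norm x" "0 \<le> K"
    using resolv_bound[OF \<nu>] by metis
  obtain B where B: "\<And>x. cmod (f x) \<le> norm x * B" "0 \<le> B"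
    using f bounded_linear.nonneg_bounded[of f] unfolding dual_elem_def by blast
  define C where "C = B * K * norm (A y) + B * (K + 1) * norm w"
  let ?h = "\<lambda>z. f (R (- z) y)"
  have C: "C \<ge> B * K * norm (A y)" "C \<ge> B * (K + 1) * norm w" using B K by (auto simp: C_def)
  have bounds: "cmod (z * ?h z - (- f y)) \<le> C / cmod z" "cmod (z * ?h z) \<le> C * cmod z"
    if z: "z \<noteq> 0" "- (pi - \<nu>) \<le> Arg z" "Arg z \<le> pi - \<nu>" for z
  proof -
    have l: "- z \<noteq> 0" "\<nu> \<le> \<bar>Arg (- z)\<bar>" using z by (auto simp: abs_Arg_minus abs_le_iff)
    then have l': "- z \<in> res_set" using \<nu> by (auto simp: res_set_def)
    have "z * ?h z - (- f y) = - f (R (- z) (A y))"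
      using f by (simp add: resolv_A[OF l' w(3)] dual_elem_simps)
    then have "cmod (z * ?h z - (- f y)) \<le> norm (R (- z) (A y)) * B" using B(1) by simp
    also have "\<dots> \<le> (K / cmod (- z) * norm (A y)) * B" by (intro mult_right_mono K B l)
    also have "\<dots> = B * K * norm (A y) / cmod z" by (simp add: mult_ac)
    also have "\<dots> \<le> C / cmod z" using C(1) by (intro divide_right_mono) auto
    finally show "cmod (z * ?h z - (- f y)) \<le> C / cmod z" .
    have "?h z = - z * f (R (- z) w) - f w"
      using f resolv_A[OF l' w(1)] by (simp add: w(2) dual_elem_simps)
    then have "cmod (?h z) \<le> cmod z * cmod (f (R (- z) w)) + cmod (f w)"
      using norm_triangle_ineq4[of "- z * f (R (- z) w)" "f w"] by (simp add: norm_mult)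
    also have "\<dots> \<le> cmod z * (K / cmod (- z) * norm w * B) + norm w * B"
      by (intro add_mono mult_left_mono order_trans[OF B(1)] mult_right_mono K B l) auto
    also have "\<dots> = B * (K + 1) * norm w" using z by (simp add: algebra_simps)
    also have "\<dots> \<le> C" by (rule C)
    finally have "cmod z * cmod (?h z) \<le> cmod z * C" by (intro mult_left_mono) auto
    then show "cmod (z * ?h z) \<le> C * cmod z" by (simp add: norm_mult mult.commute)
  qed
  have hol: "?h holomorphic_on {z. z \<noteq> 0 \<and> - (pi - \<omega>) < Arg z \<and> Arg z < pi - \<omega>}"
  proof -
    have "((\<lambda>l. f (R l y)) \<circ> uminus) holomorphic_on {z. z \<noteq> 0 \<and> - (pi - \<omega>) < Arg z \<and> Arg z < pi - \<omega>}"
    proof (rule holomorphic_on_compose_gen[OF _ holomorphic_resolv[OF f order_refl]])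
      show "uminus ` {z. z \<noteq> 0 \<and> - (pi - \<omega>) < Arg z \<and> Arg z < pi - \<omega>} \<subseteq> res_set"
      proof clarify
        fix z assume "z \<noteq> 0" "- (pi - \<omega>) < Arg z" "Arg z < pi - \<omega>"
        then show "- z \<in> res_set" by (simp add: res_set_def abs_Arg_minus abs_less_iff del: minus_diff_eq)
      qed
    qed (intro holomorphic_intros)
    then show ?thesis by (simp add: o_def)
  qed
  have "((\<lambda>t. ?h (of_real t * cis (- (pi - \<nu>))) * cis (- (pi - \<nu>)) - ?h (of_real t * cis (pi - \<nu>)) * cis (pi - \<nu>))
    has_integral (\<i> * (- f y) * (of_real (- (pi - \<nu>)) - of_real (pi - \<nu>)))) {0<..}"
    by (rule ray_rotation[OF _ _ _ _ _ hol bounds]) (use \<nu> omega in auto)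
  moreover have "cis (- (pi - \<nu>)) = - cis \<nu>" "cis (pi - \<nu>) = - cis (- \<nu>)"
    by (auto simp: complex_eq_iff)
  ultimately show ?thesis by (simp add: algebra_simps)
qed

text \<open>Cauchy's formula in two halves. By \<open>cscale_resolv\<close> the integrand splits
  into \<open>R l y\<close>, with \<open>y = pole_diff_op z1 z2 x\<close>, and scalar pole terms.
  The former contributes \<open>2 \<i> (pi - \<nu>) y\<close> from the outer sector, the latter
  \<open>2 \<i> \<nu> y\<close> from the inner one.\<close>

lemma has_integral_pole_diff:
  assumes \<nu>: "\<omega> < \<nu>" "\<nu> < \<bar>Arg z1\<bar>" "\<nu> < \<bar>Arg z2\<bar>" and nz: "z1 \<noteq> 0" "z2 \<noteq> 0"
  shows "((\<lambda>t. cscale (cis (- \<nu>)) (cscale (pole_diff z1 z2 (of_real t * cis (- \<nu>))) (R (of_real t * cis (- \<nu>)) x))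
      - cscale (cis \<nu>) (cscale (pole_diff z1 z2 (of_real t * cis \<nu>)) (R (of_real t * cis \<nu>) x)))
    has_integral cscale (2 * of_real pi * \<i>) (pole_diff_op z1 z2 x)) {0<..}"
    (is "(?I has_integral _) _")
proof -
  have \<nu>': "\<nu> < pi" "0 < \<nu>" using \<nu> abs_Arg_le_pi[of z1] omega by linarith+
  note ray = ray_in_res_set[OF \<nu>(1) \<nu>'(1)]
  have res: "z1 \<in> res_set" "z2 \<in> res_set" using \<nu> nz by (auto simp: res_set_def)
  have Arg_ray: "\<bar>Arg (of_real t * cis \<theta>)\<bar> = \<nu>" "of_real t * cis \<theta> \<noteq> 0" "cmod (of_real t * cis \<theta>) = t"
    if "t > 0" "\<theta> = \<nu> \<or> \<theta> = - \<nu>" for t \<theta>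
    using that \<nu>' by (auto simp: Arg_cis norm_mult)
  obtain K where K: "\<And>l x. l \<noteq> 0 \<Longrightarrow> \<nu> \<le> \<bar>Arg l\<bar> \<Longrightarrow> norm (R l x) \<le> K / cmod l * norm x" "0 \<le> K"
    using resolv_bound[OF \<nu>(1) \<nu>'(1)] by metis
  obtain C where C: "0 \<le> C" "\<And>z. z \<noteq> 0 \<Longrightarrow> \<bar>Arg z\<bar> \<le> \<nu> \<Longrightarrow> cmod (pole_diff z1 z2 z) \<le> C * cmod z / (1 + cmod z)\<^sup>2"
    using pole_diff_bound[of \<nu> z1 z2] \<nu> \<nu>' nz by auto
  have bnd: "norm (cscale (cis \<theta>) (cscale (pole_diff z1 z2 (of_real t * cis \<theta>)) (R (of_real t * cis \<theta>) x)))
      \<le> C * K * norm x / (1 + t)\<^sup>2" if t: "t > 0" and \<theta>: "\<theta> = \<nu> \<or> \<theta> = - \<nu>" for t \<theta>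
  proof -
    note a = Arg_ray[OF that]
    have "norm (cscale (cis \<theta>) (cscale (pole_diff z1 z2 (of_real t * cis \<theta>)) (R (of_real t * cis \<theta>) x)))
      = cmod (pole_diff z1 z2 (of_real t * cis \<theta>)) * norm (R (of_real t * cis \<theta>) x)"
      by (simp add: norm_cscale)
    also have "\<dots> \<le> (C * t / (1 + t)\<^sup>2) * (K / t * norm x)"
      using C(2)[of "of_real t * cis \<theta>"] K(1)[of "of_real t * cis \<theta>" x] a t C(1)
      by (intro mult_mono) (auto simp del: of_real_mult)
    also have "\<dots> = C * K * norm x / (1 + t)\<^sup>2" using t by simp
    finally show ?thesis .
  qed
  have cont: "continuous_on {0<..} (\<lambda>t. cscale (cis \<theta>) (cscale (pole_diff z1 z2 (of_real t * cis \<theta>)) (R (of_real t * cis \<theta>) x)))"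
    if \<theta>: "\<theta> = \<nu> \<or> \<theta> = - \<nu>" for \<theta>
  proof -
    have "continuous_on {0<..} (\<lambda>t. R (of_real t * cis \<theta>) x)"
      by (rule continuous_on_compose2[OF continuous_on_resolv[of x]])
         (use ray \<theta> in \<open>auto intro!: continuous_intros\<close>)
    moreover have "of_real t * cis \<theta> \<noteq> z1" "of_real t * cis \<theta> \<noteq> z2" if "t > 0" for t
      using Arg_ray[OF that \<theta>] \<nu> by auto
    then have "continuous_on {0<..} (\<lambda>t. pole_diff z1 z2 (of_real t * cis \<theta>))"
      unfolding pole_diff_def by (intro continuous_intros) (auto dest: sym)
    ultimately show ?thesis by (intro cscale.continuous_on continuous_on_const)
  qed
  have "?I integrable_on {0<..}"
  proof (rule integrable_Ioi_decay)
    show "continuous_on {0<..} ?I" by (intro continuous_on_diff cont) auto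
    show "norm (?I t) \<le> (2 * (C * K * norm x)) / (1 + t)\<^sup>2" if "t > 0" for t
      using norm_triangle_le_diff[OF add_mono[OF bnd[OF that, of "-\<nu>"] bnd[OF that, of "\<nu>"]]] by simp
  qed
  then obtain v where v: "(?I has_integral v) {0<..}" by (auto simp: integrable_on_def)
  define y where "y = pole_diff_op z1 z2 x"
  \<comment> \<open>Since \<open>A (R z x) = S z x - x\<close>, the difference cancels
    \<open>x\<close>; this places \<open>y\<close> in the range of \<open>A\<close> as well as in
    its domain.\<close>
  have yD: "y \<in> D" "R z1 x - R z2 x \<in> D" "A (R z1 x - R z2 x) = y"
  proof -
    have mD: "- u \<in> D" "A (- u) = - A u" if "u \<in> D" for u
      using D_closed(2)[OF that, of "-1"] A_linear(2)[OF that, of "-1"] by (simp_all add: cscale.minus_left)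
    have sub: "u - v \<in> D" "A (u - v) = A u - A v" if "u \<in> D" "v \<in> D" for u v
      using D_closed(1)[OF that(1) mD(1)[OF that(2)]] A_linear(1)[OF that(1) mD(1)[OF that(2)]] mD(2)[OF that(2)]
      by simp_all
    have in_D: "R z1 x \<in> D" "R z2 x \<in> D" using res by (auto intro: resolv_in_D)
    show "R z1 x - R z2 x \<in> D" using in_D by (rule sub)
    show "y \<in> D" unfolding y_def pole_diff_op_def S_def using in_D by (intro sub D_closed)
    have "A (R z1 x) = S z1 x - x" "A (R z2 x) = S z2 x - x"
      using resolv_eq[OF res(1), of x] resolv_eq[OF res(2), of x] by (auto simp: S_def algebra_simps)
    then show "A (R z1 x - R z2 x) = y"
      by (simp add: sub in_D y_def pole_diff_op_def)
  qed
  have "v = cscale (2 * of_real pi * \<i>) y"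
  proof (rule dual_separates)
    fix f :: "'a \<Rightarrow> complex" assume f: "dual_elem f"
    have "((\<lambda>t. f (?I t)) has_integral f v) {0<..}"
      using has_integral_linear[OF v, of f] f by (simp add: dual_elem_def o_def)
    moreover have "((\<lambda>t. f (?I t)) has_integral 2 * \<i> * of_real (pi - \<nu>) * f y
        + (2 * \<i> * of_real \<nu> * f (S z1 x) - 2 * \<i> * of_real \<nu> * f (S z2 x))) {0<..}" (is "(_ has_integral ?V) _")
    proof -
      let ?J = "\<lambda>t. (f (R (of_real t * cis (- \<nu>)) y) * cis (- \<nu>) - f (R (of_real t * cis \<nu>) y) * cis \<nu>)
        + ((1 / (z1 - of_real t * cis (- \<nu>)) * cis (- \<nu>) - 1 / (z1 - of_real t * cis \<nu>) * cis \<nu>) * f (S z1 x)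
         - (1 / (z2 - of_real t * cis (- \<nu>)) * cis (- \<nu>) - 1 / (z2 - of_real t * cis \<nu>) * cis \<nu>) * f (S z2 x))"
      have J: "(?J has_integral ?V) {0<..}"
        using \<nu> nz yD \<nu>' f
        by (intro has_integral_add has_integral_diff has_integral_mult_left has_integral_ray_resolv has_integral_ray_pole) auto
      have "?J t = f (?I t)" if t: "t \<in> {0<..}" for t
      proof -
        have pt: "pole_diff z1 z2 l * f (R l x) = f (R l y) + 1 / (z1 - l) * f (S z1 x) - 1 / (z2 - l) * f (S z2 x)"
          if l: "l \<in> res_set" "l \<noteq> z1" "l \<noteq> z2" for l
        proof -
          have "cscale (pole_diff z1 z2 l) (R l x)
            = (R l (S z1 x) + cscale (1 / (z1 - l)) (S z1 x)) - (R l (S z2 x) + cscale (1 / (z2 - l)) (S z2 x))"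
            unfolding pole_diff_def cscale.diff_left cscale_resolv[OF l(1) res(1) l(2)] cscale_resolv[OF l(1) res(2) l(3)] ..
          then show ?thesis
            using f l by (simp add: y_def pole_diff_op_def resolv_simps flip: dual_elem_simps(5)) (simp add: dual_elem_simps)
        qed
        have ne: "of_real t * cis \<theta> \<noteq> z1" "of_real t * cis \<theta> \<noteq> z2" if "\<theta> = \<nu> \<or> \<theta> = - \<nu>" for \<theta>
          using Arg_ray[OF _ that] t \<nu> by auto
        have t0: "t > 0" using t by simp
        have "f (?I t) = cis (- \<nu>) * (pole_diff z1 z2 (of_real t * cis (- \<nu>)) * f (R (of_real t * cis (- \<nu>)) x))
          - cis \<nu> * (pole_diff z1 z2 (of_real t * cis \<nu>) * f (R (of_real t * cis \<nu>) x))"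
          using f by (simp only: dual_elem_simps)
        also have "\<dots> = ?J t"
          unfolding pt[OF ray(1)[OF t0] ne(1)[of \<nu>] ne(2)[of \<nu>], simplified]
            pt[OF ray(2)[OF t0] ne(1)[of "-\<nu>"] ne(2)[of "-\<nu>"], simplified]
          by (simp add: algebra_simps)
        finally show ?thesis by (rule sym)
      qed
      then show ?thesis using J by (rule has_integral_eq)
    qed
    ultimately have "f v = ?V" by (rule has_integral_unique)
    also have "\<dots> = f (cscale (2 * of_real pi * \<i>) y)"
      using f by (simp add: y_def pole_diff_op_def dual_elem_simps algebra_simps)
    finally show "f v = f (cscale (2 * of_real pi * \<i>) y)" .
  qed
  then show ?thesis using v by (simp add: y_def)
qed

lemma scalar_calc_sum_pole_diff:
  assumes "\<omega> < \<nu>" "finite I"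
    and "\<And>i. i \<in> I \<Longrightarrow> z1 i \<noteq> 0 \<and> z2 i \<noteq> 0 \<and> \<nu> < \<bar>Arg (z1 i)\<bar> \<and> \<nu> < \<bar>Arg (z2 i)\<bar>"
  shows "scalar_calc D A \<nu> (\<lambda>z. \<Sum>i\<in>I. of_real (e i) * pole_diff (z1 i) (z2 i) z) x
    = (\<Sum>i\<in>I. e i *\<^sub>R pole_diff_op (z1 i) (z2 i) x)"
proof -
  let ?I = "\<lambda>i t. cscale (cis (- \<nu>)) (cscale (pole_diff (z1 i) (z2 i) (of_real t * cis (- \<nu>))) (R (of_real t * cis (- \<nu>)) x))
      - cscale (cis \<nu>) (cscale (pole_diff (z1 i) (z2 i) (of_real t * cis \<nu>)) (R (of_real t * cis \<nu>) x))"
  have "((\<lambda>t. \<Sum>i\<in>I. e i *\<^sub>R ?I i t) has_integral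
      (\<Sum>i\<in>I. e i *\<^sub>R cscale (2 * of_real pi * \<i>) (pole_diff_op (z1 i) (z2 i) x))) {0<..}"
    using assms by (intro has_integral_sum has_integral_cmul has_integral_pole_diff) auto
  moreover have "(\<Sum>i\<in>I. e i *\<^sub>R ?I i t) =
      cscale (cis (- \<nu>)) (cscale (\<Sum>i\<in>I. of_real (e i) * pole_diff (z1 i) (z2 i) (of_real t * cis (- \<nu>))) (R (of_real t * cis (- \<nu>)) x))
      - cscale (cis \<nu>) (cscale (\<Sum>i\<in>I. of_real (e i) * pole_diff (z1 i) (z2 i) (of_real t * cis \<nu>)) (R (of_real t * cis \<nu>) x))" for t
    by (simp add: cscale.sum_left cscale.sum_right scaleR_diff_right sum_subtractf
        cscale_cscale[symmetric] cscale_of_real cscale.scaleR_right)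
  ultimately show ?thesis
    unfolding scalar_calc_def sect_int_def
    by (simp add: integral_unique cscale.sum_right cscale.scaleR_right cscale_cscale)
qed

text \<open>Coefficients of modulus at most one disappear in the triangle inequality for the scalar
  symbol, so one bound \<open>B\<close> on a sum of absolute values serves all choices of signs.
  This is the input for the two maxima in U-boundedness.\<close>

lemma Hinf_pole_diff_bound:
  assumes H: "Hinf_calculus D A \<omega> \<sigma>"
  obtains M where "0 \<le> M"
    "\<forall>(I :: nat set) e z1 z2 B x. finite I \<longrightarrow> (\<forall>i\<in>I. \<bar>e i\<bar> \<le> 1) \<longrightarrow>
      (\<forall>i\<in>I. z1 i \<noteq> 0 \<and> z2 i \<noteq> 0 \<and> \<sigma> < \<bar>Arg (z1 i)\<bar> \<and> \<sigma> < \<bar>Arg (z2 i)\<bar>) \<longrightarrow>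
      (\<forall>z\<in>sector \<sigma>. (\<Sum>i\<in>I. cmod (pole_diff (z1 i) (z2 i) z)) \<le> B) \<longrightarrow>
      norm (\<Sum>i\<in>I. e i *\<^sub>R pole_diff_op (z1 i) (z2 i) x) \<le> M * B * norm x"
proof -
  obtain C where C: "\<And>f \<nu> x. decaying_on \<sigma> f \<Longrightarrow> \<omega> < \<nu> \<Longrightarrow> \<nu> < \<sigma> \<Longrightarrow>
      norm (scalar_calc D A \<nu> f x) \<le> C * (SUP z\<in>sector \<sigma>. cmod (f z)) * norm x"
    and \<sigma>: "\<omega> < \<sigma>" "\<sigma> < pi"
    using H unfolding Hinf_calculus_def by blast
  define \<nu> where "\<nu> = (\<omega> + \<sigma>) / 2"
  have \<nu>: "\<omega> < \<nu>" "\<nu> < \<sigma>" using \<sigma> by (auto simp: \<nu>_def)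
  have "norm (\<Sum>i\<in>I. e i *\<^sub>R pole_diff_op (z1 i) (z2 i) x) \<le> \<bar>C\<bar> * B * norm x"
    if I: "finite I" and e: "\<And>i. i \<in> I \<Longrightarrow> \<bar>e i\<bar> \<le> 1"
      and z: "\<And>i. i \<in> I \<Longrightarrow> z1 i \<noteq> 0 \<and> z2 i \<noteq> 0 \<and> \<sigma> < \<bar>Arg (z1 i)\<bar> \<and> \<sigma> < \<bar>Arg (z2 i)\<bar>"
      and B: "\<And>z. z \<in> sector \<sigma> \<Longrightarrow> (\<Sum>i\<in>I. cmod (pole_diff (z1 i) (z2 i) z)) \<le> B"
    for I :: "nat set" and e z1 z2 B x
  proof -
    let ?f = "\<lambda>z. \<Sum>i\<in>I. of_real (e i) * pole_diff (z1 i) (z2 i) z"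
    have "\<exists>C. 0 \<le> C \<and> (\<forall>z\<in>sector \<sigma>. cmod (pole_diff (z1 i) (z2 i) z) \<le> C * (cmod z / (1 + (cmod z)\<^sup>2)))
        \<and> pole_diff (z1 i) (z2 i) holomorphic_on sector \<sigma>" if "i \<in> I" for i
    proof -
      have "0 < \<sigma>" using \<sigma> omega by simp
      then show ?thesis using pole_diff_decaying[of \<sigma> "z1 i" "z2 i"] z[OF that] by metis
    qed
    then obtain c where c: "\<And>i. i \<in> I \<Longrightarrow> 0 \<le> c i \<and> (\<forall>z\<in>sector \<sigma>. cmod (pole_diff (z1 i) (z2 i) z) \<le> c i * (cmod z / (1 + (cmod z)\<^sup>2)))
        \<and> pole_diff (z1 i) (z2 i) holomorphic_on sector \<sigma>"
      by metis
    have le: "cmod (?f z) \<le> (\<Sum>i\<in>I. cmod (pole_diff (z1 i) (z2 i) z))" for z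
      by (rule order_trans[OF norm_sum], rule sum_mono) (use e in \<open>auto simp: norm_mult intro: mult_left_le_one_le\<close>)
    have dec: "decaying_on \<sigma> ?f"
      unfolding decaying_on_def
    proof (intro conjI exI ballI)
      show "?f holomorphic_on sector \<sigma>" using c by (intro holomorphic_on_sum holomorphic_on_mult holomorphic_on_const) auto
      show "(1::real) > 0" by simp
      fix z assume zs: "z \<in> sector \<sigma>"
      have "cmod (?f z) \<le> (\<Sum>i\<in>I. c i * (cmod z / (1 + (cmod z)\<^sup>2)))"
        using le[of z] by (rule order_trans) (use c zs in \<open>auto intro!: sum_mono\<close>)
      then show "cmod (?f z) \<le> (\<Sum>i\<in>I. c i) * (cmod z / (1 + (cmod z)\<^sup>2)) powr 1"
        by (simp add: sum_distrib_right sum_divide_distrib)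
    qed
    have fB: "cmod (?f z) \<le> B" if "z \<in> sector \<sigma>" for z using le[of z] B[OF that] by linarith
    have one: "1 \<in> sector \<sigma>" using \<sigma> omega by (simp add: sector_def)
    have sup: "(SUP z\<in>sector \<sigma>. cmod (?f z)) \<le> B" by (rule cSUP_least) (use one fB in auto)
    \<comment> \<open>Needed because the constant \<open>C\<close> of the calculus carries no sign
      and is replaced by its absolute value.\<close>
    have "0 \<le> (SUP z\<in>sector \<sigma>. cmod (?f z))"
      by (rule cSUP_upper2[OF _ one]) (use fB in \<open>auto intro!: bdd_aboveI2\<close>)
    then have "C * (SUP z\<in>sector \<sigma>. cmod (?f z)) \<le> \<bar>C\<bar> * B"
      using sup by (intro mult_mono) auto
    then have "C * (SUP z\<in>sector \<sigma>. cmod (?f z)) * norm x \<le> \<bar>C\<bar> * B * norm x"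
      by (intro mult_right_mono) auto
    moreover have "scalar_calc D A \<nu> ?f x = (\<Sum>i\<in>I. e i *\<^sub>R pole_diff_op (z1 i) (z2 i) x)"
    proof (rule scalar_calc_sum_pole_diff[OF \<nu>(1) I])
      fix i assume "i \<in> I"
      from z[OF this] \<nu>(2) show "z1 i \<noteq> 0 \<and> z2 i \<noteq> 0 \<and> \<nu> < \<bar>Arg (z1 i)\<bar> \<and> \<nu> < \<bar>Arg (z2 i)\<bar>" by auto
    qed
    ultimately show ?thesis using C[OF dec \<nu>, of x] by simp
  qed
  then show ?thesis by (intro that[of "\<bar>C\<bar>"]) auto
qed

end

section \<open>A dyadic partition of unity\<close>

text \<open>The summand is dominated by an increment \<open>\<theta> r - \<theta> (r / 2)\<close> of
  the bounded function \<open>\<theta> r = sqrt r / (1 + sqrt r)\<close>, so the sum telescopes.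
  With \<open>a = sqrt r\<close> and \<open>b = a / sqrt 2\<close> the increment is
  \<open>(a - b) / ((1 + a) * (1 + b))\<close>, and the denominator is at most
  \<open>2 * (1 + r)\<close>; this yields the constant.\<close>

lemma sum_dyadic_le:
  fixes r \<beta> :: real
  assumes "0 < r" "0 < \<beta>"
  shows "(\<Sum>k<K. sqrt (r / (\<beta> * 2 ^ k)) / (1 + r / (\<beta> * 2 ^ k))) \<le> 2 / (1 - 1 / sqrt 2)"
proof -
  define \<theta> where "\<theta> = (\<lambda>r. sqrt r / (1 + sqrt r))"
  define c where "c = (1 - 1 / sqrt 2) / (2::real)"
  have c: "c > 0" by (simp add: c_def)
  have step: "c * (sqrt r / (1 + r)) \<le> \<theta> r - \<theta> (r / 2)" if "r > 0" for r
  proof -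
    define a where "a = sqrt r"
    have a: "a > 0" "r = a\<^sup>2" using that by (auto simp: a_def)
    define b where "b = a / sqrt 2"
    have b: "0 < b" "b \<le> a" using a by (auto simp: b_def field_simps)
    have ab: "a - b = 2 * c * a" by (simp add: b_def c_def field_simps)
    have "(1 + a) * (1 + b) \<le> (1 + a) * (1 + a)" using a b by (intro mult_left_mono) auto
    also have "\<dots> \<le> 2 * (1 + r)"
      using zero_le_power2[of "a - 1"] by (simp add: a power2_eq_square algebra_simps)
    finally have le: "(1 + a) * (1 + b) \<le> 2 * (1 + r)" .
    have "c * (sqrt r / (1 + r)) = (a - b) / (2 * (1 + r))"
      unfolding ab mult.assoc by (subst mult_divide_mult_cancel_left) (simp_all add: a_def)
    also have "\<dots> \<le> (a - b) / ((1 + a) * (1 + b))"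
      using a b le that by (intro divide_left_mono mult_pos_pos) (auto simp: add_pos_pos)
    also have "\<dots> = a / (1 + a) - b / (1 + b)" using a b by (simp add: field_simps)
    also have "\<dots> = \<theta> r - \<theta> (r / 2)" by (simp add: \<theta>_def a_def b_def real_sqrt_divide)
    finally show ?thesis .
  qed
  have "c * (\<Sum>k<K. sqrt (r / (\<beta> * 2 ^ k)) / (1 + r / (\<beta> * 2 ^ k)))
      \<le> (\<Sum>k<K. \<theta> (r / (\<beta> * 2 ^ k)) - \<theta> (r / (\<beta> * 2 ^ Suc k)))"
    unfolding sum_distrib_left
  proof (rule sum_mono)
    fix k
    have "0 < r / (\<beta> * 2 ^ k)" "r / (\<beta> * 2 ^ k) / 2 = r / (\<beta> * 2 ^ Suc k)" using assms by auto
    with step[of "r / (\<beta> * 2 ^ k)"]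
    show "c * (sqrt (r / (\<beta> * 2 ^ k)) / (1 + r / (\<beta> * 2 ^ k))) \<le> \<theta> (r / (\<beta> * 2 ^ k)) - \<theta> (r / (\<beta> * 2 ^ Suc k))"
      by metis
  qed
  also have "\<dots> = \<theta> (r / (\<beta> * 2 ^ 0)) - \<theta> (r / (\<beta> * 2 ^ K))" by (rule sum_lessThan_telescope')
  also have "\<dots> \<le> 1"
  proof -
    have "0 \<le> \<theta> t" "\<theta> t \<le> 1" if "t > 0" for t using that by (auto simp: \<theta>_def divide_le_eq add_pos_pos)
    from this(2)[of "r / (\<beta> * 2 ^ 0)"] this(1)[of "r / (\<beta> * 2 ^ K)"] show ?thesis using assms by simp
  qed
  finally show ?thesis using c by (simp add: field_simps c_def)
qed

text \<open>The cubic Hermite step: it fixes \<open>0\<close> and \<open>1\<close> and has zero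
  derivative at both.\<close>

definition smooth_step :: "complex \<Rightarrow> complex" where
  "smooth_step t = 3 * t\<^sup>2 - 2 * t ^ 3"

definition bump :: "real \<Rightarrow> complex \<Rightarrow> complex" where
  "bump b z = smooth_step (2 * b / (2 * b + z)) - smooth_step (b / (b + z))"

text \<open>The cofactor of \<open>z * pole_diff (- (2 * b)) (- b) z\<close> in
  \<open>bump b z\<close>; the coefficients come from carrying out that division. It stays nonzero
  at \<open>0\<close> and decays quadratically at infinity.\<close>

definition weight :: "real \<Rightarrow> complex \<Rightarrow> complex" where
  "weight b z = b * (9 * z\<^sup>2 + 25 * b * z + 18 * b\<^sup>2) / ((b + z)\<^sup>2 * (2 * b + z)\<^sup>2)"

text \<open>A cubic step makes the bump vanish to second order at \<open>0\<close> and at \<open>\<infinity>\<close>. This leaves room to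
  split off two factors that decay at both ends, one for each argument of the duality pairing.\<close>

lemma bump_eq:
  assumes "complex_of_real b + z \<noteq> 0" "2 * complex_of_real b + z \<noteq> 0"
  shows "bump b z = weight b z * (z * pole_diff (- (2 * b)) (- b) z)"
proof -
  define B :: complex where "B = of_real b"
  \<comment> \<open>In terms of the two denominators \<open>X\<close> and \<open>Y\<close>, clearing
    \<open>X ^ 3 * Y ^ 3\<close> leaves a polynomial identity.\<close>
  define X where "X = B + z"
  define Y where "Y = 2 * B + z"
  have nz: "X \<noteq> 0" "Y \<noteq> 0" using assms by (auto simp: X_def Y_def B_def)
  have z: "z = 2 * X - Y" and B: "B = Y - X" by (auto simp: X_def Y_def)
  have 1: "bump b z = smooth_step (2 * B / Y) - smooth_step (B / X)"
    by (simp add: bump_def X_def Y_def B_def)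
  have "- (2 * B) - z = - Y" "- B - z = - X" by (auto simp: X_def Y_def)
  then have 2: "pole_diff (- (2 * b)) (- b) z = 2 * B / Y - B / X"
    by (simp add: pole_diff_def B_def)
  have 3: "weight b z = B * (9 * z\<^sup>2 + 25 * B * z + 18 * B\<^sup>2) / (X\<^sup>2 * Y\<^sup>2)"
    by (simp add: weight_def X_def Y_def B_def)
  have "(smooth_step (2 * B / Y) - smooth_step (B / X)) * (X ^ 3 * Y ^ 3)
      = 3 * (2 * B)\<^sup>2 * X ^ 3 * Y - 2 * (2 * B) ^ 3 * X ^ 3 - (3 * B\<^sup>2 * X * Y ^ 3 - 2 * B ^ 3 * Y ^ 3)"
    using nz by (simp add: smooth_step_def power_divide left_diff_distrib power2_eq_square power3_eq_cube)
  also have "\<dots> = (B * (9 * z\<^sup>2 + 25 * B * z + 18 * B\<^sup>2)) * (z * (2 * B * X - B * Y))"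
    unfolding z B by algebra
  also have "\<dots> = (weight b z * (z * pole_diff (- (2 * b)) (- b) z)) * (X ^ 3 * Y ^ 3)"
    unfolding 2 3 using nz by (simp add: field_simps power2_eq_square power3_eq_cube)
  finally show ?thesis using nz unfolding 1 by simp
qed

lemma sum_bump:
  "(\<Sum>k<K. bump (\<beta> * 2 ^ k) z) = smooth_step (\<beta> * 2 ^ K / (\<beta> * 2 ^ K + z)) - smooth_step (\<beta> / (\<beta> + z))"
proof -
  let ?h = "\<lambda>k::nat. smooth_step (complex_of_real (\<beta> * 2 ^ k) / (complex_of_real (\<beta> * 2 ^ k) + z))"
  have "(\<Sum>k<K. bump (\<beta> * 2 ^ k) z) = (\<Sum>k<K. ?h (Suc k) - ?h k)"
    by (intro sum.cong refl) (simp add: bump_def mult_ac)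
  also have "\<dots> = ?h K - ?h 0" by (rule sum_lessThan_telescope)
  finally show ?thesis by simp
qed

text \<open>Brings the regulariser under the estimates for pole differences. The index
  \<open>0\<close> is excluded since \<open>phi 0\<close> is the constant
  \<open>- 1\<close>.\<close>

lemma phi_eq_pole_diff: "n \<ge> 1 \<Longrightarrow> phi n z = pole_diff (- of_nat n) (- (1 / of_nat n)) z"
proof -
  assume n: "n \<ge> 1"
  have "- (of_nat n :: complex) / (- of_nat n - z) = of_nat n / (of_nat n + z)"
    using minus_divide_divide[of "of_nat n" "of_nat n + z"] by simp
  moreover have "- (1 / of_nat n) / (- (1 / of_nat n) - z) = 1 / (1 + of_nat n * z)"
  proof -
    have "- (1 / of_nat n) - z = - ((1 + of_nat n * z) / of_nat n)" using n by (simp add: field_simps)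
    then show ?thesis using n by simp
  qed
  ultimately show ?thesis by (simp add: phi_def pole_diff_def)
qed

text \<open>The lower bound is homogeneous in \<open>b\<close> and \<open>z\<close> together, so the
  estimates below inherit constants that are uniform over all scales unless stated for a fixed
  \<open>b\<close>.\<close>

locale sector_constant =
  fixes \<nu> c :: real
  assumes angle: "0 \<le> \<nu>" "\<nu> < pi" and c: "0 < c"
    and sep: "\<And>z b. z \<noteq> 0 \<Longrightarrow> \<bar>Arg z\<bar> \<le> \<nu> \<Longrightarrow> 0 < b \<Longrightarrow> c * (b + cmod z) \<le> cmod (of_real b + z)"
begin

lemma shift_nonzero: "z \<noteq> 0 \<Longrightarrow> \<bar>Arg z\<bar> \<le> \<nu> \<Longrightarrow> 0 < b \<Longrightarrow> of_real b + z \<noteq> 0"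
proof -
  assume *: "z \<noteq> 0" "\<bar>Arg z\<bar> \<le> \<nu>" "0 < b"
  have "0 < c * (b + cmod z)" using c * by (intro mult_pos_pos add_pos_nonneg) auto
  then show ?thesis using sep[OF *] by auto
qed

lemma ratio_le: "z \<noteq> 0 \<Longrightarrow> \<bar>Arg z\<bar> \<le> \<nu> \<Longrightarrow> 0 < b \<Longrightarrow> cmod (of_real b / (of_real b + z)) \<le> 1 / c"
proof -
  assume *: "z \<noteq> 0" "\<bar>Arg z\<bar> \<le> \<nu>" "0 < b"
  have "c * b \<le> c * (b + cmod z)" using c by simp
  then have "c * b \<le> cmod (of_real b + z)" using sep[OF *] by linarith
  then have "b / cmod (of_real b + z) \<le> b / (c * b)"
    using * c shift_nonzero[OF *] by (intro divide_left_mono mult_pos_pos) auto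
  then show ?thesis using * by (simp add: norm_divide)
qed

lemma ratio'_le: "z \<noteq> 0 \<Longrightarrow> \<bar>Arg z\<bar> \<le> \<nu> \<Longrightarrow> 0 < b \<Longrightarrow> cmod (z / (of_real b + z)) \<le> 1 / c"
proof -
  assume *: "z \<noteq> 0" "\<bar>Arg z\<bar> \<le> \<nu>" "0 < b"
  have "c * cmod z \<le> c * (b + cmod z)" using c * by simp
  then have "c * cmod z \<le> cmod (of_real b + z)" using sep[OF *] by linarith
  then have "cmod z / cmod (of_real b + z) \<le> cmod z / (c * cmod z)"
    using * c shift_nonzero[OF *] by (intro divide_left_mono mult_pos_pos) auto
  then show ?thesis using * by (simp add: norm_divide)
qed

lemma smooth_step_le: "cmod t \<le> 1 / c \<Longrightarrow> cmod (smooth_step t) \<le> 3 / c\<^sup>2 + 2 / c ^ 3"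
proof -
  assume "cmod t \<le> 1 / c"
  then have "cmod t ^ 2 \<le> (1 / c)\<^sup>2" "cmod t ^ 3 \<le> (1 / c) ^ 3" by (auto intro: power_mono)
  then show ?thesis
    using norm_triangle_ineq4[of "3 * t\<^sup>2" "2 * t ^ 3"]
    by (simp add: smooth_step_def norm_mult norm_power power_divide)
qed

lemma sum_bump_le:
  assumes "z \<noteq> 0" "\<bar>Arg z\<bar> \<le> \<nu>" "0 < \<beta>"
  shows "cmod (\<Sum>k<K. bump (\<beta> * 2 ^ k) z) \<le> 2 * (3 / c\<^sup>2 + 2 / c ^ 3)"
proof -
  let ?t = "\<lambda>b. complex_of_real b / (complex_of_real b + z)"
  have "cmod (smooth_step (?t (\<beta> * 2 ^ K)) - smooth_step (?t \<beta>)) \<le> 2 * (3 / c\<^sup>2 + 2 / c ^ 3)"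
    using norm_triangle_ineq4[of "smooth_step (?t (\<beta> * 2 ^ K))" "smooth_step (?t \<beta>)"]
      smooth_step_le[OF ratio_le[OF assms(1,2), of "\<beta> * 2 ^ K"]] smooth_step_le[OF ratio_le[OF assms]] assms(3)
    by auto
  then show ?thesis by (simp add: sum_bump)
qed

lemma phi_le: "z \<noteq> 0 \<Longrightarrow> \<bar>Arg z\<bar> \<le> \<nu> \<Longrightarrow> n \<ge> 1 \<Longrightarrow> cmod (phi n z) \<le> 2 / c"
proof -
  assume *: "z \<noteq> 0" "\<bar>Arg z\<bar> \<le> \<nu>" "n \<ge> 1"
  have "1 / (1 + of_nat n * z) = of_real (1 / real n) / (of_real (1 / real n) + z)"
    using * by (simp add: divide_simps mult.commute)
  then have "phi n z = of_real (real n) / (of_real (real n) + z) - of_real (1 / real n) / (of_real (1 / real n) + z)"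
    by (simp add: phi_def)
  then show ?thesis
    using norm_triangle_ineq4[of "of_real (real n) / (of_real (real n) + z)" "of_real (1 / real n) / (of_real (1 / real n) + z)"]
      ratio_le[OF *(1,2), of "real n"] ratio_le[OF *(1,2), of "1 / real n"] *(3) by simp
qed

text \<open>Homogeneous of degree \<open>- 1\<close> in \<open>b\<close> and \<open>z\<close>, like
  \<open>weight\<close> itself. The Jacobian of the substitution \<open>t = b * s\<close> restores
  the missing power.\<close>

lemma weight_le:
  assumes z: "z \<noteq> 0" "\<bar>Arg z\<bar> \<le> \<nu>" and b: "0 < b"
  shows "cmod (weight b z) \<le> 25 / c ^ 4 * (b / (b + cmod z)\<^sup>2)"
proof -
  let ?r = "cmod z" and ?B = "complex_of_real b"
  let ?s = "b + ?r"
  have s: "?s > 0" using b by (simp add: add_pos_nonneg)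
  have "cmod (9 * z\<^sup>2 + 25 * ?B * z + 18 * ?B\<^sup>2) \<le> cmod (9 * z\<^sup>2) + cmod (25 * ?B * z) + cmod (18 * ?B\<^sup>2)"
    by (meson norm_triangle_ineq norm_triangle_le add_right_mono order_trans)
  also have "\<dots> = 9 * ?r\<^sup>2 + 25 * b * ?r + 18 * b\<^sup>2"
    using b by (simp add: norm_mult norm_power)
  also have "\<dots> \<le> 25 * ?s\<^sup>2"
    using b by (simp add: power2_eq_square algebra_simps)
  finally have num: "cmod (9 * z\<^sup>2 + 25 * ?B * z + 18 * ?B\<^sup>2) \<le> 25 * ?s\<^sup>2" .
  have "c * ?s \<le> cmod (?B + z)" using sep[OF z b] .
  then have 1: "(c * ?s)\<^sup>2 \<le> (cmod (?B + z))\<^sup>2" using c s by (intro power_mono) auto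
  have "c * ?s \<le> c * (2 * b + ?r)" using c b by simp
  also have "\<dots> \<le> cmod (2 * ?B + z)" using sep[OF z, of "2 * b"] b by simp
  finally have 2: "(c * ?s)\<^sup>2 \<le> (cmod (2 * ?B + z))\<^sup>2" using c s by (intro power_mono) auto
  have den: "(c * ?s)\<^sup>2 * (c * ?s)\<^sup>2 \<le> (cmod (?B + z))\<^sup>2 * (cmod (2 * ?B + z))\<^sup>2"
    using 1 2 by (intro mult_mono) auto
  have "cmod (weight b z) = b * cmod (9 * z\<^sup>2 + 25 * ?B * z + 18 * ?B\<^sup>2) / ((cmod (?B + z))\<^sup>2 * (cmod (2 * ?B + z))\<^sup>2)"
    using b by (simp add: weight_def norm_divide norm_mult norm_power)
  also have "\<dots> \<le> b * (25 * ?s\<^sup>2) / ((c * ?s)\<^sup>2 * (c * ?s)\<^sup>2)"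
    using num den b c s by (intro frac_le mult_left_mono) (auto intro!: mult_pos_pos)
  also have "\<dots> = 25 / c ^ 4 * (b / ?s\<^sup>2)"
  proof -
    have "b * (25 * u\<^sup>2) / ((c * u)\<^sup>2 * (c * u)\<^sup>2) = 25 / c ^ 4 * (b / u\<^sup>2)" if "u > 0" for u
      using c that by (simp add: field_simps eval_nat_numeral)
    then show ?thesis using s by blast
  qed
  finally show ?thesis .
qed

text \<open>A version for one fixed scale, with a constant depending on \<open>b\<close>; it serves
  integrability and contour shifts, not the uniform estimate.\<close>

lemma weight_le':
  assumes b: "0 < b"
  obtains C where "0 \<le> C" "\<And>z. z \<noteq> 0 \<Longrightarrow> \<bar>Arg z\<bar> \<le> \<nu> \<Longrightarrow> cmod (weight b z) \<le> C / (1 + cmod z)\<^sup>2"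
proof -
  define C where "C = 25 / c ^ 4 * b / (min 1 b)\<^sup>2"
  have "cmod (weight b z) \<le> C / (1 + cmod z)\<^sup>2" if "z \<noteq> 0" "\<bar>Arg z\<bar> \<le> \<nu>" for z
  proof -
    have "(min 1 b * (1 + cmod z))\<^sup>2 \<le> (b + cmod z)\<^sup>2"
      using one_plus_cmod_le[of b "cmod z"] b by (intro power_mono) (auto simp: mult_nonneg_nonneg)
    moreover have "0 < min 1 b * (1 + cmod z)" using b by (simp add: add_pos_nonneg)
    ultimately have "b / (b + cmod z)\<^sup>2 \<le> b / (min 1 b * (1 + cmod z))\<^sup>2"
      using b by (intro divide_left_mono mult_pos_pos zero_less_power) (auto simp: add_pos_nonneg)
    then have "25 / c ^ 4 * (b / (b + cmod z)\<^sup>2) \<le> 25 / c ^ 4 * (b / (min 1 b * (1 + cmod z))\<^sup>2)"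
      using c by (intro mult_left_mono) auto
    then show ?thesis using weight_le[OF that b] by (simp add: C_def power_mult_distrib mult_ac)
  qed
  moreover have "0 \<le> C" using c b by (simp add: C_def)
  ultimately show ?thesis using that by blast
qed

end

lemma sector_constant_exists:
  assumes "0 \<le> \<nu>" "\<nu> < pi"
  obtains c where "sector_constant \<nu> c"
proof -
  obtain c where c: "0 < c"
    "\<And>z w. z \<noteq> 0 \<Longrightarrow> w \<noteq> 0 \<Longrightarrow> \<bar>Arg z\<bar> \<le> \<nu> \<Longrightarrow> pi \<le> \<bar>Arg w\<bar> \<Longrightarrow> c * (cmod z + cmod w) \<le> cmod (w - z)"
    using sector_separation[OF assms] by metis
  have "c * (b + cmod z) \<le> cmod (of_real b + z)" if "z \<noteq> 0" "\<bar>Arg z\<bar> \<le> \<nu>" "0 < b" for z b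
  proof -
    have "Arg (- complex_of_real b) = pi" using that by (simp add: Arg_minus)
    then have "c * (cmod z + cmod (- complex_of_real b)) \<le> cmod (- complex_of_real b - z)"
      using that by (intro c(2)) auto
    also have "- complex_of_real b - z = - (complex_of_real b + z)" by simp
    finally show ?thesis using that by (simp only: norm_minus_cancel norm_of_real) (simp add: add.commute)
  qed
  then have "sector_constant \<nu> c" using assms c(1) by unfold_locales auto
  then show ?thesis by (rule that)
qed

text \<open>Rescaling by \<open>\<beta> * 2 ^ k\<close> reduces each term to the poles
  \<open>- 2\<close> and \<open>- 1\<close>. The decay \<open>r / (1 + r)^2\<close> is weakened to
  \<open>sqrt r / (1 + r)\<close>, the form summed by \<open>sum_dyadic_le\<close>.\<close>

lemma pole_diff_sum_le:
  assumes "0 \<le> a" "a < pi"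
  obtains C where "0 \<le> C" "\<And>z \<beta> K. z \<noteq> 0 \<Longrightarrow> \<bar>Arg z\<bar> \<le> a \<Longrightarrow> 0 < \<beta> \<Longrightarrow>
      (\<Sum>k<K. cmod (pole_diff (- (2 * of_real (\<beta> * 2 ^ k))) (- of_real (\<beta> * 2 ^ k)) z)) \<le> C"
proof -
  obtain C where C: "0 \<le> C" "\<And>z. z \<noteq> 0 \<Longrightarrow> \<bar>Arg z\<bar> \<le> a \<Longrightarrow> cmod (pole_diff (- 2) (- 1) z) \<le> C * cmod z / (1 + cmod z)\<^sup>2"
    using pole_diff_bound[of a "- 2" "- 1"] assms Arg_minus[of 2] Arg_minus[of 1] by auto
  have "(\<Sum>k<K. cmod (pole_diff (- (2 * of_real (\<beta> * 2 ^ k))) (- of_real (\<beta> * 2 ^ k)) z)) \<le> C * (2 / (1 - 1 / sqrt 2))"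
    if z: "z \<noteq> 0" "\<bar>Arg z\<bar> \<le> a" and \<beta>: "0 < \<beta>" for z \<beta> K
  proof -
    have "cmod (pole_diff (- (2 * of_real (\<beta> * 2 ^ k))) (- of_real (\<beta> * 2 ^ k)) z)
      \<le> C * (sqrt (cmod z / (\<beta> * 2 ^ k)) / (1 + cmod z / (\<beta> * 2 ^ k)))" for k
    proof -
      define b where "b = \<beta> * 2 ^ k"
      have b: "b > 0" using \<beta> by (simp add: b_def)
      define r where "r = cmod z / b"
      have r: "r > 0" using b z by (simp add: r_def)
      have "pole_diff (- (2 * of_real b)) (- of_real b) z = pole_diff (- 2) (- 1) (z / of_real b)"
        using pole_diff_scale[of "of_real b" "- 2" "- 1" z] b by (simp add: mult.commute)
      also have "cmod \<dots> \<le> C * cmod (z / of_real b) / (1 + cmod (z / of_real b))\<^sup>2"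
        using z b by (intro C(2)) auto
      also have "\<dots> = C * (r / (1 + r)\<^sup>2)" using b by (simp add: r_def norm_divide)
      also have "\<dots> \<le> C * (sqrt r / (1 + r))"
      proof (rule mult_left_mono[OF _ C(1)])
        have "sqrt r \<le> 1 + r" using r by (intro real_le_lsqrt) (auto simp: power2_eq_square algebra_simps)
        then have "sqrt r * sqrt r \<le> sqrt r * (1 + r)" using r by (intro mult_left_mono) auto
        then have "r / (1 + r)\<^sup>2 \<le> sqrt r * (1 + r) / (1 + r)\<^sup>2" using r by (intro divide_right_mono) auto
        then show "r / (1 + r)\<^sup>2 \<le> sqrt r / (1 + r)" using r by (simp add: power2_eq_square)
      qed
      finally show ?thesis by (simp add: b_def r_def)
    qed
    then have "(\<Sum>k<K. cmod (pole_diff (- (2 * of_real (\<beta> * 2 ^ k))) (- of_real (\<beta> * 2 ^ k)) z))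
      \<le> C * (\<Sum>k<K. sqrt (cmod z / (\<beta> * 2 ^ k)) / (1 + cmod z / (\<beta> * 2 ^ k)))"
      unfolding sum_distrib_left by (rule sum_mono)
    also have "\<dots> \<le> C * (2 / (1 - 1 / sqrt 2))"
      using z \<beta> C(1) by (intro mult_left_mono sum_dyadic_le) auto
    finally show ?thesis .
  qed
  moreover have "0 \<le> C * (2 / (1 - 1 / sqrt 2))" using C(1) by simp
  ultimately show ?thesis using that by blast
qed

text \<open>After rescaling the poles are \<open>\<mu>\<close> and \<open>- 1\<close>. With
  \<open>r\<close> and \<open>s\<close> the moduli of the rescaled point and of
  \<open>\<mu>\<close>, the estimate \<open>sqrt r * sqrt s \<le> r + s\<close> splits the distance
  to \<open>\<mu>\<close> evenly: half a power of \<open>r\<close> makes the dyadic sum converge,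
  and half a power of \<open>s\<close> keeps the singularity at \<open>\<mu> = 0\<close>
  integrable.\<close>

lemma pole_diff_ray_sum_le:
  assumes "0 \<le> a" "a < \<nu>" "\<nu> < pi"
  obtains C where "0 \<le> C" "\<And>z \<mu> \<beta> K. z \<noteq> 0 \<Longrightarrow> \<bar>Arg z\<bar> \<le> a \<Longrightarrow> \<mu> \<noteq> 0 \<Longrightarrow> \<bar>Arg \<mu>\<bar> = \<nu> \<Longrightarrow> 0 < \<beta> \<Longrightarrow>
      (\<Sum>k<K. cmod (pole_diff (of_real (\<beta> * 2 ^ k) * \<mu>) (- of_real (\<beta> * 2 ^ k)) z)) \<le> C * ((1 + cmod \<mu>) / sqrt (cmod \<mu>))"
proof -
  obtain c where c: "0 < c"
    "\<And>z w. z \<noteq> 0 \<Longrightarrow> w \<noteq> 0 \<Longrightarrow> \<bar>Arg z\<bar> \<le> a \<Longrightarrow> \<nu> \<le> \<bar>Arg w\<bar> \<Longrightarrow> c * (cmod z + cmod w) \<le> cmod (w - z)"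
    using sector_separation[OF assms(1,2)] by metis
  define C where "C = 1 / c\<^sup>2 * (2 / (1 - 1 / sqrt 2))"
  have C: "0 \<le> C" using c by (simp add: C_def)
  have "(\<Sum>k<K. cmod (pole_diff (of_real (\<beta> * 2 ^ k) * \<mu>) (- of_real (\<beta> * 2 ^ k)) z)) \<le> C * ((1 + cmod \<mu>) / sqrt (cmod \<mu>))"
    if z: "z \<noteq> 0" "\<bar>Arg z\<bar> \<le> a" and \<mu>: "\<mu> \<noteq> 0" "\<bar>Arg \<mu>\<bar> = \<nu>" and \<beta>: "0 < \<beta>" for z \<mu> \<beta> K
  proof -
    define s where "s = cmod \<mu>"
    have s: "s > 0" using \<mu> by (simp add: s_def)
    have "cmod (pole_diff (of_real (\<beta> * 2 ^ k) * \<mu>) (- of_real (\<beta> * 2 ^ k)) z)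
      \<le> 1 / c\<^sup>2 * ((1 + s) / sqrt s) * (sqrt (cmod z / (\<beta> * 2 ^ k)) / (1 + cmod z / (\<beta> * 2 ^ k)))" for k
    proof -
      define b where "b = \<beta> * 2 ^ k"
      have b: "b > 0" using \<beta> by (simp add: b_def)
      define y where "y = z / of_real b"
      have y: "y \<noteq> 0" "\<bar>Arg y\<bar> \<le> a" using z b by (auto simp: y_def)
      define r where "r = cmod y"
      have r: "r > 0" using y by (simp add: r_def)
      have d1: "c * (r + s) \<le> cmod (\<mu> - y)" using c(2)[of y \<mu>] y \<mu> by (simp add: r_def s_def)
      have d2: "c * (r + 1) \<le> cmod (- 1 - y)" using c(2)[of y "- 1"] y Arg_minus[of 1] assms by (simp add: r_def)
      have pos: "0 < c * (r + s)" "0 < c * (r + 1)" using c r s by auto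
      then have ne: "y \<noteq> \<mu>" "y \<noteq> - 1" using d1 d2 by auto
      have "pole_diff (of_real b * \<mu>) (- of_real b) z = pole_diff \<mu> (- 1) y"
        using pole_diff_scale[of "of_real b" \<mu> "- 1" z] b by (simp add: y_def)
      also have "\<dots> = y * (- 1 - \<mu>) / ((\<mu> - y) * (- 1 - y))" using ne by (rule pole_diff_eq)
      also have "cmod \<dots> = r * cmod (- 1 - \<mu>) / (cmod (\<mu> - y) * cmod (- 1 - y))"
        by (simp add: norm_divide norm_mult r_def)
      also have "\<dots> \<le> r * (1 + s) / ((c * (r + s)) * (c * (r + 1)))"
      proof (rule frac_le)
        show "r * cmod (- 1 - \<mu>) \<le> r * (1 + s)"
          using norm_triangle_ineq4[of "- 1" \<mu>] r by (simp add: s_def)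
        show "c * (r + s) * (c * (r + 1)) \<le> cmod (\<mu> - y) * cmod (- 1 - y)"
          using d1 d2 pos by (intro mult_mono) auto
      qed (use r s pos in auto)
      also have "\<dots> \<le> r * (1 + s) / ((c * (sqrt r * sqrt s)) * (c * (r + 1)))"
      proof -
        have "sqrt r * sqrt s \<le> r + s"
          using zero_le_power2[of "sqrt r - sqrt s"] mult_nonneg_nonneg[of "sqrt r" "sqrt s"] r s
          by (simp add: power2_diff)
        then show ?thesis using r s c by (intro divide_left_mono mult_right_mono mult_left_mono) auto
      qed
      also have "\<dots> = 1 / c\<^sup>2 * ((1 + s) / sqrt s) * ((r / sqrt r) / (1 + r))"
        using r s c by (simp add: power2_eq_square mult_ac add.commute)
      also have "r / sqrt r = sqrt r" using r by (simp add: real_div_sqrt)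
      also have "r = cmod z / b" using b by (simp add: r_def y_def norm_divide)
      finally show ?thesis by (simp add: b_def)
    qed
    then have "(\<Sum>k<K. cmod (pole_diff (of_real (\<beta> * 2 ^ k) * \<mu>) (- of_real (\<beta> * 2 ^ k)) z))
      \<le> 1 / c\<^sup>2 * ((1 + s) / sqrt s) * (\<Sum>k<K. sqrt (cmod z / (\<beta> * 2 ^ k)) / (1 + cmod z / (\<beta> * 2 ^ k)))"
      unfolding sum_distrib_left by (rule sum_mono)
    also have "\<dots> \<le> 1 / c\<^sup>2 * ((1 + s) / sqrt s) * (2 / (1 - 1 / sqrt 2))"
      using z \<beta> s by (intro mult_left_mono sum_dyadic_le) auto
    also have "\<dots> = C * ((1 + cmod \<mu>) / sqrt (cmod \<mu>))" unfolding C_def s_def by (simp only: mult_ac)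
    finally show ?thesis .
  qed
  then show ?thesis using that C by blast
qed

text \<open>This majorant is the product of the growth \<open>(1 + s) / sqrt s\<close> of the
  pairing and the decay \<open>(1 + s)^(-2)\<close> of the weight.\<close>

lemma has_integral_inverse_sqrt:
  "((\<lambda>s::real. 1 / (sqrt s * (1 + s))) has_integral pi) {0<..}"
proof -
  have "((\<lambda>s. 2 * arctan (sqrt s)) has_vector_derivative 1 / (sqrt s * (1 + s))) (at s)" if "s > 0" for s :: real
    unfolding has_real_derivative_iff_has_vector_derivative[symmetric]
    using that by (auto intro!: derivative_eq_intros simp: divide_simps)
  moreover have "((\<lambda>s. 2 * arctan (sqrt s)) \<longlongrightarrow> 2 * (pi / 2)) at_top"
    by (intro tendsto_mult tendsto_const filterlim_compose[OF tendsto_arctan_at_top sqrt_at_top])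
  moreover have "((\<lambda>s. 2 * arctan (sqrt s)) \<longlongrightarrow> 2 * arctan (sqrt 0)) (at_right 0)"
    by (intro tendsto_intros)
  ultimately show ?thesis
    using has_integral_Ioi_antiderivative[of "\<lambda>s. 2 * arctan (sqrt s)" "\<lambda>s. 1 / (sqrt s * (1 + s))" pi 0] by simp
qed

section \<open>U-bounded families\<close>

text \<open>Replaces both suprema by arbitrary upper bounds. Monotonicity of the product requires
  that the suprema be nonnegative and taken over bounded sets, which the pointwise bounds
  guarantee.\<close>

lemma U_boundedE:
  assumes "U_bounded \<F>"
  obtains C where "0 \<le> C" "\<forall>n xs xds Ts a b.
    (\<forall>k<n. Ts k \<in> \<F>) \<longrightarrow> (\<forall>k<n. dual_elem (xds k)) \<longrightarrow> 0 \<le> b \<longrightarrow>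
    (\<forall>e\<in>sign_seqs n. norm (\<Sum>k<n. e k *\<^sub>R xs k) \<le> a) \<longrightarrow>
    (\<forall>e\<in>sign_seqs n. \<forall>x. cmod (\<Sum>k<n. complex_of_real (e k) * xds k x) \<le> b * norm x) \<longrightarrow>
    (\<Sum>k<n. cmod (xds k (Ts k (xs k)))) \<le> C * a * b"
proof -
  obtain C where C: "\<And>n xs xds Ts. (\<forall>k<n. Ts k \<in> \<F> \<and> dual_elem (xds k)) \<Longrightarrow>
      (\<Sum>k<n. cmod (xds k (Ts k (xs k))))
        \<le> C * (SUP e\<in>sign_seqs n. norm (\<Sum>k<n. e k *\<^sub>R xs k))
            * (SUP e\<in>sign_seqs n. onorm (\<lambda>x. \<Sum>k<n. complex_of_real (e k) * xds k x))"
    using assms unfolding U_bounded_def by blast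
  have "(\<Sum>k<n. cmod (xds k (Ts k (xs k)))) \<le> \<bar>C\<bar> * a * b"
    if T: "\<And>k. k < n \<Longrightarrow> Ts k \<in> \<F>" and d: "\<And>k. k < n \<Longrightarrow> dual_elem (xds k)" and b0: "0 \<le> b"
      and a: "\<And>e. e \<in> sign_seqs n \<Longrightarrow> norm (\<Sum>k<n. e k *\<^sub>R xs k) \<le> a"
      and b: "\<And>e x. e \<in> sign_seqs n \<Longrightarrow> cmod (\<Sum>k<n. complex_of_real (e k) * xds k x) \<le> b * norm x"
    for n xs xds Ts a b
  proof -
    have one: "(\<lambda>_. 1) \<in> sign_seqs n" by (simp add: sign_seqs_def)
    have on: "0 \<le> onorm (\<lambda>x. \<Sum>k<n. complex_of_real (e k) * xds k x) \<and> onorm (\<lambda>x. \<Sum>k<n. complex_of_real (e k) * xds k x) \<le> b"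
      if "e \<in> sign_seqs n" for e
    proof
      have "bounded_linear (\<lambda>x. \<Sum>k<n. complex_of_real (e k) * xds k x)"
        using d by (intro bounded_linear_sum bounded_linear_const_mult) (auto simp: dual_elem_def)
      then show "0 \<le> onorm (\<lambda>x. \<Sum>k<n. complex_of_real (e k) * xds k x)" by (rule onorm_pos_le)
      show "onorm (\<lambda>x. \<Sum>k<n. complex_of_real (e k) * xds k x) \<le> b" by (rule onorm_bound[OF b0 b[OF that]])
    qed
    let ?S1 = "SUP e\<in>sign_seqs n. norm (\<Sum>k<n. e k *\<^sub>R xs k)"
    let ?S2 = "SUP e\<in>sign_seqs n. onorm (\<lambda>x. \<Sum>k<n. complex_of_real (e k) * xds k x)"
    have 1: "?S1 \<le> a" "?S2 \<le> b" using one a on by (auto intro!: cSUP_least)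
    have 2: "0 \<le> ?S1" by (rule cSUP_upper2[OF _ one]) (use a in \<open>auto intro!: bdd_aboveI2\<close>)
    have 3: "0 \<le> ?S2"
    proof (rule cSUP_upper2[OF _ one])
      show "bdd_above ((\<lambda>e. onorm (\<lambda>x. \<Sum>k<n. complex_of_real (e k) * xds k x)) ` sign_seqs n)"
        using on by (auto intro!: bdd_aboveI2)
    qed (use on[OF one] in blast)
    have "C * ?S1 * ?S2 \<le> \<bar>C\<bar> * a * b"
      using 1 2 3 by (intro mult_mono) (auto intro: mult_nonneg_nonneg order_trans)
    then show ?thesis using C[of n Ts xds xs] T d by auto
  qed
  then show ?thesis by (intro that[of "\<bar>C\<bar>"]) auto
qed

section \<open>Operator-valued functions\<close>

lemma Arg_uminus_of_real: "b > 0 \<Longrightarrow> Arg (- complex_of_real b) = pi"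
  by (simp add: Arg_minus Arg_of_real)

lemma open_sector': "open (sector s)"
proof (cases "s \<le> pi")
  case False
  then have "sector s = - {0}"
    using abs_Arg_le_pi by (force simp: sector_def intro: order.strict_trans1)
  then show ?thesis by (simp add: open_Compl)
qed (rule open_sector)

section \<open>Cauchy's theorem for scalar integrals over the two boundary rays of a sector\<close>

definition ray_diff :: "real \<Rightarrow> (complex \<Rightarrow> complex) \<Rightarrow> real \<Rightarrow> complex" where
  "ray_diff \<nu> h t = h (of_real t * cis (- \<nu>)) * cis (- \<nu>) - h (of_real t * cis \<nu>) * cis \<nu>"

lemma decay_bounds:
  fixes z w :: complex
  assumes "cmod w \<le> C / (1 + cmod z)\<^sup>2" "z \<noteq> 0" "0 \<le> C"
  shows "cmod (z * w) \<le> C / cmod z" "cmod (z * w) \<le> C * cmod z"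
proof -
  define r where "r = cmod z"
  have r: "r > 0" using assms by (simp add: r_def)
  have le: "cmod (z * w) \<le> r * (C / (1 + r)\<^sup>2)"
    using assms r by (simp add: norm_mult r_def mult_left_mono del: times_divide_eq_right)
  also have "\<dots> \<le> r * (C / r\<^sup>2)"
    using r assms(3) by (intro mult_left_mono divide_left_mono power_mono) auto
  also have "\<dots> = C / r" using r by (simp add: power2_eq_square)
  finally show "cmod (z * w) \<le> C / cmod z" by (simp add: r_def)
  note le
  also have "r * (C / (1 + r)\<^sup>2) \<le> r * (C / 1)"
    using r assms(3) by (intro mult_left_mono divide_left_mono) auto
  finally show "cmod (z * w) \<le> C * cmod z" by (simp add: r_def mult.commute)
qed

text \<open>One rotation through the inside of the sector; quadratic decay kills the arcs at both
  ends.\<close>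

lemma ray_diff_holomorphic:
  assumes \<nu>: "0 \<le> \<nu>" "\<nu> < \<tau>" "\<tau> \<le> pi" and h: "h holomorphic_on sector \<tau>"
    and C: "0 \<le> C" "\<And>z. z \<noteq> 0 \<Longrightarrow> \<bar>Arg z\<bar> \<le> \<nu> \<Longrightarrow> cmod (h z) \<le> C / (1 + cmod z)\<^sup>2"
  shows "(ray_diff \<nu> h has_integral 0) {0<..}"
proof -
  have sec: "{z. z \<noteq> 0 \<and> - \<tau> < Arg z \<and> Arg z < \<tau>} = sector \<tau>"
    by (auto simp: sector_def abs_less_iff)
  have "((\<lambda>t. h (of_real t * cis (- \<nu>)) * cis (- \<nu>) - h (of_real t * cis \<nu>) * cis \<nu>)
    has_integral (\<i> * 0 * (of_real (- \<nu>) - of_real \<nu>))) {0<..}"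
  proof (rule ray_rotation[where \<alpha> = "- \<tau>" and \<beta> = \<tau> and C = C])
    fix z assume z: "z \<noteq> 0" "- \<nu> \<le> Arg z" "Arg z \<le> \<nu>"
    then have "cmod (h z) \<le> C / (1 + cmod z)\<^sup>2" by (intro C(2)) auto
    from decay_bounds[OF this z(1) C(1)]
    show "cmod (z * h z - 0) \<le> C / cmod z" "cmod (z * h z) \<le> C * cmod z" by auto
  qed (use \<nu> h in \<open>auto simp: sec\<close>)
  then show ?thesis unfolding ray_diff_def by simp
qed

text \<open>The upper and the lower ray are rotated separately, so holomorphy is used only for
  \<open>\<bar>Arg z\<bar>\<close> between \<open>\<omega>\<close> and \<open>\<tau>\<close>; the
  inner sector may contain spectrum.\<close>

lemma ray_diff_shift:
  assumes \<nu>: "0 \<le> \<omega>" "\<omega> < \<nu>1" "\<nu>1 \<le> \<nu>2" "\<nu>2 < \<tau>" "\<tau> \<le> pi"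
    and h: "h holomorphic_on {z. z \<noteq> 0 \<and> \<omega> < \<bar>Arg z\<bar> \<and> \<bar>Arg z\<bar> < \<tau>}"
    and C: "0 \<le> C" "\<And>z. z \<noteq> 0 \<Longrightarrow> \<nu>1 \<le> \<bar>Arg z\<bar> \<Longrightarrow> \<bar>Arg z\<bar> \<le> \<nu>2 \<Longrightarrow> cmod (h z) \<le> C / (1 + cmod z)\<^sup>2"
  shows "((\<lambda>t. ray_diff \<nu>1 h t - ray_diff \<nu>2 h t) has_integral 0) {0<..}"
proof -
  have up: "((\<lambda>t. h (of_real t * cis \<nu>1) * cis \<nu>1 - h (of_real t * cis \<nu>2) * cis \<nu>2)
    has_integral (\<i> * 0 * (of_real \<nu>1 - of_real \<nu>2))) {0<..}"
  proof (rule ray_rotation[where \<alpha> = \<omega> and \<beta> = \<tau> and C = C])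
    fix z assume z: "z \<noteq> 0" "\<nu>1 \<le> Arg z" "Arg z \<le> \<nu>2"
    then have "cmod (h z) \<le> C / (1 + cmod z)\<^sup>2" using \<nu> by (intro C(2)) auto
    from decay_bounds[OF this z(1) C(1)]
    show "cmod (z * h z - 0) \<le> C / cmod z" "cmod (z * h z) \<le> C * cmod z" by auto
  next
    show "h holomorphic_on {z. z \<noteq> 0 \<and> \<omega> < Arg z \<and> Arg z < \<tau>}"
      by (rule holomorphic_on_subset[OF h]) (use \<nu> in auto)
  qed (use \<nu> in auto)
  have down: "((\<lambda>t. h (of_real t * cis (- \<nu>2)) * cis (- \<nu>2) - h (of_real t * cis (- \<nu>1)) * cis (- \<nu>1))
    has_integral (\<i> * 0 * (of_real (- \<nu>2) - of_real (- \<nu>1)))) {0<..}"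
  proof (rule ray_rotation[where \<alpha> = "- \<tau>" and \<beta> = "- \<omega>" and C = C])
    fix z assume z: "z \<noteq> 0" "- \<nu>2 \<le> Arg z" "Arg z \<le> - \<nu>1"
    then have "cmod (h z) \<le> C / (1 + cmod z)\<^sup>2" using \<nu> by (intro C(2)) auto
    from decay_bounds[OF this z(1) C(1)]
    show "cmod (z * h z - 0) \<le> C / cmod z" "cmod (z * h z) \<le> C * cmod z" by auto
  next
    show "h holomorphic_on {z. z \<noteq> 0 \<and> - \<tau> < Arg z \<and> Arg z < - \<omega>}"
      by (rule holomorphic_on_subset[OF h]) (use \<nu> in auto)
  qed (use \<nu> in auto)
  from has_integral_add[OF has_integral_neg[OF up] has_integral_neg[OF down]]
  show ?thesis by (simp add: ray_diff_def algebra_simps)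
qed

section \<open>The setting of the theorem and weak holomorphy of the operator-valued
  integrand\<close>

locale operator_valued_calculus = sectorial_operator D A \<omega>
  for D :: "'a::complex_banach set" and A \<omega> +
  fixes \<sigma> \<rho> :: real and F :: "complex \<Rightarrow> 'a \<Rightarrow> 'a"
  assumes Hinf: "Hinf_calculus D A \<omega> \<sigma>" and rho: "\<sigma> < \<rho>"
    and Hinf_op: "Hinf_op D A \<rho> F" and U_bounded: "U_bounded (F ` sector \<rho>)"
begin

text \<open>For \<open>\<rho> > pi\<close> the set \<open>sector \<rho>\<close> contains the
  negative axis, where \<open>phi\<close> and the bumps have their poles; the truncated angle keeps
  them outside.\<close>

definition \<tau> where "\<tau> = min \<rho> pi"

lemma sigma: "\<omega> < \<sigma>" "\<sigma> < pi" "\<sigma> < \<tau>" "\<tau> \<le> pi" "\<tau> \<le> \<rho>" "0 < \<sigma>"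
  using Hinf rho omega by (auto simp: Hinf_calculus_def \<tau>_def)

lemma bop_F: "z \<in> sector \<rho> \<Longrightarrow> bop (F z)"
  using Hinf_op by (auto simp: Hinf_op_def comm_alg_def)

lemma F_resolv: "z \<in> sector \<rho> \<Longrightarrow> l \<in> res_set \<Longrightarrow> F z (R l x) = R l (F z x)"
proof -
  assume "z \<in> sector \<rho>" "l \<in> res_set"
  then have "F z \<circ> R l = R l \<circ> F z"
    using Hinf_op in_resolvent[of l] by (auto simp: Hinf_op_def comm_alg_def)
  then show ?thesis by (auto simp: fun_eq_iff)
qed

lemma F_bound:
  obtains C where "0 \<le> C" "\<And>z x. z \<in> sector \<rho> \<Longrightarrow> norm (F z x) \<le> C * norm x"
proof -
  obtain C where C: "\<And>z x. z \<in> sector \<rho> \<Longrightarrow> norm (F z x) \<le> C * norm x"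
    using Hinf_op unfolding Hinf_op_def by blast
  have "norm (F z x) \<le> \<bar>C\<bar> * norm x" if "z \<in> sector \<rho>" for z x
    using C[OF that, of x] by (rule order_trans) (intro mult_right_mono, auto)
  then show ?thesis using that[of "\<bar>C\<bar>"] by simp
qed

lemma has_field_derivative_F:
  assumes z: "z \<in> sector \<rho>" and f: "dual_elem f"
  obtains d where "((\<lambda>z. f (F z y)) has_field_derivative d) (at z)"
proof -
  obtain v where v: "((\<lambda>z. F z y) has_derivative (\<lambda>h. cscale h v)) (at z)"
    using Hinf_op z unfolding Hinf_op_def vec_holomorphic_on_def by blast
  have "((\<lambda>z. f (F z y)) has_derivative (\<lambda>h. f (cscale h v))) (at z)"
    using f v unfolding dual_elem_def by (intro bounded_linear.has_derivative[of f]) auto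
  moreover have "(\<lambda>h. f (cscale h v)) = (*) (f v)"
    by (simp add: fun_eq_iff dual_elem_simps[OF f] mult.commute)
  ultimately have "((\<lambda>z. f (F z y)) has_field_derivative f v) (at z)"
    unfolding has_field_derivative_def by simp
  then show ?thesis by (rule that)
qed

lemma holomorphic_F:
  assumes "dual_elem f" "T \<subseteq> sector \<rho>"
  shows "(\<lambda>z. f (F z y)) holomorphic_on T"
  unfolding holomorphic_on_def
proof (rule ballI)
  fix z assume "z \<in> T"
  then obtain d where "((\<lambda>z. f (F z y)) has_field_derivative d) (at z)"
    using has_field_derivative_F[of z f y] assms by blast
  then show "(\<lambda>z. f (F z y)) field_differentiable at z within T"
    using field_differentiable_at_within field_differentiable_def by blast
qed

text \<open>A product rule for strongly analytic factors. With \<open>u = R l y\<close> the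
  resolvent identity gives \<open>F m (R m y) = F m u + (l - m) F m (R m u)\<close>; the first term
  is differentiable by hypothesis, and uniform boundedness of \<open>F\<close> yields the limit of
  \<open>F m (R m u)\<close>.\<close>

lemma holomorphic_F_resolv:
  assumes f: "dual_elem f" and T: "T \<subseteq> sector \<rho> \<inter> res_set"
  shows "(\<lambda>z. f (F z (R z y))) holomorphic_on T"
  unfolding holomorphic_on_def
proof (rule ballI)
  fix l assume "l \<in> T"
  then have l: "l \<in> sector \<rho>" "l \<in> res_set" using T by auto
  obtain C where C: "0 \<le> C" "\<And>z x. z \<in> sector \<rho> \<Longrightarrow> norm (F z x) \<le> C * norm x" using F_bound by blast
  obtain B where B: "0 \<le> B" "\<And>x. cmod (f x) \<le> norm x * B"
    using f bounded_linear.nonneg_bounded[of f] unfolding dual_elem_def by blast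
  define u where "u = R l y"
  obtain d where d: "((\<lambda>z. f (F z u)) has_field_derivative d) (at l)"
    using has_field_derivative_F[OF l(1) f] by blast
  obtain d' where d': "((\<lambda>z. f (F z (R l u))) has_field_derivative d') (at l)"
    using has_field_derivative_F[OF l(1) f] by blast
  have ev: "eventually (\<lambda>m. m \<in> sector \<rho>) (at l)" "eventually (\<lambda>m. m \<in> res_set) (at l)"
    using l open_sector' open_res_set by (auto intro: eventually_at_in_open')
  have "((\<lambda>m. f (F m (R m u - R l u))) \<longlongrightarrow> 0) (at l)"
  proof (rule Lim_null_comparison)
    show "eventually (\<lambda>m. cmod (f (F m (R m u - R l u))) \<le> C * norm (R m u - R l u) * B) (at l)"
      using ev(1) by eventually_elim (rule order_trans[OF B(2)], intro mult_right_mono C(2) B(1))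
    have "((\<lambda>m. C * norm (R m u - R l u) * B) \<longlongrightarrow> C * norm (R l u - R l u) * B) (at l)"
      by (intro tendsto_intros tendsto_resolv l)
    then show "((\<lambda>m. C * norm (R m u - R l u) * B) \<longlongrightarrow> 0) (at l)" by simp
  qed
  moreover have "((\<lambda>m. f (F m (R l u))) \<longlongrightarrow> f (F l (R l u))) (at l)"
    using DERIV_isCont[OF d'] by (simp add: isCont_def)
  ultimately have "((\<lambda>m. f (F m (R m u - R l u)) + f (F m (R l u))) \<longlongrightarrow> 0 + f (F l (R l u))) (at l)"
    by (rule tendsto_add)
  then have "((\<lambda>m. - (f (F m (R m u - R l u)) + f (F m (R l u))) + (f (F m u) - f (F l u)) / (m - l))
      \<longlongrightarrow> - (0 + f (F l (R l u))) + d) (at l)"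
    using d unfolding has_field_derivative_iff by (rule tendsto_add[OF tendsto_minus])
  moreover have "eventually (\<lambda>m. - (f (F m (R m u - R l u)) + f (F m (R l u))) + (f (F m u) - f (F l u)) / (m - l)
      = (f (F m (R m y)) - f (F l (R l y))) / (m - l)) (at l)"
    using ev eventually_neq_at_within[of l l UNIV]
  proof eventually_elim
    case (elim m)
    note bm = bop_simps[OF bop_F[OF elim(1)]]
    have "R m y = u + cscale (l - m) (R m u)"
      using resolvent_identity[OF elim(2) l(2), of y] by (simp add: u_def algebra_simps)
    then have "f (F m (R m y)) = f (F m u) + (l - m) * f (F m (R m u))"
      using f by (simp add: bm dual_elem_simps)
    moreover have "f (F m (R m u - R l u)) + f (F m (R l u)) = f (F m (R m u))"
      using f by (simp add: bm dual_elem_simps)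
    ultimately show ?case using elim by (simp add: u_def field_simps)
  qed
  ultimately have "((\<lambda>m. (f (F m (R m y)) - f (F l (R l y))) / (m - l)) \<longlongrightarrow> - (0 + f (F l (R l u))) + d) (at l)"
    by (rule Lim_transform_eventually)
  then have "((\<lambda>m. f (F m (R m y))) has_field_derivative - (0 + f (F l (R l u))) + d) (at l)"
    unfolding has_field_derivative_iff .
  then show "(\<lambda>m. f (F m (R m y))) field_differentiable at l within T"
    using field_differentiable_at_within field_differentiable_def by blast
qed

section \<open>Decomposition of one bump of the integrand into a main term and a holomorphic
  error\<close>

definition Q :: "real \<Rightarrow> 'a \<Rightarrow> 'a" where
  "Q b = pole_diff_op (- (2 * of_real b)) (- of_real b)"

text \<open>The main term. The factor \<open>l\<close> in the bump turns \<open>R l\<close> into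
  \<open>S l\<close>, and subtracting \<open>S (- b)\<close> makes the result a pole difference,
  decaying at both ends; \<open>Q b\<close> is the other decaying factor.\<close>

definition kernel :: "('a \<Rightarrow> complex) \<Rightarrow> 'a \<Rightarrow> nat \<Rightarrow> real \<Rightarrow> complex \<Rightarrow> complex" where
  "kernel f x n b l = phi n l * weight b l * f (F l (pole_diff_op l (- of_real b) (Q b x)))"

text \<open>The errors of the exchange: \<open>F l\<close> acts here on vectors independent of
  \<open>l\<close>, so no resolvent at \<open>l\<close> remains and the function is holomorphic
  across the spectrum.\<close>

definition remainder :: "('a \<Rightarrow> complex) \<Rightarrow> 'a \<Rightarrow> nat \<Rightarrow> real \<Rightarrow> complex \<Rightarrow> complex" where
  "remainder f x n b l = phi n l * weight b l * (f (F l (S (- of_real b) (Q b x)))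
     + l / (of_real b + l) * f (F l (S (- of_real b) x)) - l / (2 * of_real b + l) * f (F l (S (- (2 * of_real b)) x)))"

lemma neg_res: "b > 0 \<Longrightarrow> - complex_of_real b \<in> res_set" "b > 0 \<Longrightarrow> - (2 * complex_of_real b) \<in> res_set"
  using neg_real_in_res_set[of b] neg_real_in_res_set[of "2 * b"] by auto

lemma bop_Q: "b > 0 \<Longrightarrow> bop (Q b)"
  unfolding Q_def by (intro bop_pole_diff_op neg_res)

text \<open>By \<open>bump_eq\<close> the bump contains a pole difference in \<open>l\<close>; two
  applications of \<open>cscale_resolv\<close> exchange it for \<open>Q b\<close> acting on
  \<open>x\<close>, and the correction by \<open>S (- b)\<close> is added and subtracted.\<close>

lemma bump_resolv:
  assumes f: "dual_elem f" and b: "b > 0" and l: "l \<in> res_set" "\<bar>Arg l\<bar> < \<tau>"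
  shows "bump b l * (phi n l * f (F l (R l x))) = kernel f x n b l + remainder f x n b l"
proof -
  have lz: "l \<noteq> 0" "l \<in> sector \<rho>" using l sigma by (auto simp: res_set_def sector_def)
  have Argn: "Arg (- complex_of_real b) = pi" "Arg (- (2 * complex_of_real b)) = pi"
    using b Arg_minus[of "of_real b"] Arg_minus[of "of_real (2 * b)"] by auto
  have ne: "l \<noteq> - of_real b" "l \<noteq> - (2 * of_real b)" using l sigma Argn by auto
  have nz: "complex_of_real b + l \<noteq> 0" "2 * complex_of_real b + l \<noteq> 0"
    using ne by (auto simp: add_eq_0_iff2 add_eq_0_iff)
  note bm = bop_simps[OF bop_F[OF lz(2)]]
  define p where "p = pole_diff (- (2 * of_real b)) (- of_real b) l"
  have "- (2 * complex_of_real b) - l = - (2 * of_real b + l)" "- complex_of_real b - l = - (of_real b + l)" by auto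
  then have den: "1 / (- (2 * complex_of_real b) - l) = - (1 / (2 * of_real b + l))"
      "1 / (- complex_of_real b - l) = - (1 / (of_real b + l))"
    by (metis divide_minus_right)+
  have "cscale p (R l x) = R l (Q b x) + cscale (1 / (of_real b + l)) (S (- of_real b) x)
      - cscale (1 / (2 * of_real b + l)) (S (- (2 * of_real b)) x)"
    unfolding p_def pole_diff_def cscale.diff_left cscale_resolv[OF l(1) neg_res(1)[OF b] ne(1)]
      cscale_resolv[OF l(1) neg_res(2)[OF b] ne(2)] Q_def pole_diff_op_def
    unfolding den bop_simps(2)[OF bop_resolv[OF l(1)]] cscale.minus_left by simp
  then have "f (F l (cscale p (R l x))) = f (F l (R l (Q b x) + cscale (1 / (of_real b + l)) (S (- of_real b) x)
      - cscale (1 / (2 * of_real b + l)) (S (- (2 * of_real b)) x)))" by (rule arg_cong)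
  then have 1: "p * f (F l (R l x)) = f (F l (R l (Q b x))) + 1 / (of_real b + l) * f (F l (S (- of_real b) x))
      - 1 / (2 * of_real b + l) * f (F l (S (- (2 * of_real b)) x))"
    using f by (simp only: bm dual_elem_simps)
  have 2: "f (F l (pole_diff_op l (- of_real b) (Q b x))) = l * f (F l (R l (Q b x))) - f (F l (S (- of_real b) (Q b x)))"
    using f by (simp add: pole_diff_op_def S_def[of l] bm dual_elem_simps)
  have "bump b l * (phi n l * f (F l (R l x))) = phi n l * weight b l * l * (p * f (F l (R l x)))"
    using bump_eq[OF nz] by (simp add: p_def)
  also have "\<dots> = kernel f x n b l + remainder f x n b l"
    unfolding 1 kernel_def remainder_def 2 by (simp add: algebra_simps)
  finally show ?thesis .
qed

lemma F_functional_bound: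
  assumes "\<And>y. cmod (f y) \<le> norm y"
  obtains C where "0 \<le> C" "\<And>z y. z \<in> sector \<rho> \<Longrightarrow> cmod (f (F z y)) \<le> C * norm y"
  using F_bound order_trans[OF assms] by metis

lemma holomorphic_phi: "n \<ge> 1 \<Longrightarrow> phi n holomorphic_on sector \<tau>"
proof -
  assume n: "n \<ge> 1"
  have "Arg (- of_nat n) = pi" "Arg (- (1 / of_nat n)) = pi"
    using n Arg_uminus_of_real[of "real n"] Arg_uminus_of_real[of "1 / real n"] by auto
  then have "- of_nat n - z \<noteq> 0" "- (1 / of_nat n) - z \<noteq> 0" if "z \<in> sector \<tau>" for z
    using that sigma by (auto simp: sector_def)
  then show ?thesis
    unfolding phi_eq_pole_diff[OF n, abs_def] pole_diff_def by (intro holomorphic_intros) auto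
qed

lemma shift_nz:
  assumes "z \<in> sector \<tau>" "b > 0"
  shows "complex_of_real b + z \<noteq> 0" "2 * complex_of_real b + z \<noteq> 0"
proof -
  have *: "complex_of_real b + z \<noteq> 0" if "b > 0" for b
  proof
    assume "complex_of_real b + z = 0"
    then have "z = - complex_of_real b" by (simp add: add_eq_0_iff2)
    then have "Arg z = pi" using that Arg_minus[of "of_real b"] by simp
    then show False using assms(1) sigma by (simp add: sector_def)
  qed
  show "complex_of_real b + z \<noteq> 0" "2 * complex_of_real b + z \<noteq> 0"
    using *[of b] *[of "2 * b"] assms by auto
qed

lemma holomorphic_weight: "b > 0 \<Longrightarrow> weight b holomorphic_on sector \<tau>"
  unfolding weight_def[abs_def] by (intro holomorphic_intros) (use shift_nz in auto)

lemma sector_subset: "sector \<tau> \<subseteq> sector \<rho>"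
  using sigma by (auto simp: sector_def)

lemma holomorphic_kernel:
  assumes "n \<ge> 1" "b > 0" "dual_elem f"
  shows "kernel f x n b holomorphic_on sector \<tau> \<inter> res_set"
proof -
  have "(\<lambda>l. phi n l * weight b l * (l * f (F l (R l (Q b x))) - f (F l (S (- of_real b) (Q b x)))))
      holomorphic_on sector \<tau> \<inter> res_set"
    using sector_subset assms
    by (intro holomorphic_on_mult holomorphic_on_diff holomorphic_on_ident holomorphic_F_resolv holomorphic_F
        holomorphic_on_subset[OF holomorphic_phi] holomorphic_on_subset[OF holomorphic_weight]) auto
  then show ?thesis
  proof (rule holomorphic_transform)
    fix l assume "l \<in> sector \<tau> \<inter> res_set"
    then have "bop (F l)" using bop_F sector_subset by auto
    then show "phi n l * weight b l * (l * f (F l (R l (Q b x))) - f (F l (S (- of_real b) (Q b x)))) = kernel f x n b l"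
      using assms(3) by (simp add: kernel_def pole_diff_op_def S_def[of l] bop_simps dual_elem_simps)
  qed
qed

lemma holomorphic_remainder:
  assumes "n \<ge> 1" "b > 0" "dual_elem f"
  shows "remainder f x n b holomorphic_on sector \<tau>"
  unfolding remainder_def[abs_def]
  using sector_subset assms shift_nz
  by (intro holomorphic_on_mult holomorphic_on_add holomorphic_on_diff holomorphic_on_divide holomorphic_on_ident
      holomorphic_on_const holomorphic_F holomorphic_phi holomorphic_weight) auto

lemma pole_diff_op_bounded:
  assumes "\<omega> < \<nu>" "\<nu> < pi"
  obtains C where "0 \<le> C" "\<And>l b y. l \<noteq> 0 \<Longrightarrow> \<nu> \<le> \<bar>Arg l\<bar> \<Longrightarrow> b > 0 \<Longrightarrow> norm (pole_diff_op l (- of_real b) y) \<le> C * norm y"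
proof -
  obtain C where C: "0 \<le> C" "\<And>l x. l \<noteq> 0 \<Longrightarrow> \<nu> \<le> \<bar>Arg l\<bar> \<Longrightarrow> norm (R l x) \<le> C / cmod l * norm x"
    using resolv_bound[OF assms] by blast
  have S: "norm (S l y) \<le> C * norm y" if "l \<noteq> 0" "\<nu> \<le> \<bar>Arg l\<bar>" for l y
    using mult_left_mono[OF C(2)[OF that, of y], of "cmod l"] that by (simp add: S_def norm_cscale)
  have "norm (pole_diff_op l (- of_real b) y) \<le> (2 * C) * norm y"
    if "l \<noteq> 0" "\<nu> \<le> \<bar>Arg l\<bar>" "b > 0" for l b y
  proof -
    have "Arg (- complex_of_real b) = pi" using that Arg_minus[of "of_real b"] by simp
    then have "norm (S (- of_real b) y) \<le> C * norm y" using that assms by (intro S) auto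
    then show ?thesis
      using S[OF that(1,2), of y] norm_triangle_ineq4[of "S l y" "S (- of_real b) y"] by (simp add: pole_diff_op_def)
  qed
  then show ?thesis using that[of "2 * C"] C(1) by simp
qed

text \<open>Qualitative decay on one pair of rays; \<open>C\<close> may depend on \<open>n\<close>,
  \<open>b\<close> and \<open>x\<close>, as only absolute integrability is at stake.\<close>

lemma kernel_bound:
  assumes \<nu>: "\<omega> < \<nu>" "\<nu> < \<tau>" and n: "n \<ge> 1" and b: "b > 0" and f: "\<And>y. cmod (f y) \<le> norm y"
  obtains C where "0 \<le> C" "\<And>l. l \<noteq> 0 \<Longrightarrow> \<bar>Arg l\<bar> = \<nu> \<Longrightarrow> cmod (kernel f x n b l) \<le> C / (1 + cmod l)\<^sup>2"
proof -
  have \<nu>': "0 \<le> \<nu>" "\<nu> < pi" using \<nu> sigma omega by auto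
  obtain c where "sector_constant \<nu> c" using sector_constant_exists[OF \<nu>'] .
  then interpret sector_constant \<nu> c .
  obtain W where W: "0 \<le> W" "\<And>z. z \<noteq> 0 \<Longrightarrow> \<bar>Arg z\<bar> \<le> \<nu> \<Longrightarrow> cmod (weight b z) \<le> W / (1 + cmod z)\<^sup>2"
    using weight_le'[OF b] by blast
  obtain G where G: "0 \<le> G" "\<And>z y. z \<in> sector \<rho> \<Longrightarrow> cmod (f (F z y)) \<le> G * norm y"
    using F_functional_bound[OF f] by blast
  obtain P where P: "0 \<le> P" "\<And>l b y. l \<noteq> 0 \<Longrightarrow> \<nu> \<le> \<bar>Arg l\<bar> \<Longrightarrow> b > 0 \<Longrightarrow> norm (pole_diff_op l (- of_real b) y) \<le> P * norm y"
    using pole_diff_op_bounded[OF \<nu>(1) \<nu>'(2)] by blast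
  define C where "C = 2 / c * W * (G * (P * norm (Q b x)))"
  have "cmod (kernel f x n b l) \<le> C / (1 + cmod l)\<^sup>2" if l: "l \<noteq> 0" "\<bar>Arg l\<bar> = \<nu>" for l
  proof -
    have "l \<in> sector \<rho>" using l \<nu> sigma by (auto simp: sector_def)
    then have "cmod (f (F l (pole_diff_op l (- of_real b) (Q b x)))) \<le> G * (P * norm (Q b x))"
      using l b by (intro order_trans[OF G(2)] mult_left_mono P G) auto
    then have "cmod (kernel f x n b l) \<le> 2 / c * (W / (1 + cmod l)\<^sup>2) * (G * (P * norm (Q b x)))"
      unfolding kernel_def norm_mult using l n c W(1) by (intro mult_mono phi_le W) auto
    then show ?thesis by (simp add: C_def mult_ac)
  qed
  moreover have "0 \<le> C" using c W G P by (simp add: C_def)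
  ultimately show ?thesis using that by blast
qed

text \<open>Here the decay must hold in the full closed sector, since the contour is collapsed
  through its interior.\<close>

lemma remainder_bound:
  assumes \<nu>: "0 \<le> \<nu>" "\<nu> < \<tau>" and n: "n \<ge> 1" and b: "b > 0" and f: "\<And>y. cmod (f y) \<le> norm y"
  obtains C where "0 \<le> C" "\<And>l. l \<noteq> 0 \<Longrightarrow> \<bar>Arg l\<bar> \<le> \<nu> \<Longrightarrow> cmod (remainder f x n b l) \<le> C / (1 + cmod l)\<^sup>2"
proof -
  have \<nu>': "\<nu> < pi" using \<nu> sigma by auto
  obtain c where "sector_constant \<nu> c" using sector_constant_exists[OF \<nu>(1) \<nu>'] .
  then interpret sector_constant \<nu> c .
  obtain W where W: "0 \<le> W" "\<And>z. z \<noteq> 0 \<Longrightarrow> \<bar>Arg z\<bar> \<le> \<nu> \<Longrightarrow> cmod (weight b z) \<le> W / (1 + cmod z)\<^sup>2"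
    using weight_le'[OF b] by blast
  obtain G where G: "0 \<le> G" "\<And>z y. z \<in> sector \<rho> \<Longrightarrow> cmod (f (F z y)) \<le> G * norm y"
    using F_functional_bound[OF f] by blast
  define y1 y2 y3 where "y1 = S (- of_real b) (Q b x)" and "y2 = S (- of_real b) x" and "y3 = S (- (2 * of_real b)) x"
  define Z where "Z = G * norm y1 + 1 / c * (G * norm y2) + 1 / c * (G * norm y3)"
  define C where "C = 2 / c * W * Z"
  have Z: "0 \<le> Z" using c G by (simp add: Z_def)
  have "cmod (remainder f x n b l) \<le> C / (1 + cmod l)\<^sup>2" if l: "l \<noteq> 0" "\<bar>Arg l\<bar> \<le> \<nu>" for l
  proof -
    have ls: "l \<in> sector \<rho>" using l \<nu> sigma by (auto simp: sector_def)
    let ?a = "f (F l y1)" and ?b = "l / (of_real b + l) * f (F l y2)" and ?c = "l / (2 * of_real b + l) * f (F l y3)"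
    have "cmod (l / (2 * of_real b + l)) \<le> 1 / c" using ratio'_le[OF l, of "2 * b"] b by simp
    then have "cmod ?c \<le> 1 / c * (G * norm y3)"
      unfolding norm_mult using c ls by (intro mult_mono G) auto
    moreover have "cmod ?b \<le> 1 / c * (G * norm y2)"
      unfolding norm_mult using c ls l b by (intro mult_mono G ratio'_le) auto
    moreover have "cmod ?a \<le> G * norm y1" using ls by (rule G)
    moreover have "cmod (?a + ?b - ?c) \<le> cmod ?a + cmod ?b + cmod ?c"
      by (meson norm_triangle_ineq norm_triangle_ineq4 add_right_mono order_trans)
    ultimately have "cmod (?a + ?b - ?c) \<le> Z" unfolding Z_def by linarith
    then have "cmod (phi n l * weight b l * (?a + ?b - ?c)) \<le> 2 / c * (W / (1 + cmod l)\<^sup>2) * Z"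
      unfolding norm_mult using l n c W(1) by (intro mult_mono phi_le W) auto
    then show ?thesis by (simp add: remainder_def C_def y1_def y2_def y3_def mult_ac)
  qed
  moreover have "0 \<le> C" using c W Z by (simp add: C_def)
  ultimately show ?thesis using that by blast
qed

end

section \<open>Convergence of the dyadic partition and rescaling of rays\<close>

lemma tendsto_smooth_step: "(f \<longlongrightarrow> a) G \<Longrightarrow> ((\<lambda>x. smooth_step (f x)) \<longlongrightarrow> smooth_step a) G"
  unfolding smooth_step_def by (intro tendsto_intros)

text \<open>Starting at scale \<open>2^(-N)\<close>, the \<open>2 * N\<close> bumps telescope to
  steps at the scales \<open>2^N\<close> and \<open>2^(-N)\<close>, which tend to \<open>1\<close>
  and \<open>0\<close> at a fixed nonzero point.\<close>

lemma tendsto_sum_bump: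
  assumes "z \<noteq> 0"
  shows "(\<lambda>N. \<Sum>k<2 * N. bump ((1/2) ^ N * 2 ^ k) z) \<longlonglongrightarrow> 1"
proof -
  define u where "u = (\<lambda>N. complex_of_real ((1/2) ^ N))"
  have u: "u \<longlonglongrightarrow> 0"
    unfolding u_def using tendsto_of_real[OF LIMSEQ_realpow_zero[of "1/2"], where ?'a = complex] by simp
  have nz: "u N \<noteq> 0" for N by (simp add: u_def)
  have "(\<Sum>k<2 * N. bump ((1/2) ^ N * 2 ^ k) z) = smooth_step (1 / (1 + z * u N)) - smooth_step (u N / (u N + z))" for N
  proof -
    have "complex_of_real ((1/2) ^ N) * 2 ^ (2 * N) = 1 / u N"
      by (simp add: u_def power_one_over mult_2 power_add)
    then have "(\<Sum>k<2 * N. bump ((1/2) ^ N * 2 ^ k) z) = smooth_step ((1 / u N) / (1 / u N + z)) - smooth_step (u N / (u N + z))"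
      using sum_bump[of "(1/2) ^ N" z "2 * N"] by (simp only: u_def)
    moreover have "(1 / u N) / (1 / u N + z) = 1 / (1 + z * u N)"
      using nz[of N] by (simp add: divide_simps)
    ultimately show ?thesis by simp
  qed
  moreover have "(\<lambda>N. smooth_step (1 / (1 + z * u N)) - smooth_step (u N / (u N + z)))
      \<longlonglongrightarrow> smooth_step (1 / (1 + z * 0)) - smooth_step (0 / (0 + z))"
    using assms by (intro tendsto_diff tendsto_smooth_step tendsto_intros u) auto
  ultimately show ?thesis by (simp add: smooth_step_def)
qed

lemma integral_ray_rescale:
  fixes h :: "complex \<Rightarrow> complex"
  assumes int: "(\<lambda>t. h (of_real t * e)) absolutely_integrable_on {0<..}" and b: "b > 0"
  shows "(\<lambda>s. b * cmod (h (of_real b * (of_real s * e)))) integrable_on {0<..}"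
    and "integral {0<..} (\<lambda>t. cmod (h (of_real t * e))) = integral {0<..} (\<lambda>s. b * cmod (h (of_real b * (of_real s * e))))"
proof -
  have img: "(\<lambda>s. b * s) ` {0<..} = {0<..}"
  proof
    show "{0<..} \<subseteq> (\<lambda>s. b * s) ` {0<..}"
    proof
      fix t :: real assume "t \<in> {0<..}"
      then show "t \<in> (\<lambda>s. b * s) ` {0<..}" using b by (intro image_eqI[of _ _ "t / b"]) auto
    qed
  qed (use b in auto)
  have "(\<lambda>t. cmod (h (of_real t * e))) absolutely_integrable_on {0<..}"
    using absolutely_integrable_norm[OF int] by (simp add: o_def)
  then have *: "(\<lambda>s. \<bar>b\<bar> *\<^sub>R cmod (h (of_real (b * s) * e))) absolutely_integrable_on {0<..} \<and>
      integral {0<..} (\<lambda>s. \<bar>b\<bar> *\<^sub>R cmod (h (of_real (b * s) * e))) = integral {0<..} (\<lambda>t. cmod (h (of_real t * e)))"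
    using has_absolute_integral_change_of_variables_real[of "{0<..}" "\<lambda>s. b * s" "\<lambda>_. b"
        "\<lambda>t. cmod (h (of_real t * e))" "integral {0<..} (\<lambda>t. cmod (h (of_real t * e)))"] b
    by (simp add: img inj_on_def has_field_derivative_at_within DERIV_cmult_Id)
  have eq: "(\<lambda>s. \<bar>b\<bar> *\<^sub>R cmod (h (of_real (b * s) * e))) = (\<lambda>s. b * cmod (h (of_real b * (of_real s * e))))"
    using b by (simp add: fun_eq_iff mult.assoc)
  show "(\<lambda>s. b * cmod (h (of_real b * (of_real s * e)))) integrable_on {0<..}"
    using *[unfolded eq] by (blast intro: set_lebesgue_integral_eq_integral(1))
  show "integral {0<..} (\<lambda>t. cmod (h (of_real t * e))) = integral {0<..} (\<lambda>s. b * cmod (h (of_real b * (of_real s * e))))"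
    using *[unfolded eq] by simp
qed

section \<open>The uniform estimate of the main terms\<close>

context operator_valued_calculus
begin

lemma pole_diff_op_commute:
  assumes "l \<in> res_set" "z1 \<in> res_set" "z2 \<in> res_set" "z3 \<in> res_set"
  shows "pole_diff_op l z1 (pole_diff_op z2 z3 x) = pole_diff_op z2 z3 (pole_diff_op l z1 x)"
proof -
  have S: "S m (S k x) = S k (S m x)" if "m \<in> res_set" "k \<in> res_set" for m k x
    using that by (simp add: S_def resolv_simps resolv_commute[of m k] cscale_cscale mult.commute)
  note bS = bop_simps[OF bop_S]
  show ?thesis
    unfolding pole_diff_op_def using assms
    by (simp add: bS(2) S[OF assms(1,3)] S[OF assms(1,4)] S[OF assms(2,3)] S[OF assms(2,4)] algebra_simps)
qed

lemma F_pole_diff_op: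
  assumes "z \<in> sector \<rho>" "z1 \<in> res_set" "z2 \<in> res_set"
  shows "F z (pole_diff_op z1 z2 x) = pole_diff_op z1 z2 (F z x)"
  using assms bop_simps[OF bop_F[OF assms(1)]] by (simp add: pole_diff_op_def S_def F_resolv)

text \<open>For fixed \<open>\<mu>\<close> on the ray, the family \<open>F (b\<^sub>k \<mu>)\<close> is tested against the vectors
  \<open>pole_diff_op (b\<^sub>k \<mu>) (- b\<^sub>k) x\<close> and the functionals \<open>f \<circ> Q b\<^sub>k\<close>, whose random sums are
  controlled by the scalar calculus.\<close>

lemma U_bounded_pairing:
  assumes \<nu>: "\<sigma> < \<nu>" "\<nu> < \<tau>"
  obtains M where "0 \<le> M" "\<forall>f x \<mu> \<beta> K. dual_elem f \<longrightarrow> (\<forall>y. cmod (f y) \<le> norm y) \<longrightarrow> \<mu> \<noteq> 0 \<longrightarrow> \<bar>Arg \<mu>\<bar> = \<nu> \<longrightarrow> 0 < \<beta> \<longrightarrow>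
    (\<Sum>k<K. cmod (f (F (of_real (\<beta> * 2 ^ k) * \<mu>)
        (pole_diff_op (of_real (\<beta> * 2 ^ k) * \<mu>) (- of_real (\<beta> * 2 ^ k)) (Q (\<beta> * 2 ^ k) x)))))
      \<le> M * ((1 + cmod \<mu>) / sqrt (cmod \<mu>)) * norm x"
proof -
  have \<nu>': "\<nu> < pi" using \<nu> sigma by simp
  obtain U where U0: "0 \<le> U" and U1: "\<forall>n xs xds Ts a b.
    (\<forall>k<n. Ts k \<in> F ` sector \<rho>) \<longrightarrow> (\<forall>k<n. dual_elem (xds k)) \<longrightarrow> 0 \<le> b \<longrightarrow>
    (\<forall>e\<in>sign_seqs n. norm (\<Sum>k<n. e k *\<^sub>R xs k) \<le> a) \<longrightarrow>
    (\<forall>e\<in>sign_seqs n. \<forall>x. cmod (\<Sum>k<n. complex_of_real (e k) * xds k x) \<le> b * norm x) \<longrightarrow>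
    (\<Sum>k<n. cmod (xds k (Ts k (xs k)))) \<le> U * a * b"
    using U_boundedE[OF U_bounded] by blast
  note U = U0 U1[rule_format]
  obtain H where H0: "0 \<le> H" and H1: "\<forall>(I :: nat set) e z1 z2 B x. finite I \<longrightarrow> (\<forall>i\<in>I. \<bar>e i\<bar> \<le> 1) \<longrightarrow>
      (\<forall>i\<in>I. z1 i \<noteq> 0 \<and> z2 i \<noteq> 0 \<and> \<sigma> < \<bar>Arg (z1 i)\<bar> \<and> \<sigma> < \<bar>Arg (z2 i)\<bar>) \<longrightarrow>
      (\<forall>z\<in>sector \<sigma>. (\<Sum>i\<in>I. cmod (pole_diff (z1 i) (z2 i) z)) \<le> B) \<longrightarrow>
      norm (\<Sum>i\<in>I. e i *\<^sub>R pole_diff_op (z1 i) (z2 i) x) \<le> H * B * norm x"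
    using Hinf_pole_diff_bound[OF Hinf] by blast
  note H = H0 H1[rule_format]
  obtain C1 where C1: "0 \<le> C1" "\<And>z \<beta> K. z \<noteq> 0 \<Longrightarrow> \<bar>Arg z\<bar> \<le> \<sigma> \<Longrightarrow> 0 < \<beta> \<Longrightarrow>
      (\<Sum>k<K. cmod (pole_diff (- (2 * of_real (\<beta> * 2 ^ k))) (- of_real (\<beta> * 2 ^ k)) z)) \<le> C1"
    using pole_diff_sum_le[OF less_imp_le[OF sigma(6)] sigma(2)] by blast
  obtain C2 where C2: "0 \<le> C2" "\<And>z \<mu> \<beta> K. z \<noteq> 0 \<Longrightarrow> \<bar>Arg z\<bar> \<le> \<sigma> \<Longrightarrow> \<mu> \<noteq> 0 \<Longrightarrow> \<bar>Arg \<mu>\<bar> = \<nu> \<Longrightarrow> 0 < \<beta> \<Longrightarrow>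
      (\<Sum>k<K. cmod (pole_diff (of_real (\<beta> * 2 ^ k) * \<mu>) (- of_real (\<beta> * 2 ^ k)) z)) \<le> C2 * ((1 + cmod \<mu>) / sqrt (cmod \<mu>))"
    using pole_diff_ray_sum_le[OF less_imp_le[OF sigma(6)] \<nu>(1) \<nu>'] by blast
  have "(\<Sum>k<K. cmod (f (F (of_real (\<beta> * 2 ^ k) * \<mu>)
        (pole_diff_op (of_real (\<beta> * 2 ^ k) * \<mu>) (- of_real (\<beta> * 2 ^ k)) (Q (\<beta> * 2 ^ k) x)))))
      \<le> (U * (H * C2) * (H * C1)) * ((1 + cmod \<mu>) / sqrt (cmod \<mu>)) * norm x"
    if f: "dual_elem f" "\<And>y. cmod (f y) \<le> norm y" and \<mu>: "\<mu> \<noteq> 0" "\<bar>Arg \<mu>\<bar> = \<nu>" and \<beta>: "0 < \<beta>"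
    for f x \<mu> \<beta> K
  proof -
    define b where "b k = \<beta> * 2 ^ k" for k :: nat
    have b: "b k > 0" for k using \<beta> by (simp add: b_def)
    define l where "l k = of_real (b k) * \<mu>" for k
    have l: "l k \<noteq> 0" "\<bar>Arg (l k)\<bar> = \<nu>" for k using b[of k] \<mu> by (auto simp: l_def)
    have lr: "l k \<in> res_set" "l k \<in> sector \<rho>" for k
      using l[of k] \<nu> sigma by (auto simp: res_set_def sector_def)
    have nb: "Arg (- complex_of_real (b k)) = pi" "Arg (- (2 * complex_of_real (b k))) = pi" for k
      using Arg_uminus_of_real[OF b[of k]] Arg_uminus_of_real[of "2 * b k"] b[of k] by auto
    have sgn: "\<bar>e k\<bar> \<le> 1" if "e \<in> sign_seqs K" "k < K" for e k
      using that by (auto simp: sign_seqs_def)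
    let ?a = "H * (C2 * ((1 + cmod \<mu>) / sqrt (cmod \<mu>))) * norm x"
    \<comment> \<open>\<open>Q (b k)\<close> is pulled to the outside, where it belongs to the
      functional; this is legitimate because it commutes with \<open>F (l k)\<close> and with the
      other pole difference.\<close>
    have "(\<Sum>k<K. cmod (f (Q (b k) (F (l k) (pole_diff_op (l k) (- of_real (b k)) x))))) \<le> U * ?a * (H * C1)"
    proof (rule U(2)[where xds = "\<lambda>k y. f (Q (b k) y)" and Ts = "\<lambda>k. F (l k)"])
      show "F (l k) \<in> F ` sector \<rho>" for k using lr by blast
      show "dual_elem (\<lambda>y. f (Q (b k) y))" for k using f(1) bop_Q[OF b] by (rule dual_elem_compose)
      show "0 \<le> H * C1" using H C1 by simp
      fix e assume e: "e \<in> sign_seqs K"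
      show "norm (\<Sum>k<K. e k *\<^sub>R pole_diff_op (l k) (- of_real (b k)) x) \<le> ?a"
      proof (rule H(2))
        fix z assume "z \<in> sector \<sigma>"
        then show "(\<Sum>i<K. cmod (pole_diff (l i) (- of_real (b i)) z)) \<le> C2 * ((1 + cmod \<mu>) / sqrt (cmod \<mu>))"
          unfolding l_def b_def using \<mu> \<beta> by (intro C2(2)) (auto simp: sector_def)
      next
        fix i assume "i \<in> {..<K}"
        then show "\<bar>e i\<bar> \<le> 1" using sgn[OF e] by simp
        show "l i \<noteq> 0 \<and> - complex_of_real (b i) \<noteq> 0 \<and> \<sigma> < \<bar>Arg (l i)\<bar> \<and> \<sigma> < \<bar>Arg (- complex_of_real (b i))\<bar>"
          unfolding nb using l[of i] b[of i] sigma \<nu> by simp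
      qed simp
      fix y
      have "(\<Sum>k<K. complex_of_real (e k) * f (Q (b k) y)) = f (\<Sum>k<K. e k *\<^sub>R Q (b k) y)"
        using f(1) by (simp add: dual_elem_simps flip: cscale_of_real)
      also have "cmod \<dots> \<le> norm (\<Sum>k<K. e k *\<^sub>R Q (b k) y)" by (rule f(2))
      also have "\<dots> \<le> H * C1 * norm y"
        unfolding Q_def
      proof (rule H(2))
        fix z assume "z \<in> sector \<sigma>"
        then show "(\<Sum>i<K. cmod (pole_diff (- (2 * of_real (b i))) (- of_real (b i)) z)) \<le> C1"
          unfolding b_def using \<beta> by (intro C1(2)) (auto simp: sector_def)
      next
        fix i assume "i \<in> {..<K}"
        then show "\<bar>e i\<bar> \<le> 1" using sgn[OF e] by simp
        show "- (2 * complex_of_real (b i)) \<noteq> 0 \<and> - complex_of_real (b i) \<noteq> 0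
          \<and> \<sigma> < \<bar>Arg (- (2 * complex_of_real (b i)))\<bar> \<and> \<sigma> < \<bar>Arg (- complex_of_real (b i))\<bar>"
          unfolding nb using b[of i] sigma by simp
      qed simp
      finally show "cmod (\<Sum>k<K. complex_of_real (e k) * f (Q (b k) y)) \<le> H * C1 * norm y" .
    qed
    moreover have "Q (b k) (F (l k) (pole_diff_op (l k) (- of_real (b k)) x))
      = F (l k) (pole_diff_op (l k) (- of_real (b k)) (Q (b k) x))" for k
      unfolding Q_def using lr neg_res[OF b]
      by (simp add: F_pole_diff_op pole_diff_op_commute)
    ultimately show ?thesis by (simp add: l_def b_def mult_ac)
  qed
  moreover have "0 \<le> U * (H * C2) * (H * C1)" using U H C1 C2 by simp
  ultimately show ?thesis by (intro that[of "U * (H * C2) * (H * C1)"]) blast+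
qed

lemma ray_facts:
  assumes "\<omega> < \<nu>" "\<nu> < \<tau>" "t > 0" "\<theta> = \<nu> \<or> \<theta> = - \<nu>"
  shows "of_real t * cis \<theta> \<noteq> 0" "\<bar>Arg (of_real t * cis \<theta>)\<bar> = \<nu>" "cmod (of_real t * cis \<theta>) = t"
    "of_real t * cis \<theta> \<in> res_set" "of_real t * cis \<theta> \<in> sector \<tau>"
proof -
  have \<nu>': "0 \<le> \<nu>" "\<nu> < pi" using assms omega sigma by auto
  show 1: "of_real t * cis \<theta> \<noteq> 0" "\<bar>Arg (of_real t * cis \<theta>)\<bar> = \<nu>" "cmod (of_real t * cis \<theta>) = t"
    using assms \<nu>' by (auto simp: Arg_cis norm_mult)
  show "of_real t * cis \<theta> \<in> res_set" "of_real t * cis \<theta> \<in> sector \<tau>"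
    using 1 assms by (simp_all add: res_set_def sector_def)
qed

lemma continuous_on_ray:
  assumes "\<omega> < \<nu>" "\<nu> < \<tau>" "\<theta> = \<nu> \<or> \<theta> = - \<nu>" "h holomorphic_on sector \<tau> \<inter> res_set"
  shows "continuous_on {0<..} (\<lambda>t. h (of_real t * cis \<theta>))"
  by (rule continuous_on_compose2[OF holomorphic_on_imp_continuous_on[OF assms(4)]])
     (use ray_facts[OF assms(1,2) _ assms(3)] in \<open>auto intro!: continuous_intros\<close>)

lemma ray_absolutely_integrable:
  fixes h :: "complex \<Rightarrow> complex"
  assumes \<nu>: "\<omega> < \<nu>" "\<nu> < \<tau>" "\<theta> = \<nu> \<or> \<theta> = - \<nu>" and h: "h holomorphic_on sector \<tau> \<inter> res_set"
    and C: "\<And>l. l \<noteq> 0 \<Longrightarrow> \<bar>Arg l\<bar> = \<nu> \<Longrightarrow> cmod (h l) \<le> C / (1 + cmod l)\<^sup>2"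
  shows "(\<lambda>t. h (of_real t * cis \<theta>)) absolutely_integrable_on {0<..}"
proof -
  note cont = continuous_on_ray[OF \<nu> h]
  have le: "cmod (h (of_real t * cis \<theta>)) \<le> C / (1 + t)\<^sup>2" if "t > 0" for t
    using C[OF ray_facts(1,2)[OF \<nu>(1,2) that \<nu>(3)]] ray_facts(3)[OF \<nu>(1,2) that \<nu>(3)] by simp
  have "(\<lambda>t. h (of_real t * cis \<theta>)) integrable_on {0<..}"
    using cont le by (rule integrable_Ioi_decay)
  moreover have "(\<lambda>t. cmod (h (of_real t * cis \<theta>))) integrable_on {0<..}"
    by (rule integrable_Ioi_decay[OF continuous_on_norm[OF cont]]) (use le in simp)
  ultimately show ?thesis by (simp add: absolutely_integrable_on_def)
qed

text \<open>Rescaling each integral by its own \<open>b k\<close> evaluates all summands at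
  multiples of one common \<open>\<mu>\<close>. Only then can sum and integral be exchanged and the
  pairing estimate be applied pointwise in \<open>\<mu>\<close>.\<close>

lemma kernel_integral_bound:
  assumes \<nu>: "\<sigma> < \<nu>" "\<nu> < \<tau>"
  obtains M where "0 \<le> M" "\<forall>f x n \<beta> K \<theta>. dual_elem f \<longrightarrow> (\<forall>y. cmod (f y) \<le> norm y) \<longrightarrow> n \<ge> 1 \<longrightarrow> 0 < \<beta> \<longrightarrow>
    \<theta> = \<nu> \<or> \<theta> = - \<nu> \<longrightarrow>
    (\<Sum>k<K. integral {0<..} (\<lambda>t. cmod (kernel f x n (\<beta> * 2 ^ k) (of_real t * cis \<theta>)))) \<le> M * norm x"
proof -
  have \<nu>': "\<omega> < \<nu>" "0 \<le> \<nu>" "\<nu> < pi" using \<nu> sigma omega by auto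
  obtain c where "sector_constant \<nu> c" using sector_constant_exists[OF \<nu>'(2,3)] .
  then interpret sector_constant \<nu> c .
  obtain M where M0: "0 \<le> M" and M1: "\<forall>f x \<mu> \<beta> K. dual_elem f \<longrightarrow> (\<forall>y. cmod (f y) \<le> norm y) \<longrightarrow> \<mu> \<noteq> 0 \<longrightarrow> \<bar>Arg \<mu>\<bar> = \<nu> \<longrightarrow> 0 < \<beta> \<longrightarrow>
    (\<Sum>k<K. cmod (f (F (of_real (\<beta> * 2 ^ k) * \<mu>)
        (pole_diff_op (of_real (\<beta> * 2 ^ k) * \<mu>) (- of_real (\<beta> * 2 ^ k)) (Q (\<beta> * 2 ^ k) x)))))
      \<le> M * ((1 + cmod \<mu>) / sqrt (cmod \<mu>)) * norm x"
    using U_bounded_pairing[OF \<nu>] by blast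
  note M = M0 M1[rule_format]
  define L where "L = 2 / c * (25 / c ^ 4)"
  have L: "0 \<le> L" using c by (simp add: L_def)
  have "(\<Sum>k<K. integral {0<..} (\<lambda>t. cmod (kernel f x n (\<beta> * 2 ^ k) (of_real t * cis \<theta>)))) \<le> (L * M * pi) * norm x"
    if f: "dual_elem f" "\<And>y. cmod (f y) \<le> norm y" and n: "n \<ge> 1" and \<beta>: "0 < \<beta>" and \<theta>: "\<theta> = \<nu> \<or> \<theta> = - \<nu>"
    for f x n \<beta> K \<theta>
  proof -
    define b where "b k = \<beta> * 2 ^ k" for k :: nat
    have b: "b k > 0" for k using \<beta> by (simp add: b_def)
    let ?g = "\<lambda>k s. b k * cmod (kernel f x n (b k) (of_real (b k) * (of_real s * cis \<theta>)))"
    have "(\<lambda>t. kernel f x n (b k) (of_real t * cis \<theta>)) absolutely_integrable_on {0<..}" for k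
    proof -
      obtain C where "0 \<le> C" "\<And>l. l \<noteq> 0 \<Longrightarrow> \<bar>Arg l\<bar> = \<nu> \<Longrightarrow> cmod (kernel f x n (b k) l) \<le> C / (1 + cmod l)\<^sup>2"
        using kernel_bound[OF \<nu>'(1) \<nu>(2) n b f(2)] by metis
      then show ?thesis
        by (intro ray_absolutely_integrable[OF \<nu>'(1) \<nu>(2) \<theta> holomorphic_kernel[OF n b f(1)]])
    qed
    note resc = integral_ray_rescale[OF this b]
    have "(\<Sum>k<K. integral {0<..} (\<lambda>t. cmod (kernel f x n (b k) (of_real t * cis \<theta>)))) = (\<Sum>k<K. integral {0<..} (?g k))"
      by (intro sum.cong refl resc(2))
    also have "\<dots> = integral {0<..} (\<lambda>s. \<Sum>k<K. ?g k s)"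
      by (rule integral_sum[symmetric]) (use resc(1) in auto)
    also have "\<dots> \<le> integral {0<..} (\<lambda>s. L * M * norm x * (1 / (sqrt s * (1 + s))))"
    proof (rule integral_le)
      show "(\<lambda>s. \<Sum>k<K. ?g k s) integrable_on {0<..}" by (rule integrable_sum) (use resc(1) in auto)
      show "(\<lambda>s. L * M * norm x * (1 / (sqrt s * (1 + s)))) integrable_on {0<..}"
        using has_integral_mult_right[OF has_integral_inverse_sqrt, of "L * M * norm x"] by (auto simp: integrable_on_def)
      fix s :: real assume "s \<in> {0<..}"
      then have s: "s > 0" by simp
      define \<mu> where "\<mu> = of_real s * cis \<theta>"
      note \<mu> = ray_facts[OF \<nu>'(1) \<nu>(2) s \<theta>, folded \<mu>_def]
      let ?p = "\<lambda>k. cmod (f (F (of_real (b k) * \<mu>) (pole_diff_op (of_real (b k) * \<mu>) (- of_real (b k)) (Q (b k) x))))"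
      have "?g k s \<le> L / (1 + s)\<^sup>2 * ?p k" for k
      proof -
        have l: "of_real (b k) * \<mu> \<noteq> 0" "\<bar>Arg (of_real (b k) * \<mu>)\<bar> \<le> \<nu>" using b[of k] \<mu> by auto
        have "cmod (phi n (of_real (b k) * \<mu>)) * cmod (weight (b k) (of_real (b k) * \<mu>))
          \<le> 2 / c * (25 / c ^ 4 * (b k / (b k + cmod (of_real (b k) * \<mu>))\<^sup>2))"
          using l n b c by (intro mult_mono phi_le weight_le) auto
        \<comment> \<open>From here on the scale cancels: the Jacobian \<open>b k\<close> and the
          numerator of the weight absorb the square of \<open>b k\<close> in the
          denominator.\<close>
        also have "b k + cmod (of_real (b k) * \<mu>) = b k * (1 + s)"
          using b[of k] \<mu> by (simp add: norm_mult algebra_simps)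
        finally have "b k * (cmod (phi n (of_real (b k) * \<mu>)) * cmod (weight (b k) (of_real (b k) * \<mu>)))
          \<le> b k * (2 / c * (25 / c ^ 4 * (b k / (b k * (1 + s))\<^sup>2)))"
          using b[of k] by (intro mult_left_mono) auto
        also have "\<dots> = L / (1 + s)\<^sup>2"
          using b[of k] s by (simp add: L_def power_mult_distrib power2_eq_square)
        finally have "b k * (cmod (phi n (of_real (b k) * \<mu>)) * cmod (weight (b k) (of_real (b k) * \<mu>))) * ?p k
          \<le> L / (1 + s)\<^sup>2 * ?p k" by (rule mult_right_mono) simp
        then show ?thesis by (simp add: kernel_def norm_mult \<mu>_def mult.assoc)
      qed
      then have "(\<Sum>k<K. ?g k s) \<le> L / (1 + s)\<^sup>2 * (\<Sum>k<K. ?p k)"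
        unfolding sum_distrib_left by (rule sum_mono)
      also have "\<dots> \<le> L / (1 + s)\<^sup>2 * (M * ((1 + s) / sqrt s) * norm x)"
        unfolding b_def using M(2)[OF f \<mu>(1,2) \<beta>, where K = K and x = x] \<mu>(3) L by (intro mult_left_mono) auto
      also have "\<dots> = L * M * norm x * (1 / (sqrt s * (1 + s)))"
        using s by (simp add: power2_eq_square mult_ac)
      finally show "(\<Sum>k<K. ?g k s) \<le> L * M * norm x * (1 / (sqrt s * (1 + s)))" .
    qed
    also have "\<dots> = L * M * norm x * pi"
      by (rule integral_unique, rule has_integral_mult_right, rule has_integral_inverse_sqrt)
    finally show ?thesis by (simp add: b_def mult_ac)
  qed
  moreover have "0 \<le> L * M * pi" using L M by simp
  ultimately show ?thesis by (intro that[of "L * M * pi"]) blast+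
qed

section \<open>Removal of the partition of unity and independence of the angle\<close>

definition integrand :: "('a \<Rightarrow> complex) \<Rightarrow> 'a \<Rightarrow> nat \<Rightarrow> complex \<Rightarrow> complex" where
  "integrand f x n l = phi n l * f (F l (R l x))"

lemma holomorphic_integrand:
  assumes "n \<ge> 1" "dual_elem f"
  shows "integrand f x n holomorphic_on sector \<tau> \<inter> res_set"
  unfolding integrand_def[abs_def]
  using sector_subset assms
  by (intro holomorphic_on_mult holomorphic_F_resolv holomorphic_on_subset[OF holomorphic_phi]) auto

text \<open>The regulariser contributes \<open>cmod l / (1 + cmod l)^2\<close> and the resolvent
  \<open>1 / cmod l\<close>; the constant depends on \<open>n\<close>.\<close>

lemma integrand_bound:
  assumes \<nu>: "\<omega> < \<nu>1" "\<nu>1 \<le> \<nu>2" "\<nu>2 < \<tau>" and n: "n \<ge> 1" and f: "\<And>y. cmod (f y) \<le> norm y"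
  obtains C where "0 \<le> C" "\<And>l. l \<noteq> 0 \<Longrightarrow> \<nu>1 \<le> \<bar>Arg l\<bar> \<Longrightarrow> \<bar>Arg l\<bar> \<le> \<nu>2 \<Longrightarrow> cmod (integrand f x n l) \<le> C / (1 + cmod l)\<^sup>2"
proof -
  have \<nu>': "\<nu>1 < pi" "0 \<le> \<nu>2" "\<nu>2 < pi" using \<nu> sigma omega by auto
  have "Arg (- of_nat n) = pi" "Arg (- (1 / of_nat n)) = pi"
    using n Arg_uminus_of_real[of "real n"] Arg_uminus_of_real[of "1 / real n"] by auto
  then obtain P where P: "0 \<le> P" "\<And>z. z \<noteq> 0 \<Longrightarrow> \<bar>Arg z\<bar> \<le> \<nu>2 \<Longrightarrow> cmod (phi n z) \<le> P * cmod z / (1 + cmod z)\<^sup>2"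
    using pole_diff_bound[of \<nu>2 "- of_nat n" "- (1 / of_nat n)"] \<nu>' n unfolding phi_eq_pole_diff[OF n] by auto
  obtain G where G: "0 \<le> G" "\<And>z y. z \<in> sector \<rho> \<Longrightarrow> cmod (f (F z y)) \<le> G * norm y"
    using F_functional_bound[OF f] by blast
  obtain K where K: "0 \<le> K" "\<And>l x. l \<noteq> 0 \<Longrightarrow> \<nu>1 \<le> \<bar>Arg l\<bar> \<Longrightarrow> norm (R l x) \<le> K / cmod l * norm x"
    using resolv_bound[OF \<nu>(1) \<nu>'(1)] by blast
  have "cmod (integrand f x n l) \<le> (P * (G * K * norm x)) / (1 + cmod l)\<^sup>2"
    if l: "l \<noteq> 0" "\<nu>1 \<le> \<bar>Arg l\<bar>" "\<bar>Arg l\<bar> \<le> \<nu>2" for l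
  proof -
    have ls: "l \<in> sector \<rho>" using l \<nu> sigma by (auto simp: sector_def)
    have "cmod (integrand f x n l) \<le> (P * cmod l / (1 + cmod l)\<^sup>2) * (G * (K / cmod l * norm x))"
      unfolding integrand_def norm_mult using l P(1) G(1)
      by (intro mult_mono P order_trans[OF G(2)[OF ls]] mult_left_mono K) auto
    also have "\<dots> = (P * (G * K * norm x)) / (1 + cmod l)\<^sup>2" using l by simp
    finally show ?thesis .
  qed
  moreover have "0 \<le> P * (G * K * norm x)" using P G K by simp
  ultimately show ?thesis using that by blast
qed

lemma ray_diff_integrable:
  assumes \<nu>: "\<omega> < \<nu>" "\<nu> < \<tau>" and h: "h holomorphic_on sector \<tau> \<inter> res_set"
    and C: "\<And>l. l \<noteq> 0 \<Longrightarrow> \<bar>Arg l\<bar> = \<nu> \<Longrightarrow> cmod (h l) \<le> C / (1 + cmod l)\<^sup>2"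
  shows "ray_diff \<nu> h integrable_on {0<..}"
    and "cmod (integral {0<..} (ray_diff \<nu> h)) \<le> integral {0<..} (\<lambda>t. cmod (h (of_real t * cis (- \<nu>))))
      + integral {0<..} (\<lambda>t. cmod (h (of_real t * cis \<nu>)))"
proof -
  have ac: "(\<lambda>t. h (of_real t * cis \<theta>)) absolutely_integrable_on {0<..}" if "\<theta> = \<nu> \<or> \<theta> = - \<nu>" for \<theta>
    by (rule ray_absolutely_integrable[OF \<nu> that h C])
  have int: "(\<lambda>t. h (of_real t * cis \<theta>)) integrable_on {0<..}" "(\<lambda>t. cmod (h (of_real t * cis \<theta>))) integrable_on {0<..}"
    if "\<theta> = \<nu> \<or> \<theta> = - \<nu>" for \<theta>
    using ac[OF that] by (auto simp: absolutely_integrable_on_def)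
  show ri: "ray_diff \<nu> h integrable_on {0<..}"
    unfolding ray_diff_def[abs_def] by (intro integrable_diff integrable_on_mult_left int) auto
  have "cmod (integral {0<..} (ray_diff \<nu> h)) \<le> integral {0<..} (\<lambda>t. cmod (h (of_real t * cis (- \<nu>))) + cmod (h (of_real t * cis \<nu>)))"
  proof (rule Henstock_Kurzweil_Integration.integral_norm_bound_integral[OF ri])
    show "(\<lambda>t. cmod (h (of_real t * cis (- \<nu>))) + cmod (h (of_real t * cis \<nu>))) integrable_on {0<..}"
      by (intro integrable_add int) auto
    show "cmod (ray_diff \<nu> h t) \<le> cmod (h (of_real t * cis (- \<nu>))) + cmod (h (of_real t * cis \<nu>))" for t
      unfolding ray_diff_def by (rule order_trans[OF norm_triangle_ineq4]) (simp add: norm_mult)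
  qed
  then show "cmod (integral {0<..} (ray_diff \<nu> h)) \<le> integral {0<..} (\<lambda>t. cmod (h (of_real t * cis (- \<nu>))))
      + integral {0<..} (\<lambda>t. cmod (h (of_real t * cis \<nu>)))"
    by (subst (asm) integral_add) (auto intro: int)
qed

text \<open>The uniform bound for the integrals with \<open>\<psi>\<close> passes to the limit by
  dominated convergence, since the partial sums of bumps are uniformly bounded on the rays. The
  factor \<open>2\<close> counts the two rays.\<close>

lemma integrand_integral_bound:
  assumes \<nu>: "\<sigma> < \<nu>" "\<nu> < \<tau>"
  obtains M where "0 \<le> M" "\<forall>f x n. dual_elem f \<longrightarrow> (\<forall>y. cmod (f y) \<le> norm y) \<longrightarrow> n \<ge> 1 \<longrightarrow>
    cmod (integral {0<..} (ray_diff \<nu> (integrand f x n))) \<le> M * norm x"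
proof -
  have \<nu>': "\<omega> < \<nu>" "0 \<le> \<nu>" "\<nu> < pi" using \<nu> sigma omega by auto
  obtain c where "sector_constant \<nu> c" using sector_constant_exists[OF \<nu>'(2,3)] .
  then interpret sector_constant \<nu> c .
  obtain M where M0: "0 \<le> M" and M1: "\<forall>f x n \<beta> K \<theta>. dual_elem f \<longrightarrow> (\<forall>y. cmod (f y) \<le> norm y) \<longrightarrow> n \<ge> 1 \<longrightarrow> 0 < \<beta> \<longrightarrow>
    \<theta> = \<nu> \<or> \<theta> = - \<nu> \<longrightarrow>
    (\<Sum>k<K. integral {0<..} (\<lambda>t. cmod (kernel f x n (\<beta> * 2 ^ k) (of_real t * cis \<theta>)))) \<le> M * norm x"
    using kernel_integral_bound[OF \<nu>] by blast
  note M = M0 M1[rule_format]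
  have "cmod (integral {0<..} (ray_diff \<nu> (integrand f x n))) \<le> (2 * M) * norm x"
    if f: "dual_elem f" "\<And>y. cmod (f y) \<le> norm y" and n: "n \<ge> 1" for f x n
  proof -
    define \<beta> where "\<beta> N = (1/2 :: real) ^ N" for N :: nat
    have \<beta>: "\<beta> N > 0" "\<beta> N * 2 ^ k > 0" for N k by (auto simp: \<beta>_def)
    define g where "g N l = (\<Sum>k<2 * N. bump (\<beta> N * 2 ^ k) l) * integrand f x n l" for N l
    have g_eq: "ray_diff \<nu> (g N) t = (\<Sum>k<2 * N. ray_diff \<nu> (kernel f x n (\<beta> N * 2 ^ k)) t + ray_diff \<nu> (remainder f x n (\<beta> N * 2 ^ k)) t)"
      if t: "t \<in> {0<..}" for N t
    proof -
      have *: "g N (of_real t * cis \<theta>) = (\<Sum>k<2 * N. kernel f x n (\<beta> N * 2 ^ k) (of_real t * cis \<theta>) + remainder f x n (\<beta> N * 2 ^ k) (of_real t * cis \<theta>))"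
        if "\<theta> = \<nu> \<or> \<theta> = - \<nu>" for \<theta>
        unfolding g_def integrand_def sum_distrib_right
        using ray_facts[OF \<nu>'(1) \<nu>(2) _ that, of t] t \<nu>(2)
        by (intro sum.cong refl bump_resolv[OF f(1) \<beta>(2)]) auto
      show ?thesis
        unfolding ray_diff_def *[OF disjI1[OF refl]] *[OF disjI2[OF refl]] sum_distrib_right sum_subtractf[symmetric]
        by (intro sum.cong refl) (simp add: algebra_simps)
    qed
    have ker: "ray_diff \<nu> (kernel f x n b) integrable_on {0<..}"
      "cmod (integral {0<..} (ray_diff \<nu> (kernel f x n b))) \<le> integral {0<..} (\<lambda>t. cmod (kernel f x n b (of_real t * cis (- \<nu>))))
        + integral {0<..} (\<lambda>t. cmod (kernel f x n b (of_real t * cis \<nu>)))" if b: "b > 0" for b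
    proof -
      obtain C where C: "0 \<le> C" "\<And>l. l \<noteq> 0 \<Longrightarrow> \<bar>Arg l\<bar> = \<nu> \<Longrightarrow> cmod (kernel f x n b l) \<le> C / (1 + cmod l)\<^sup>2"
        using kernel_bound[OF \<nu>'(1) \<nu>(2) n b f(2)] by metis
      note * = ray_diff_integrable[OF \<nu>'(1) \<nu>(2) holomorphic_kernel[OF n b f(1)] C(2)]
      show "ray_diff \<nu> (kernel f x n b) integrable_on {0<..}" by (rule *(1))
      show "cmod (integral {0<..} (ray_diff \<nu> (kernel f x n b))) \<le> integral {0<..} (\<lambda>t. cmod (kernel f x n b (of_real t * cis (- \<nu>))))
        + integral {0<..} (\<lambda>t. cmod (kernel f x n b (of_real t * cis \<nu>)))" by (rule *(2))
    qed
    have rem: "(ray_diff \<nu> (remainder f x n b) has_integral 0) {0<..}" if b: "b > 0" for b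
    proof -
      obtain C where C: "0 \<le> C" "\<And>l. l \<noteq> 0 \<Longrightarrow> \<bar>Arg l\<bar> \<le> \<nu> \<Longrightarrow> cmod (remainder f x n b l) \<le> C / (1 + cmod l)\<^sup>2"
        using remainder_bound[OF \<nu>'(2) \<nu>(2) n b f(2)] by metis
      show ?thesis
        using ray_diff_holomorphic[OF \<nu>'(2) \<nu>(2) sigma(4) holomorphic_remainder[OF n b f(1)] C] .
    qed
    \<comment> \<open>The \<open>0\<close> in each summand is the integral of the remainder.\<close>
    have int_g: "(ray_diff \<nu> (g N) has_integral (\<Sum>k<2 * N. integral {0<..} (ray_diff \<nu> (kernel f x n (\<beta> N * 2 ^ k))) + 0)) {0<..}" for N
    proof (rule has_integral_eq[OF g_eq[symmetric]])
      show "((\<lambda>t. \<Sum>k<2 * N. ray_diff \<nu> (kernel f x n (\<beta> N * 2 ^ k)) t + ray_diff \<nu> (remainder f x n (\<beta> N * 2 ^ k)) t)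
        has_integral (\<Sum>k<2 * N. integral {0<..} (ray_diff \<nu> (kernel f x n (\<beta> N * 2 ^ k))) + 0)) {0<..}"
        by (intro has_integral_sum has_integral_add integrable_integral ker(1) rem \<beta>) auto
    qed
    have bound_g: "cmod (integral {0<..} (ray_diff \<nu> (g N))) \<le> 2 * M * norm x" for N
    proof -
      have "cmod (integral {0<..} (ray_diff \<nu> (g N))) \<le> (\<Sum>k<2 * N. cmod (integral {0<..} (ray_diff \<nu> (kernel f x n (\<beta> N * 2 ^ k)))))"
        unfolding integral_unique[OF int_g] by (rule order_trans[OF norm_sum]) simp
      also have "\<dots> \<le> (\<Sum>k<2 * N. integral {0<..} (\<lambda>t. cmod (kernel f x n (\<beta> N * 2 ^ k) (of_real t * cis (- \<nu>))))
        + integral {0<..} (\<lambda>t. cmod (kernel f x n (\<beta> N * 2 ^ k) (of_real t * cis \<nu>))))"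
        by (intro sum_mono ker(2) \<beta>)
      also have "\<dots> \<le> M * norm x + M * norm x"
        unfolding sum.distrib by (intro add_mono M(2) f n \<beta>) auto
      finally show ?thesis by simp
    qed
    obtain C where C: "0 \<le> C" "\<And>l. l \<noteq> 0 \<Longrightarrow> \<nu> \<le> \<bar>Arg l\<bar> \<Longrightarrow> \<bar>Arg l\<bar> \<le> \<nu> \<Longrightarrow> cmod (integrand f x n l) \<le> C / (1 + cmod l)\<^sup>2"
      using integrand_bound[OF \<nu>'(1) order_refl \<nu>(2) n f(2)] by metis
    define B where "B = 2 * (3 / c\<^sup>2 + 2 / c ^ 3)"
    have "(\<lambda>N. integral {0<..} (ray_diff \<nu> (g N))) \<longlonglongrightarrow> integral {0<..} (ray_diff \<nu> (integrand f x n))"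
    proof (rule dominated_convergence(2))
      show "ray_diff \<nu> (g N) integrable_on {0<..}" for N using int_g by (auto simp: integrable_on_def)
      show "(\<lambda>t. 2 * (B * C) / (1 + t)\<^sup>2) integrable_on {0<..}"
        by (rule integrable_Ioi_decay[where C = "\<bar>2 * (B * C)\<bar>"])
           (auto intro!: continuous_intros simp: add_eq_0_iff power2_eq_square abs_mult)
      fix N and t :: real assume t: "t \<in> {0<..}"
      have *: "cmod (g N (of_real t * cis \<theta>)) \<le> B * C / (1 + t)\<^sup>2" if "\<theta> = \<nu> \<or> \<theta> = - \<nu>" for \<theta>
      proof -
        have r: "of_real t * cis \<theta> \<noteq> 0" "\<bar>Arg (of_real t * cis \<theta>)\<bar> = \<nu>" "cmod (of_real t * cis \<theta>) = t"
          using ray_facts[OF \<nu>'(1) \<nu>(2) _ that, of t] t by auto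
        have "cmod (integrand f x n (of_real t * cis \<theta>)) \<le> C / (1 + t)\<^sup>2"
          by (rule C(2)[OF r(1), unfolded r(2,3), OF order_refl order_refl])
        moreover have "cmod (\<Sum>k<2 * N. bump (\<beta> N * 2 ^ k) (of_real t * cis \<theta>)) \<le> B"
          unfolding B_def by (rule sum_bump_le[OF r(1) eq_refl[OF r(2)] \<beta>(1)])
        moreover have "0 \<le> B" using c by (simp add: B_def)
        ultimately show ?thesis
          unfolding g_def norm_mult times_divide_eq_right[symmetric] by (intro mult_mono norm_ge_zero)
      qed
      have "cmod (ray_diff \<nu> (g N) t) \<le> cmod (g N (of_real t * cis (- \<nu>))) + cmod (g N (of_real t * cis \<nu>))"
        unfolding ray_diff_def by (rule order_trans[OF norm_triangle_ineq4]) (simp add: norm_mult)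
      also have "\<dots> \<le> B * C / (1 + t)\<^sup>2 + B * C / (1 + t)\<^sup>2" by (intro add_mono *) auto
      finally show "cmod (ray_diff \<nu> (g N) t) \<le> 2 * (B * C) / (1 + t)\<^sup>2" by simp
    next
      fix t :: real assume t: "t \<in> {0<..}"
      have "(\<lambda>N. g N l) \<longlonglongrightarrow> 1 * integrand f x n l" if "l \<noteq> 0" for l
        unfolding g_def \<beta>_def by (intro tendsto_mult tendsto_sum_bump that tendsto_const)
      then show "(\<lambda>N. ray_diff \<nu> (g N) t) \<longlonglongrightarrow> ray_diff \<nu> (integrand f x n) t"
        unfolding ray_diff_def using t by (intro tendsto_diff tendsto_mult tendsto_const) auto
    qed
    then have "(\<lambda>N. cmod (integral {0<..} (ray_diff \<nu> (g N)))) \<longlonglongrightarrow> cmod (integral {0<..} (ray_diff \<nu> (integrand f x n)))"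
      by (rule tendsto_norm)
    then show ?thesis using bound_g by (intro LIMSEQ_le_const2) auto
  qed
  moreover have "0 \<le> 2 * M" using M by simp
  ultimately show ?thesis by (intro that[of "2 * M"]) blast+
qed

text \<open>Lets the estimate, available only above \<open>\<sigma>\<close>, serve every angle
  between \<open>\<omega>\<close> and \<open>\<tau>\<close>.\<close>

lemma integral_ray_diff_eq:
  assumes \<nu>: "\<omega> < \<nu>1" "\<nu>1 < \<tau>" "\<omega> < \<nu>2" "\<nu>2 < \<tau>"
    and f: "dual_elem f" "\<And>y. cmod (f y) \<le> norm y" and n: "n \<ge> 1"
  shows "integral {0<..} (ray_diff \<nu>1 (integrand f x n)) = integral {0<..} (ray_diff \<nu>2 (integrand f x n))"
proof -
  let ?h = "integrand f x n"
  have set_eq: "{z. z \<noteq> 0 \<and> \<omega> < \<bar>Arg z\<bar> \<and> \<bar>Arg z\<bar> < \<tau>} = sector \<tau> \<inter> res_set"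
    by (auto simp: sector_def res_set_def)
  have eq: "integral {0<..} (ray_diff a ?h) = integral {0<..} (ray_diff b ?h)" if ab: "\<omega> < a" "a \<le> b" "b < \<tau>" for a b
  proof -
    obtain C where C: "0 \<le> C" "\<And>l. l \<noteq> 0 \<Longrightarrow> a \<le> \<bar>Arg l\<bar> \<Longrightarrow> \<bar>Arg l\<bar> \<le> b \<Longrightarrow> cmod (?h l) \<le> C / (1 + cmod l)\<^sup>2"
      using integrand_bound[OF ab n f(2)] by metis
    have zero: "((\<lambda>t. ray_diff a ?h t - ray_diff b ?h t) has_integral 0) {0<..}"
      by (rule ray_diff_shift[OF omega(1) ab sigma(4) _ C]) (use holomorphic_integrand[OF n f(1)] in \<open>simp_all add: set_eq\<close>)
    have int: "ray_diff d ?h integrable_on {0<..}" if d: "a \<le> d" "d \<le> b" for d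
    proof (rule ray_diff_integrable(1)[OF _ _ holomorphic_integrand[OF n f(1)]])
      show "\<omega> < d" "d < \<tau>" using ab d by auto
      show "cmod (?h l) \<le> C / (1 + cmod l)\<^sup>2" if "l \<noteq> 0" "\<bar>Arg l\<bar> = d" for l
        using that d by (intro C(2)) auto
    qed
    have "integral {0<..} (ray_diff a ?h) - integral {0<..} (ray_diff b ?h) = 0"
      using integral_diff[OF int[OF order_refl ab(2)] int[OF ab(2) order_refl]] integral_unique[OF zero] by simp
    then show ?thesis by simp
  qed
  show ?thesis
  proof (cases "\<nu>1 \<le> \<nu>2")
    case True
    then show ?thesis by (rule eq[OF \<nu>(1) _ \<nu>(4)])
  next
    case False
    then have "\<nu>2 \<le> \<nu>1" by simp
    then show ?thesis by (rule eq[OF \<nu>(3) _ \<nu>(2), symmetric])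
  qed
qed

lemma phiF_calc_bound:
  obtains M where "\<And>\<nu> n x. \<omega> < \<nu> \<Longrightarrow> \<nu> < \<tau> \<Longrightarrow> n \<ge> 1 \<Longrightarrow> norm (phiF_calc D A \<nu> n F x) \<le> M * norm x"
proof -
  \<comment> \<open>Any angle strictly between works: above \<open>\<sigma>\<close> for the scalar
    calculus, below \<open>\<tau>\<close> for the domain of \<open>F\<close>.\<close>
  define \<nu>0 where "\<nu>0 = (\<sigma> + \<tau>) / 2"
  have \<nu>0: "\<sigma> < \<nu>0" "\<nu>0 < \<tau>" "\<omega> < \<nu>0" using sigma by (auto simp: \<nu>0_def)
  obtain M where M0: "0 \<le> M" and M1: "\<forall>f x n. dual_elem f \<longrightarrow> (\<forall>y. cmod (f y) \<le> norm y) \<longrightarrow> n \<ge> 1 \<longrightarrow>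
    cmod (integral {0<..} (ray_diff \<nu>0 (integrand f x n))) \<le> M * norm x"
    using integrand_integral_bound[OF \<nu>0(1,2)] by blast
  note M = M0 M1[rule_format]
  have "norm (phiF_calc D A \<nu> n F x) \<le> (1 / (2 * pi) * M) * norm x"
    if \<nu>: "\<omega> < \<nu>" "\<nu> < \<tau>" and n: "n \<ge> 1" for \<nu> n x
  proof -
    let ?I = "\<lambda>t. cscale (cis (- \<nu>)) (cscale (phi n (of_real t * cis (- \<nu>))) (F (of_real t * cis (- \<nu>)) (R (of_real t * cis (- \<nu>)) x)))
      - cscale (cis \<nu>) (cscale (phi n (of_real t * cis \<nu>)) (F (of_real t * cis \<nu>) (R (of_real t * cis \<nu>) x)))"
    have "norm (integral {0<..} ?I) \<le> M * norm x"
    \<comment> \<open>Only the weak integrals have been shown to exist. If the vector integral did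
      not, \<open>integral\<close> would take its default value \<open>0\<close> and the bound would
      be trivial.\<close>
    proof (cases "?I integrable_on {0<..}")
      case True
      obtain f where f: "dual_elem f" "\<And>y. cmod (f y) \<le> norm y" "f (integral {0<..} ?I) = of_real (norm (integral {0<..} ?I))"
        using norming_functional by blast
      have "f (integral {0<..} ?I) = integral {0<..} (f \<circ> ?I)"
        using True f(1) by (intro integral_linear[symmetric]) (auto simp: dual_elem_def)
      also have "f \<circ> ?I = ray_diff \<nu> (integrand f x n)"
        using f(1) by (auto simp: fun_eq_iff ray_diff_def integrand_def dual_elem_simps)
      also have "integral {0<..} \<dots> = integral {0<..} (ray_diff \<nu>0 (integrand f x n))"
        by (rule integral_ray_diff_eq[OF \<nu> \<nu>0(3,2) f(1,2) n])
      finally have "cmod (of_real (norm (integral {0<..} ?I))) = cmod (integral {0<..} (ray_diff \<nu>0 (integrand f x n)))"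
        unfolding f(3) by (rule arg_cong)
      then have "norm (integral {0<..} ?I) = cmod (integral {0<..} (ray_diff \<nu>0 (integrand f x n)))"
        unfolding norm_of_real abs_norm_cancel .
      then show ?thesis using M(2)[OF f(1,2) n] by (simp only:)
    qed (use M in \<open>simp add: not_integrable_integral\<close>)
    then have "cmod (1 / (2 * complex_of_real pi * \<i>)) * norm (integral {0<..} ?I) \<le> 1 / (2 * pi) * (M * norm x)"
      by (intro mult_mono) (auto simp: norm_divide norm_mult)
    then show ?thesis
      unfolding phiF_calc_def sect_int_def by (simp only: norm_cscale mult.assoc)
  qed
  then show ?thesis by (rule that)
qed

end

theorem theorem4p4:
  fixes D :: "'a::complex_banach set" and A :: "'a \<Rightarrow> 'a"
    and \<omega> \<sigma> \<rho> :: real and F :: "complex \<Rightarrow> 'a \<Rightarrow> 'a"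
  assumes "sectorial D A \<omega>"
    and "Hinf_calculus D A \<omega> \<sigma>"
    and "\<rho> > \<sigma>"
    and "Hinf_op D A \<rho> F"
    and "U_bounded (F ` sector \<rho>)"
  shows "\<forall>\<nu>. \<omega> < \<nu> \<and> \<nu> < \<rho> \<and> \<nu> < pi \<longrightarrow>
           (\<exists>M. \<forall>n\<ge>1. \<forall>x. norm (phiF_calc D A \<nu> n F x) \<le> M * norm x)"
proof -
  interpret operator_valued_calculus D A \<omega> \<sigma> \<rho> F
    using assms by unfold_locales
  obtain M where M: "\<And>\<nu> n x. \<omega> < \<nu> \<Longrightarrow> \<nu> < \<tau> \<Longrightarrow> n \<ge> 1 \<Longrightarrow> norm (phiF_calc D A \<nu> n F x) \<le> M * norm x"
    using phiF_calc_bound by blast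
  show ?thesis
  \<comment> \<open>The same \<open>M\<close> serves all angles, since each integral equals the one
    at the fixed angle.\<close>
  proof (intro allI impI, rule exI[of _ M], intro allI impI)
    fix \<nu> n x assume "\<omega> < \<nu> \<and> \<nu> < \<rho> \<and> \<nu> < pi" "n \<ge> (1 :: nat)"
    then show "norm (phiF_calc D A \<nu> n F x) \<le> M * norm x" by (intro M) (auto simp: \<tau>_def)
  qed
qed

end
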